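(* Let $a,b\in\mathbb{R}$ and consider the linear neutral delay differential equation $$y'(t)+y'(t-1)+a\,y(t)+b\,y(t-1)=0,\quad t>0,$$ with characteristic equation $\lambda(e^\lambda+1)+a\,e^\lambda+b=0$, $\lambda\in\mathbb{C}$, whose roots are denoted $\lambda_n$. The stability of the solution $y=0$ is as follows. Open quadrants (only one is asymptotically stable, the other three are unstable): - if $a>|b|$: asymptotic stability, and $\Re(\lambda_n)<0$ for all $n$; - if $b<-|a|$: instability, and $\Re(\lambda_n)>0$ for all $n$; - if $b>|a|$: instability, and $\Re(\lambda_n)>0$ for all roots except one root, which has $\Re(\lambda)<0$; - if $a<-|b|$: instability, and $\Re(\lambda_n)<0$ for all roots except one root, which has $\Re(\lambda)>0$. Edges: - if $a=|b|\neq 0$: stability, and $\Re(\lambda_n)=0$ for all roots, except one root $\lambda=-a<0$ if $b>0$; - if $-a=b>0$: stability, and the spectrum is contained in $i\mathbb{R}$, i.e. $\Re(\lambda_n)=0$ for all $n$; - if $a=b<0$: instability, and $\Re(\lambda_n)=0$ for all roots except one positive root $\lambda=-a>0$. Finally, $a=0$, $b=0$ is a stable case.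
   Context: Characteristic roots are the $\lambda\in\mathbb{C}$ such that $y(t)=e^{\lambda t}$ solves the equation; there are countably many, and the set of them is called the spectrum. Solutions $y\in H^1_{loc}((-1,+\infty))$ are those with initial data $y=y_0\in H^1((-1,0))$ on $(-1,0)$. Stability, asymptotic stability and instability of $y=0$ have their usual (Lyapunov) meaning with respect to the initial datum $y_0$.
   Formalization: On the edge -a=b>0, stability is claimed only for b<2 and the spectrum in iR only for b≤2: for b=2, y(t)=t is an unbounded solution, and for b>2 there is a positive real characteristic root, so the printed claim fails there. *)

theory Defs
  imports "HOL-Analysis.Analysis"
begin

section \<open>Sobolev spaces of order one on open subsets of the real line\<close>

text \<open>Elements of these spaces are represented by functions on the whole line; only their values
  almost everywhere on the open set \<open>U\<close> matter.\<close>

definition square_integrable_on :: "real set \<Rightarrow> (real \<Rightarrow> real) \<Rightarrow> bool" where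
  "square_integrable_on U f \<longleftrightarrow>
     f \<in> borel_measurable (lebesgue_on U) \<and> integrable (lebesgue_on U) (\<lambda>x. (f x)\<^sup>2)"

definition locally_integrable_on :: "real set \<Rightarrow> (real \<Rightarrow> real) \<Rightarrow> bool" where
  "locally_integrable_on U f \<longleftrightarrow> (\<forall>K. compact K \<and> K \<subseteq> U \<longrightarrow> f absolutely_integrable_on K)"

text \<open>Test functions are of class \<open>C\<^sup>1\<close> with compact support in \<open>U\<close>. By mollification they define
  the same weak derivatives as smooth compactly supported ones.\<close>

definition test_function :: "real set \<Rightarrow> (real \<Rightarrow> real) \<Rightarrow> bool" where
  "test_function U \<phi> \<longleftrightarrow>
     \<phi> C1_differentiable_on UNIV \<and> (\<exists>K. compact K \<and> K \<subseteq> U \<and> (\<forall>x. x \<notin> K \<longrightarrow> \<phi> x = 0))"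

definition has_weak_deriv :: "real set \<Rightarrow> (real \<Rightarrow> real) \<Rightarrow> (real \<Rightarrow> real) \<Rightarrow> bool" where
  "has_weak_deriv U f g \<longleftrightarrow>
     locally_integrable_on U f \<and> locally_integrable_on U g \<and>
     (\<forall>\<phi>. test_function U \<phi> \<longrightarrow>
        (LINT x|lebesgue_on U. f x * deriv \<phi> x) = - (LINT x|lebesgue_on U. g x * \<phi> x))"

definition H1 :: "real set \<Rightarrow> (real \<Rightarrow> real) set" where
  "H1 U = {f. square_integrable_on U f \<and> (\<exists>g. has_weak_deriv U f g \<and> square_integrable_on U g)}"

text \<open>Weak derivatives are unique almost everywhere on \<open>U\<close>, so the norm does not depend on the
  choice made here.\<close>

definition weak_deriv :: "real set \<Rightarrow> (real \<Rightarrow> real) \<Rightarrow> real \<Rightarrow> real" where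
  "weak_deriv U f = (SOME g. has_weak_deriv U f g)"

definition H1_norm :: "real set \<Rightarrow> (real \<Rightarrow> real) \<Rightarrow> real" where
  "H1_norm U f =
     sqrt ((LINT x|lebesgue_on U. (f x)\<^sup>2) + (LINT x|lebesgue_on U. (weak_deriv U f x)\<^sup>2))"

definition H1_loc :: "real set \<Rightarrow> (real \<Rightarrow> real) set" where
  "H1_loc U = {f. \<forall>V. open V \<and> compact (closure V) \<and> closure V \<subseteq> U \<longrightarrow> f \<in> H1 V}"

section \<open>The neutral delay equation \<open>y'(t) + y'(t - 1) + a y(t) + b y(t - 1) = 0\<close>\<close>

definition neutral_solution ::
    "real \<Rightarrow> real \<Rightarrow> (real \<Rightarrow> real) \<Rightarrow> (real \<Rightarrow> real) \<Rightarrow> bool" where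
  "neutral_solution a b y0 y \<longleftrightarrow>
     y0 \<in> H1 {-1<..<0} \<and> y \<in> H1_loc {-1<..} \<and>
     (AE t in lebesgue_on {-1<..<0}. y t = y0 t) \<and>
     (\<exists>y'. has_weak_deriv {-1<..} y y' \<and>
        (AE t in lebesgue_on {0<..}. y' t + y' (t - 1) + a * y t + b * y (t - 1) = 0))"

text \<open>The state at time \<open>t\<close> is the history segment \<open>s \<mapsto> y (t + s)\<close> on \<open>(-1, 0)\<close>, measured in the
  norm of the space of initial data.\<close>

definition state_norm :: "(real \<Rightarrow> real) \<Rightarrow> real \<Rightarrow> real" where
  "state_norm y t = H1_norm {-1<..<0} (\<lambda>s. y (t + s))"

definition zero_stable :: "real \<Rightarrow> real \<Rightarrow> bool" where
  "zero_stable a b \<longleftrightarrow>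
     (\<forall>\<epsilon>>0. \<exists>\<delta>>0. \<forall>y0 y. neutral_solution a b y0 y \<and> H1_norm {-1<..<0} y0 < \<delta> \<longrightarrow>
        (\<forall>t\<ge>0. state_norm y t < \<epsilon>))"

definition zero_asymptotically_stable :: "real \<Rightarrow> real \<Rightarrow> bool" where
  "zero_asymptotically_stable a b \<longleftrightarrow>
     zero_stable a b \<and>
     (\<exists>\<eta>>0. \<forall>y0 y. neutral_solution a b y0 y \<and> H1_norm {-1<..<0} y0 < \<eta> \<longrightarrow>
        (state_norm y \<longlongrightarrow> 0) at_top)"

abbreviation zero_unstable :: "real \<Rightarrow> real \<Rightarrow> bool" where
  "zero_unstable a b \<equiv> \<not> zero_stable a b"

section \<open>Characteristic roots\<close>

text \<open>Pitfall: for \<open>- a = b > 0\<close> the roots are purely imaginary and the zero solution is stable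
  only while \<open>b\<close> is small enough. For \<open>b = 2\<close> the root \<open>0\<close> is triple and \<open>y t = t\<close> is an unbounded
  solution; for \<open>b > 2\<close> there are two further real roots \<open>z\<close> and \<open>-z\<close>, the nonzero solutions of
  \<open>tanh (z / 2) = z / b\<close>.\<close>

definition char_roots :: "real \<Rightarrow> real \<Rightarrow> complex set" where
  "char_roots a b = {z. z * (exp z + 1) + of_real a * exp z + of_real b = 0}"

lemma char_roots_iff_exp_solution:
  fixes a b :: real and z :: complex
  defines "y \<equiv> \<lambda>t::real. exp (z * of_real t)"
  shows "z \<in> char_roots a b \<longleftrightarrow>
    (\<forall>t>0. vector_derivative y (at t) + vector_derivative y (at (t - 1))
            + of_real a * y t + of_real b * y (t - 1) = 0)"
proof -
  have D: "vector_derivative y (at t) = z * y t" for t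
  proof -
    have "((\<lambda>w. exp (z * w)) has_field_derivative z * exp (z * of_real t)) (at (of_real t))"
      by (auto intro!: derivative_eq_intros)
    then have "(y has_vector_derivative z * y t) (at t)"
      unfolding y_def by (rule has_vector_derivative_real_field)
    then show ?thesis by (rule vector_derivative_at)
  qed
  have shift: "y t = exp z * y (t - 1)" for t
    by (simp add: y_def exp_add [symmetric] algebra_simps)
  have "vector_derivative y (at t) + vector_derivative y (at (t - 1))
          + of_real a * y t + of_real b * y (t - 1)
        = y (t - 1) * (z * (exp z + 1) + of_real a * exp z + of_real b)" for t
    unfolding D shift [of t] by (simp add: algebra_simps)
  moreover have "y t \<noteq> 0" for t by (simp add: y_def)
  ultimately show ?thesis
    by (auto simp: char_roots_def intro: exI [of _ 1])
qed

end

theory Submission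
  imports Defs
begin

text \<open>
  A solution has an absolutely continuous representative \<open>Y\<close> with derivative \<open>p\<close>. Squaring
  \<open>p(t) + a Y(t) = - (p(t - 1) + b Y(t - 1))\<close> shows that
  \<open>E(t) = \<integral>\<^bsub>[t-1,t]\<^esub> (p + b Y)\<^sup>2 + (a - b) Y(t)\<^sup>2\<close> satisfies \<open>E' = - (a\<^sup>2 - b\<^sup>2) Y\<^sup>2\<close>. For
  \<open>a \<ge> \<bar>b\<bar>\<close>, \<open>a > 0\<close>, this bounds the forcing of the stable equation \<open>Y' + a Y = r\<close>, hence \<open>Y\<close>.
  For \<open>a > \<bar>b\<bar>\<close> it gives moreover \<open>\<integral> Y\<^sup>2 < \<infinity>\<close>, which forces the energy of time averages
  of \<open>Y\<close> to vanish. For \<open>a = - b\<close> the quantities \<open>E\<close> and \<open>Y(t) + Y(t - 1) - b \<integral>\<^bsub>[t-1,t]\<^esub> Y\<close> are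
  both conserved, and \<open>E\<close> is coercive on the level sets of the latter as long as \<open>b < 2\<close>.

  Taking moduli in \<open>(z + a) e\<^sup>z = - (z + b)\<close> locates most of the roots; the others are
  found from \<open>z + (a + b)/2 = (b - a)/2 tanh (z/2)\<close>. A root in the right half-plane makes the
  zero solution unstable.
\<close>

section \<open>Square integrable functions on intervals\<close>

text \<open>The equation does not smooth: up to sign and lower order terms, \<open>p\<close> at time
  \<open>t\<close> repeats \<open>p\<close> at \<open>t - 1\<close>. The energy is therefore
  modelled on a delay line. The signal \<open>p + b Y\<close> leaves the present, is stored for one
  unit of time and returns as the forcing of \<open>Y' + a Y\<close>; its stored square norm changes
  only through \<open>Y\<close> at the present time. The obstacle is that the dissipation sees
  \<open>Y\<close> and never \<open>p\<close>, so it cannot by itself drive a norm containing the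
  derivative to zero. For \<open>a = - b\<close> the constants are solutions and the energy is
  negative on them when \<open>0 < b < 2\<close>; the conserved linear functional is what controls
  this direction, and it loses sight of constants at \<open>b = 2\<close>. Instability is drawn from
  a root, so where all roots lie to the right, or all but one, a root with positive real part must
  first be produced; a fixed point theorem supplies a nonreal one. Since \<open>p\<close> is merely
  square integrable, all identities are kept in integrated form over intervals, and the rules of
  calculus behind them are proved by adding up errors of second order over fine partitions.\<close>

lemma square_integrable_on_Icc_iff:
  "square_integrable_on {c..d} f \<longleftrightarrow>
     f \<in> borel_measurable (lebesgue_on {c..d}) \<and> (\<lambda>x. (f x)\<^sup>2) integrable_on {c..d}"
proof -
  have "integrable (lebesgue_on {c..d}) (\<lambda>x. (f x)\<^sup>2) \<longleftrightarrow> (\<lambda>x. (f x)\<^sup>2) integrable_on {c..d}"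
  proof
    assume "integrable (lebesgue_on {c..d}) (\<lambda>x. (f x)\<^sup>2)"
    then show "(\<lambda>x. (f x)\<^sup>2) integrable_on {c..d}"
      by (rule integrable_on_lebesgue_on) auto
  next
    assume "(\<lambda>x. (f x)\<^sup>2) integrable_on {c..d}"
    then have "(\<lambda>x. (f x)\<^sup>2) absolutely_integrable_on {c..d}"
      by (rule nonnegative_absolutely_integrable_1) auto
    then show "integrable (lebesgue_on {c..d}) (\<lambda>x. (f x)\<^sup>2)"
      by (rule absolutely_integrable_imp_integrable) auto
  qed
  then show ?thesis by (auto simp: square_integrable_on_def)
qed

lemma square_integrable_on_mult:
  assumes "square_integrable_on {c..d} f" "square_integrable_on {c..d} g"
  shows "(\<lambda>x. f x * g x) absolutely_integrable_on {c..d}"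
proof (rule measurable_bounded_by_integrable_imp_absolutely_integrable)
  show "(\<lambda>x. f x * g x) \<in> borel_measurable (lebesgue_on {c..d})"
    using assms by (intro borel_measurable_times) (auto simp: square_integrable_on_def)
  show "(\<lambda>x. (f x)\<^sup>2 + (g x)\<^sup>2) integrable_on {c..d}"
    using assms by (intro integrable_add) (auto simp: square_integrable_on_Icc_iff)
  have "2 * \<bar>u * v\<bar> \<le> u\<^sup>2 + v\<^sup>2" for u v :: real
    using zero_le_power2[of "\<bar>u\<bar> - \<bar>v\<bar>"] by (simp add: power2_diff abs_mult)
  then show "norm (f x * g x) \<le> (f x)\<^sup>2 + (g x)\<^sup>2" for x
    by (smt (verit) real_norm_def)
qed auto

lemma square_integrable_on_mult_integrable:
  assumes "square_integrable_on {c..d} f" "square_integrable_on {c..d} g"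
  shows "(\<lambda>x. f x * g x) integrable_on {c..d}"
  using square_integrable_on_mult[OF assms] by (simp add: absolutely_integrable_on_def)

lemma square_integrable_on_power2:
  "square_integrable_on {c..d} f \<Longrightarrow> (\<lambda>x. (f x)\<^sup>2) integrable_on {c..d}"
  by (simp add: square_integrable_on_Icc_iff)

lemma square_integrable_on_add:
  assumes f: "square_integrable_on {c..d} f" and g: "square_integrable_on {c..d} g"
  shows "square_integrable_on {c..d} (\<lambda>x. f x + g x)"
proof -
  have "(\<lambda>x. ((f x)\<^sup>2 + (g x)\<^sup>2) + 2 * (f x * g x)) integrable_on {c..d}"
    using square_integrable_on_mult_integrable[OF f g] f g
    by (intro integrable_add integrable_on_mult_right) (auto simp: square_integrable_on_Icc_iff)
  then show ?thesis
    using f g by (auto simp: square_integrable_on_Icc_iff power2_sum algebra_simps)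
qed

lemma square_integrable_on_cmult:
  assumes f: "square_integrable_on {c..d} f"
  shows "square_integrable_on {c..d} (\<lambda>x. k * f x)"
  using assms by (auto simp: square_integrable_on_Icc_iff power_mult_distrib intro!: integrable_on_mult_right)

lemma square_integrable_on_diff:
  assumes f: "square_integrable_on {c..d} f" and g: "square_integrable_on {c..d} g"
  shows "square_integrable_on {c..d} (\<lambda>x. f x - g x)"
  using square_integrable_on_add[OF f square_integrable_on_cmult[OF g, of "-1"]] by simp

lemma square_integrable_on_continuous:
  assumes "continuous_on {c..d} f"
  shows "square_integrable_on {c..d} f"
  using assms unfolding square_integrable_on_Icc_iff
  by (auto intro!: continuous_imp_measurable_on_sets_lebesgue integrable_continuous_interval continuous_intros)

lemma square_integrable_on_imp_absolutely_integrable: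
  assumes "square_integrable_on {c..d} f"
  shows "f absolutely_integrable_on {c..d}"
  using square_integrable_on_mult[OF assms square_integrable_on_continuous[OF continuous_on_const[of _ 1]]]
  by simp

lemma square_integrable_on_imp_integrable:
  "square_integrable_on {c..d} f \<Longrightarrow> f integrable_on {c..d}"
  using square_integrable_on_imp_absolutely_integrable absolutely_integrable_on_def by blast

lemma square_integrable_on_subset:
  assumes "square_integrable_on T f" "S \<subseteq> T" "S \<in> sets lebesgue" "T \<in> sets lebesgue"
  shows "square_integrable_on S f"
proof -
  have 1: "f \<in> borel_measurable (lebesgue_on S)"
    using assms unfolding square_integrable_on_def by (meson measurable_restrict_mono)
  have "(\<lambda>x. (f x)\<^sup>2) absolutely_integrable_on T"
    using assms unfolding square_integrable_on_def
    by (auto simp: absolutely_integrable_measurable_real)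
  then have "(\<lambda>x. (f x)\<^sup>2) absolutely_integrable_on S"
    using assms set_integrable_subset by blast
  then show ?thesis
    unfolding square_integrable_on_def using 1 assms absolutely_integrable_imp_integrable by blast
qed

lemma square_integrable_on_spike:
  assumes "square_integrable_on S f" "S \<in> sets lebesgue" "negligible N"
    "\<And>x. x \<in> S - N \<Longrightarrow> g x = f x"
  shows "square_integrable_on S g"
proof -
  have "f measurable_on S"
    using assms by (simp add: measurable_on_iff_borel_measurable square_integrable_on_def)
  then have "g measurable_on S"
    by (rule measurable_on_spike[OF _ assms(3)]) (use assms in auto)
  then have 1: "g \<in> borel_measurable (lebesgue_on S)"
    using assms by (simp add: measurable_on_iff_borel_measurable)
  have "(\<lambda>x. (f x)\<^sup>2) absolutely_integrable_on S"
    using assms unfolding square_integrable_on_def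
    by (auto simp: absolutely_integrable_measurable_real)
  then have "(\<lambda>x. (g x)\<^sup>2) absolutely_integrable_on S"
    by (rule absolutely_integrable_spike[OF _ assms(3)]) (use assms in auto)
  then show ?thesis
    unfolding square_integrable_on_def using 1 assms absolutely_integrable_imp_integrable by blast
qed

lemma square_integrable_on_Icc_iff_Ioo:
  "square_integrable_on {c..d} f \<longleftrightarrow> square_integrable_on {c<..<d} f"
proof
  assume *: "square_integrable_on {c<..<d} f"
  have "f measurable_on {c<..<d}"
    using * by (simp add: measurable_on_iff_borel_measurable square_integrable_on_def)
  then have "f measurable_on {c..d}"
  proof (rule measurable_on_spike_set)
    show "negligible ({c<..<d} - {c..d} \<union> ({c..d} - {c<..<d}))"
      by (rule negligible_subset[of "{c,d}"]) auto
  qed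
  then have 1: "f \<in> borel_measurable (lebesgue_on {c..d})"
    by (simp add: measurable_on_iff_borel_measurable)
  have "(\<lambda>x. (f x)\<^sup>2) integrable_on {c<..<d}"
    using * unfolding square_integrable_on_def by (auto intro: integrable_on_lebesgue_on)
  then show "square_integrable_on {c..d} f"
    using 1 by (simp add: square_integrable_on_Icc_iff integrable_on_Icc_iff_Ioo)
qed (rule square_integrable_on_subset, auto)

section \<open>Translations and elementary integral estimates\<close>

lemma integrable_shift_Icc:
  fixes f :: "real \<Rightarrow> real"
  shows "(\<lambda>x. f (x + c)) integrable_on {s..t} \<longleftrightarrow> f integrable_on {s + c..t + c}"
  using integrable_shift_real_ivl[of f "s + c" "t + c" c] integrable_shift_real_ivl[of "\<lambda>x. f (x + c)" s t "-c"]
  by auto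

lemma integral_shift_Icc:
  fixes f :: "real \<Rightarrow> real"
  shows "integral {s..t} (\<lambda>x. f (x + c)) = integral {s + c..t + c} f"
  using integral_shift_real_ivl[of "s + c" c "t + c" f] by simp

lemma square_integrable_on_shift:
  assumes "square_integrable_on {s + c..t + c} f"
  shows "square_integrable_on {s..t} (\<lambda>x. f (x + c))"
proof -
  have "f integrable_on {s + c..t + c}"
    using assms by (rule square_integrable_on_imp_integrable)
  then have "(\<lambda>x. f (x + c)) \<in> borel_measurable (lebesgue_on {s..t})"
    by (intro integrable_imp_measurable) (simp add: integrable_shift_Icc)
  moreover have "(\<lambda>x. (f (x + c))\<^sup>2) integrable_on {s..t}"
    using integrable_shift_Icc[of "\<lambda>x. (f x)\<^sup>2" c s t] assms
    by (simp add: square_integrable_on_Icc_iff)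
  ultimately show ?thesis by (simp add: square_integrable_on_Icc_iff)
qed

text \<open>Jensen's inequality, from the nonnegative integral of the squared deviation from the
  mean \<open>m\<close>. The factor \<open>d - c\<close> is what counts on shrinking
  intervals.\<close>

lemma integral_power2_le:
  assumes f: "square_integrable_on {c..d} f" and "c \<le> d"
  shows "(integral {c..d} f)\<^sup>2 \<le> (d - c) * integral {c..d} (\<lambda>x. (f x)\<^sup>2)"
proof (cases "c = d")
  case False
  define m where "m = integral {c..d} f / (d - c)"
  have fi: "f integrable_on {c..d}"
    using f by (rule square_integrable_on_imp_integrable)
  have "0 \<le> integral {c..d} (\<lambda>x. (f x - m)\<^sup>2)"
    by (intro integral_nonneg square_integrable_on_power2 square_integrable_on_diff f
        square_integrable_on_continuous continuous_intros) auto
  also have "(\<lambda>x. (f x - m)\<^sup>2) = (\<lambda>x. (f x)\<^sup>2 - 2 * m * f x + m\<^sup>2)"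
    by (auto simp: power2_diff)
  also have "integral {c..d} \<dots> = integral {c..d} (\<lambda>x. (f x)\<^sup>2) - 2 * m * integral {c..d} f + m\<^sup>2 * (d - c)"
  proof (rule integral_unique, intro has_integral_add has_integral_diff has_integral_mult_right)
    show "((\<lambda>x. m\<^sup>2) has_integral m\<^sup>2 * (d - c)) {c..d}"
      using has_integral_const_real[of "m\<^sup>2" c d] \<open>c \<le> d\<close> by (simp add: mult.commute)
  qed (use fi square_integrable_on_power2[OF f] in auto)
  finally have "0 \<le> (d - c) * (integral {c..d} (\<lambda>x. (f x)\<^sup>2) - 2 * m * integral {c..d} f + m\<^sup>2 * (d - c))"
    using \<open>c \<le> d\<close> by simp
  moreover have I: "integral {c..d} f = m * (d - c)"
    using False by (simp add: m_def)
  ultimately show ?thesis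
    unfolding I by (simp add: algebra_simps power2_eq_square)
qed simp

lemma absolutely_integrable_mult_continuous:
  fixes g k :: "real \<Rightarrow> real"
  assumes g: "g absolutely_integrable_on {c..d}" and k: "continuous_on {c..d} k"
  shows "(\<lambda>x. g x * k x) absolutely_integrable_on {c..d}"
proof -
  have "(\<lambda>x. k x * g x) absolutely_integrable_on {c..d}"
    using g by (intro absolutely_integrable_bounded_measurable_product_real compact_imp_bounded
        compact_continuous_image[OF k] continuous_imp_measurable_on_sets_lebesgue[OF k]) auto
  then show ?thesis by (simp add: mult.commute)
qed

lemma power2_sum3_le: "(x + y + z)\<^sup>2 \<le> 3 * (x\<^sup>2 + y\<^sup>2 + z\<^sup>2)" for x y z :: real
  using sum_squares_ge_zero[of "x - y" "y - z"] zero_le_power2[of "x - z"]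
  by (simp add: power2_eq_square algebra_simps)

lemma integral_initial_diff:
  fixes f :: "real \<Rightarrow> real"
  assumes "f integrable_on {c..d}" "c \<le> s" "s \<le> t" "t \<le> d"
  shows "integral {c..t} f - integral {c..s} f = integral {s..t} f"
proof -
  have "f integrable_on {c..t}"
    by (rule integrable_on_subinterval[OF assms(1)]) (use assms in auto)
  with Henstock_Kurzweil_Integration.integral_combine[of c s t f] assms show ?thesis by simp
qed

lemma abs_integral_bound:
  fixes f g :: "real \<Rightarrow> real"
  assumes "f integrable_on S" "g integrable_on S" "\<And>x. x \<in> S \<Longrightarrow> \<bar>f x\<bar> \<le> g x"
  shows "\<bar>integral S f\<bar> \<le> integral S g"
  using integral_norm_bound_integral[of f S g] assms by simp

lemma integral_nonneg_subset_le:
  fixes f :: "real \<Rightarrow> real"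
  assumes "f integrable_on {c..d}" "{s..t} \<subseteq> {c..d}" "\<And>x. 0 \<le> f x"
  shows "integral {s..t} f \<le> integral {c..d} f"
  using assms by (intro integral_subset_le) (auto intro: integrable_on_subinterval)

section \<open>Primitives of locally integrable functions\<close>

text \<open>Absolute continuity encoded by increments alone: no derivative of \<open>Y\<close> at a
  point is mentioned, and \<open>p\<close> may be changed on negligible sets. The integral is the
  gauge integral, so stronger integrability of \<open>p\<close> is assumed separately where it is
  used.\<close>

definition primitive_on :: "real set \<Rightarrow> (real \<Rightarrow> real) \<Rightarrow> (real \<Rightarrow> real) \<Rightarrow> bool" where
  "primitive_on U Y p \<longleftrightarrow> (\<forall>s t. s \<le> t \<and> {s..t} \<subseteq> U \<longrightarrow> (p has_integral Y t - Y s) {s..t})"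

lemma primitive_onD:
  "primitive_on U Y p \<Longrightarrow> s \<le> t \<Longrightarrow> {s..t} \<subseteq> U \<Longrightarrow> (p has_integral Y t - Y s) {s..t}"
  by (simp add: primitive_on_def)

lemma primitive_on_subset: "primitive_on U Y p \<Longrightarrow> V \<subseteq> U \<Longrightarrow> primitive_on V Y p"
  unfolding primitive_on_def by blast

lemma primitive_on_continuous_Icc:
  assumes "primitive_on {c..d} Y p"
  shows "continuous_on {c..d} Y"
proof (cases "c \<le> d")
  case True
  have p: "p integrable_on {c..d}"
    using primitive_onD[OF assms True] by auto
  have "continuous_on {c..d} (\<lambda>x. Y c + integral {c..x} p)"
    by (intro continuous_intros indefinite_integral_continuous_1 p)
  moreover have "Y c + integral {c..x} p = Y x" if "x \<in> {c..d}" for x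
    using primitive_onD[OF assms, of c x] that by (auto simp: has_integral_iff)
  ultimately show ?thesis by (rule continuous_on_eq)
qed simp

text \<open>Increments of second order force constancy: over \<open>n + 1\<close> equal steps the
  bounds telescope to a total of order \<open>1 / (n + 1)\<close>. This replaces the argument from a
  vanishing derivative, which fails when derivatives exist only almost everywhere.\<close>

lemma constant_if_increment_bound:
  fixes H M :: "real \<Rightarrow> real"
  assumes "c \<le> d"
    and bound: "\<And>s t. c \<le> s \<Longrightarrow> s \<le> t \<Longrightarrow> t \<le> d \<Longrightarrow> \<bar>H t - H s\<bar> \<le> (t - s) * (M t - M s)"
  shows "H d = H c"
proof -
  have *: "\<bar>H d - H c\<bar> \<le> (d - c) * (M d - M c) / real (Suc n)" for n
  proof -
    define \<delta> where "\<delta> = (d - c) / real (Suc n)"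
    have \<delta>: "0 \<le> \<delta>" "real (Suc n) * \<delta> = d - c"
      using \<open>c \<le> d\<close> by (auto simp: \<delta>_def)
    have "\<bar>H (c + real k * \<delta>) - H c\<bar> \<le> \<delta> * (M (c + real k * \<delta>) - M c)" if "k \<le> Suc n" for k
      using that
    proof (induction k)
      case (Suc k)
      have "real (Suc k) * \<delta> \<le> real (Suc n) * \<delta>"
        using Suc.prems \<delta>(1) by (intro mult_right_mono) auto
      then have "\<bar>H (c + real (Suc k) * \<delta>) - H (c + real k * \<delta>)\<bar>
          \<le> (c + real (Suc k) * \<delta> - (c + real k * \<delta>)) * (M (c + real (Suc k) * \<delta>) - M (c + real k * \<delta>))"
        using \<delta> by (intro bound) (auto simp: algebra_simps)
      also have "\<dots> = \<delta> * (M (c + real (Suc k) * \<delta>) - M (c + real k * \<delta>))"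
        by (simp add: algebra_simps)
      finally show ?case
        using Suc by (simp add: algebra_simps)
    qed simp
    from this[of "Suc n"] show ?thesis
      unfolding \<delta>(2) by (simp add: \<delta>_def algebra_simps)
  qed
  have "(\<lambda>n. (d - c) * (M d - M c) / real (Suc n)) \<longlonglongrightarrow> 0"
    using LIMSEQ_Suc[OF lim_const_over_n] .
  then have "\<bar>H d - H c\<bar> \<le> 0"
    by (rule tendsto_lowerbound) (use * in auto)
  then show ?thesis by simp
qed

text \<open>On \<open>{s..t}\<close> the error in the chain rule is the integral of
  \<open>p x\<close> times \<open>(Y t - Y x) - (Y x - Y s)\<close>, at most
  \<open>2 * m\<^sup>2\<close> with \<open>m\<close> the integral of \<open>\<bar>p x\<bar>\<close>.
  Jensen's inequality extracts a factor \<open>t - s\<close> from \<open>m\<^sup>2\<close>; this is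
  where square integrability enters.\<close>

lemma primitive_on_power2:
  assumes Y: "primitive_on {c..d} Y p" and p: "square_integrable_on {c..d} p" and "c \<le> d"
  shows "((\<lambda>x. 2 * Y x * p x) has_integral (Y d)\<^sup>2 - (Y c)\<^sup>2) {c..d}"
proof -
  have Yc: "continuous_on {c..d} Y"
    using Y by (rule primitive_on_continuous_Icc)
  have Yp: "(\<lambda>x. 2 * Y x * p x) integrable_on {c..d}"
    using square_integrable_on_mult_integrable[OF square_integrable_on_continuous[OF continuous_on_mult[OF continuous_on_const[of _ 2] Yc]] p] .
  have p2: "(\<lambda>x. (p x)\<^sup>2) integrable_on {c..d}"
    using p by (rule square_integrable_on_power2)
  define H where "H t = (Y t)\<^sup>2 - integral {c..t} (\<lambda>x. 2 * Y x * p x)" for t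
  define M where "M t = 2 * integral {c..t} (\<lambda>x. (p x)\<^sup>2)" for t
  have "H d = H c"
  proof (rule constant_if_increment_bound[OF \<open>c \<le> d\<close>, where M = M])
    fix s t assume st: "c \<le> s" "s \<le> t" "t \<le> d"
    have sub: "{s..t} \<subseteq> {c..d}" using st by auto
    have ps: "square_integrable_on {s..t} p"
      by (rule square_integrable_on_subset[OF p sub]) auto
    define m where "m = integral {s..t} (\<lambda>x. \<bar>p x\<bar>)"
    have absp: "(\<lambda>x. \<bar>p x\<bar>) integrable_on {s..t}"
      using square_integrable_on_imp_absolutely_integrable[OF ps] by (simp add: absolutely_integrable_on_def)
    have incr: "\<bar>Y v - Y u\<bar> \<le> m" if "s \<le> u" "u \<le> v" "v \<le> t" for u v
    proof -
      have "(p has_integral Y v - Y u) {u..v}"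
        using that st by (intro primitive_onD[OF Y]) auto
      then have "\<bar>Y v - Y u\<bar> = \<bar>integral {u..v} p\<bar>" by (simp add: has_integral_iff)
      also have "\<dots> \<le> integral {u..v} (\<lambda>x. \<bar>p x\<bar>)"
        using \<open>(p has_integral Y v - Y u) {u..v}\<close> absp that
        by (intro abs_integral_bound integrable_on_subinterval[OF absp]) auto
      also have "\<dots> \<le> m"
        unfolding m_def using absp that by (intro integral_nonneg_subset_le) auto
      finally show ?thesis .
    qed
    have pY: "(p has_integral Y t - Y s) {s..t}"
      using st by (intro primitive_onD[OF Y]) auto
    have Yps: "(\<lambda>x. 2 * Y x * p x) integrable_on {s..t}"
      using Yp sub by (rule integrable_on_subinterval)
    have "H t - H s = (Y t)\<^sup>2 - (Y s)\<^sup>2 - integral {s..t} (\<lambda>x. 2 * Y x * p x)"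
      unfolding H_def using integral_initial_diff[OF Yp, of s t] st by simp
    moreover have "((\<lambda>x. p x * (Y t + Y s) - 2 * Y x * p x) has_integral
        (Y t - Y s) * (Y t + Y s) - integral {s..t} (\<lambda>x. 2 * Y x * p x)) {s..t}"
      using pY Yps by (intro has_integral_diff has_integral_mult_left) auto
    ultimately have Hi: "((\<lambda>x. p x * (Y t + Y s) - 2 * Y x * p x) has_integral H t - H s) {s..t}"
      by (elim has_integral_eq_rhs) (simp add: power2_eq_square algebra_simps)
    have "\<bar>H t - H s\<bar> \<le> integral {s..t} (\<lambda>x. (2 * m) * \<bar>p x\<bar>)"
      unfolding has_integral_iff[THEN iffD1, OF Hi, THEN conjunct2, symmetric]
    proof (rule abs_integral_bound)
      fix x assume x: "x \<in> {s..t}"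
      have "p x * (Y t + Y s) - 2 * Y x * p x = p x * ((Y t - Y x) - (Y x - Y s))"
        by (simp add: algebra_simps)
      moreover have "\<bar>(Y t - Y x) - (Y x - Y s)\<bar> \<le> 2 * m"
        using incr[of x t] incr[of s x] x by auto
      ultimately show "\<bar>p x * (Y t + Y s) - 2 * Y x * p x\<bar> \<le> 2 * m * \<bar>p x\<bar>"
        by (simp add: abs_mult mult.commute mult_left_mono)
    qed (use Hi absp integrable_on_mult_right[OF absp, of "2 * m"] in \<open>simp_all add: has_integral_iff\<close>)
    also have "\<dots> = 2 * m\<^sup>2"
      by (simp add: m_def power2_eq_square)
    also have "m\<^sup>2 \<le> (t - s) * integral {s..t} (\<lambda>x. (p x)\<^sup>2)"
    proof -
      have "square_integrable_on {s..t} (\<lambda>x. \<bar>p x\<bar>)"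
        using ps by (auto simp: square_integrable_on_def intro: borel_measurable_abs)
      from integral_power2_le[OF this \<open>s \<le> t\<close>] show ?thesis by (simp add: m_def)
    qed
    also have "2 * ((t - s) * integral {s..t} (\<lambda>x. (p x)\<^sup>2)) = (t - s) * (M t - M s)"
      unfolding M_def using integral_initial_diff[OF p2, of s t] st by simp
    finally show "\<bar>H t - H s\<bar> \<le> (t - s) * (M t - M s)" by simp
  qed
  then have "integral {c..d} (\<lambda>x. 2 * Y x * p x) = (Y d)\<^sup>2 - (Y c)\<^sup>2"
    by (simp add: H_def)
  with Yp show ?thesis by (simp add: has_integral_iff)
qed

text \<open>With \<open>g\<close> only integrable the small factor \<open>t - s\<close> comes from
  the Lipschitz constant \<open>L\<close> of \<open>\<phi>\<close>. The integrand is compared with a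
  frozen one, \<open>\<phi>\<close> taken at \<open>t\<close> and \<open>Y\<close> at
  \<open>s\<close>, whose integral is exactly the increment of the product.\<close>

lemma primitive_on_by_parts:
  assumes Y: "primitive_on {c..d} Y g" and g: "g absolutely_integrable_on {c..d}" and "c \<le> d"
    and \<phi>: "\<And>x. x \<in> {c..d} \<Longrightarrow> (\<phi> has_real_derivative \<phi>' x) (at x)"
    and \<phi>': "continuous_on {c..d} \<phi>'"
  shows "((\<lambda>x. g x * \<phi> x + Y x * \<phi>' x) has_integral Y d * \<phi> d - Y c * \<phi> c) {c..d}"
proof -
  have Yc: "continuous_on {c..d} Y"
    using Y by (rule primitive_on_continuous_Icc)
  have \<phi>c: "continuous_on {c..d} \<phi>"
    using \<phi> DERIV_isCont by (intro continuous_at_imp_continuous_on) blast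
  have "bounded (\<phi>' ` {c..d})"
    by (intro compact_imp_bounded compact_continuous_image[OF \<phi>']) simp
  then obtain L where "\<forall>y\<in>\<phi>' ` {c..d}. norm y \<le> L"
    unfolding bounded_iff by blast
  then have L: "\<And>x. x \<in> {c..d} \<Longrightarrow> \<bar>\<phi>' x\<bar> \<le> L"
    by auto
  have lip: "\<bar>\<phi> v - \<phi> u\<bar> \<le> L * (v - u)" if "c \<le> u" "u \<le> v" "v \<le> d" for u v
  proof (cases "u = v")
    case False
    then have "u < v" using that by simp
    have "\<exists>\<xi>. u < \<xi> \<and> \<xi> < v \<and> \<phi> v - \<phi> u = (v - u) * \<phi>' \<xi>"
      by (rule MVT2[OF \<open>u < v\<close>], rule \<phi>) (use that in auto)
    then obtain \<xi> where \<xi>: "u < \<xi>" "\<xi> < v" "\<phi> v - \<phi> u = (v - u) * \<phi>' \<xi>"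
      by blast
    have "\<bar>\<phi>' \<xi>\<bar> * (v - u) \<le> L * (v - u)"
      using L[of \<xi>] \<xi> that by (intro mult_right_mono) auto
    then show ?thesis
      using that unfolding \<xi>(3) by (simp add: abs_mult mult.commute)
  qed simp
  have "(\<lambda>x. g x * \<phi> x) integrable_on {c..d}"
    using absolutely_integrable_mult_continuous[OF g \<phi>c] by (simp add: absolutely_integrable_on_def)
  moreover have "(\<lambda>x. Y x * \<phi>' x) integrable_on {c..d}"
    using Yc \<phi>' by (intro integrable_continuous_interval continuous_intros)
  ultimately have W: "(\<lambda>x. g x * \<phi> x + Y x * \<phi>' x) integrable_on {c..d}"
    by (rule integrable_add)
  have absg: "(\<lambda>x. \<bar>g x\<bar>) integrable_on {c..d}"
    using g by (simp add: absolutely_integrable_on_def)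
  define H where "H t = Y t * \<phi> t - integral {c..t} (\<lambda>x. g x * \<phi> x + Y x * \<phi>' x)" for t
  define M where "M t = 2 * L * integral {c..t} (\<lambda>x. \<bar>g x\<bar>)" for t
  have "H d = H c"
  proof (rule constant_if_increment_bound[OF \<open>c \<le> d\<close>, where M = M])
    fix s t assume st: "c \<le> s" "s \<le> t" "t \<le> d"
    have sub: "{s..t} \<subseteq> {c..d}" using st by auto
    have absgs: "(\<lambda>x. \<bar>g x\<bar>) integrable_on {s..t}"
      using absg sub by (rule integrable_on_subinterval)
    define m where "m = integral {s..t} (\<lambda>x. \<bar>g x\<bar>)"
    have "0 \<le> m" unfolding m_def by (intro integral_nonneg absgs) auto
    have "0 \<le> L" using L[of c] \<open>c \<le> d\<close> by auto
    have incr: "\<bar>Y v - Y s\<bar> \<le> m" if "s \<le> v" "v \<le> t" for v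
    proof -
      have "(g has_integral Y v - Y s) {s..v}"
        using that st by (intro primitive_onD[OF Y]) auto
      then have "\<bar>Y v - Y s\<bar> = \<bar>integral {s..v} g\<bar>" by (simp add: has_integral_iff)
      also have "\<dots> \<le> integral {s..v} (\<lambda>x. \<bar>g x\<bar>)"
        using \<open>(g has_integral Y v - Y s) {s..v}\<close> absgs that
        by (intro abs_integral_bound integrable_on_subinterval[OF absgs]) auto
      also have "\<dots> \<le> m"
        unfolding m_def using absgs that by (intro integral_nonneg_subset_le) auto
      finally show ?thesis .
    qed
    have gY: "(g has_integral Y t - Y s) {s..t}"
      using st by (intro primitive_onD[OF Y]) auto
    have \<phi>i: "(\<phi>' has_integral \<phi> t - \<phi> s) {s..t}"
      using st \<phi> by (intro fundamental_theorem_of_calculus)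
        (auto simp: has_real_derivative_iff_has_vector_derivative[symmetric] intro: has_field_derivative_at_within)
    have Ws: "(\<lambda>x. g x * \<phi> x + Y x * \<phi>' x) integrable_on {s..t}"
      using W sub by (rule integrable_on_subinterval)
    have "H t - H s = Y t * \<phi> t - Y s * \<phi> s - integral {s..t} (\<lambda>x. g x * \<phi> x + Y x * \<phi>' x)"
      unfolding H_def using integral_initial_diff[OF W, of s t] st by simp
    moreover have "((\<lambda>x. (g x * \<phi> t + Y s * \<phi>' x) - (g x * \<phi> x + Y x * \<phi>' x)) has_integral
        ((Y t - Y s) * \<phi> t + Y s * (\<phi> t - \<phi> s)) - integral {s..t} (\<lambda>x. g x * \<phi> x + Y x * \<phi>' x)) {s..t}"
      using gY \<phi>i Ws by (intro has_integral_diff has_integral_add has_integral_mult_left has_integral_mult_right) auto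
    ultimately have Hi: "((\<lambda>x. (g x * \<phi> t + Y s * \<phi>' x) - (g x * \<phi> x + Y x * \<phi>' x)) has_integral H t - H s) {s..t}"
      by (elim has_integral_eq_rhs) (simp add: algebra_simps)
    have "\<bar>H t - H s\<bar> \<le> integral {s..t} (\<lambda>x. (L * (t - s)) * \<bar>g x\<bar> + L * m)"
      unfolding has_integral_iff[THEN iffD1, OF Hi, THEN conjunct2, symmetric]
    proof (rule abs_integral_bound)
      fix x assume x: "x \<in> {s..t}"
      have "(g x * \<phi> t + Y s * \<phi>' x) - (g x * \<phi> x + Y x * \<phi>' x) = g x * (\<phi> t - \<phi> x) - \<phi>' x * (Y x - Y s)"
        by (simp add: algebra_simps)
      moreover have "\<bar>\<phi> t - \<phi> x\<bar> \<le> L * (t - s)"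
      proof -
        have "L * (t - x) \<le> L * (t - s)" using x \<open>0 \<le> L\<close> by (intro mult_left_mono) auto
        then show ?thesis using lip[of x t] x st by auto
      qed
      then have "\<bar>g x * (\<phi> t - \<phi> x)\<bar> \<le> (L * (t - s)) * \<bar>g x\<bar>"
        by (simp add: abs_mult mult.commute mult_left_mono)
      moreover have "\<bar>\<phi>' x * (Y x - Y s)\<bar> \<le> L * m"
        unfolding abs_mult using incr[of x] L[of x] x st \<open>0 \<le> L\<close> by (intro mult_mono) auto
      ultimately show "\<bar>(g x * \<phi> t + Y s * \<phi>' x) - (g x * \<phi> x + Y x * \<phi>' x)\<bar> \<le> L * (t - s) * \<bar>g x\<bar> + L * m"
        by linarith
    qed (use Hi integrable_add[OF integrable_on_mult_right[OF absgs, of "L * (t - s)"] integrable_const_ivl[of "L * m"]]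
        in \<open>simp_all add: has_integral_iff\<close>)
    also have "\<dots> = L * (t - s) * m + L * m * (t - s)"
      using integral_add[OF integrable_on_mult_right[OF absgs, of "L * (t - s)"] integrable_const_ivl[of "L * m"]] st
      by (simp add: m_def)
    also have "\<dots> = (t - s) * (2 * L * m)"
      by simp
    also have "2 * L * m = M t - M s"
      unfolding M_def m_def using integral_initial_diff[OF absg, of s t] st by (simp add: right_diff_distrib [symmetric])
    finally show "\<bar>H t - H s\<bar> \<le> (t - s) * (M t - M s)" .
  qed
  then have "integral {c..d} (\<lambda>x. g x * \<phi> x + Y x * \<phi>' x) = Y d * \<phi> d - Y c * \<phi> c"
    by (simp add: H_def)
  with W show ?thesis by (simp add: has_integral_iff)
qed

text \<open>Lebesgue differentiation: at almost every \<open>x\<close> the value \<open>e x\<close>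
  is the limit of the averages over \<open>{x..x + h}\<close>, which all vanish. Integrability is
  known only on compact intervals inside \<open>U\<close>, so the exceptional sets are collected
  over the countably many intervals with rational endpoints.\<close>

lemma integral_zero_imp_negligible:
  fixes e :: "real \<Rightarrow> real"
  assumes "open U"
    and int: "\<And>c d. {c..d} \<subseteq> U \<Longrightarrow> e integrable_on {c..d}"
    and zero: "\<And>c d. {c..d} \<subseteq> U \<Longrightarrow> integral {c..d} e = 0"
  shows "negligible {x \<in> U. e x \<noteq> 0}"
proof -
  have neg: "negligible {x \<in> {c<..<d}. e x \<noteq> 0}" if cd: "{c..d} \<subseteq> U" for c d
  proof -
    define e' where "e' x = (if x \<in> {c..d} then e x else 0)" for x
    have "e' integrable_on UNIV"
      unfolding e'_def integrable_restrict_UNIV by (rule int[OF cd])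
    then have "e' integrable_on cbox u v" for u v
      by (rule integrable_on_subcbox) auto
    then obtain N where N: "negligible N"
      "\<And>x \<epsilon>. x \<notin> N \<Longrightarrow> 0 < \<epsilon> \<Longrightarrow> \<exists>r>0. \<forall>h. 0 < h \<and> h < r \<longrightarrow>
         norm (integral (cbox x (x + h *\<^sub>R One)) e' /\<^sub>R h ^ DIM(real) - e' x) < \<epsilon>"
      by (rule integrable_ccontinuous_explicit[of e']) blast
    have "e x = 0" if x: "x \<in> {c<..<d}" "x \<notin> N" for x
    proof (rule ccontr)
      assume "e x \<noteq> 0"
      then obtain r where r: "r > 0" and
        rh: "\<And>h. 0 < h \<Longrightarrow> h < r \<Longrightarrow> \<bar>integral {x..x + h} e' / h - e' x\<bar> < \<bar>e x\<bar>"
        using N(2)[OF x(2), of "\<bar>e x\<bar>"] by (auto simp: divide_inverse mult.commute)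
      define h where "h = min (r / 2) (d - x)"
      have h: "0 < h" "h < r" "x + h \<le> d" using r x by (auto simp: h_def)
      have "integral {x..x + h} e' = integral {x..x + h} e"
        using x h by (intro integral_cong) (auto simp: e'_def)
      also have "\<dots> = 0"
        using cd x h by (intro zero) (auto intro: subsetD[OF cd])
      finally show False
        using rh[OF h(1,2)] x by (simp add: e'_def)
    qed
    then show ?thesis
      using N(1) by (auto intro: negligible_subset)
  qed
  define I where "I = {(c, d). c \<in> \<rat> \<and> d \<in> \<rat> \<and> {c..d} \<subseteq> U}"
  have "countable I"
    by (rule countable_subset[of _ "\<rat> \<times> \<rat>"]) (auto simp: I_def intro: countable_rat)
  then have "negligible (\<Union>z\<in>I. {x \<in> {fst z<..<snd z}. e x \<noteq> 0})"
    using neg by (intro negligible_countable_Union) (auto simp: I_def)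
  moreover have "{x \<in> U. e x \<noteq> 0} \<subseteq> (\<Union>z\<in>I. {x \<in> {fst z<..<snd z}. e x \<noteq> 0})"
  proof
    fix x assume x: "x \<in> {x \<in> U. e x \<noteq> 0}"
    then obtain r where r: "r > 0" "cball x r \<subseteq> U"
      using \<open>open U\<close> open_contains_cball by blast
    obtain c where c: "c \<in> \<rat>" "x - r < c" "c < x"
      using Rats_dense_in_real[of "x - r" x] r by auto
    obtain d where d: "d \<in> \<rat>" "x < d" "d < x + r"
      using Rats_dense_in_real[of x "x + r"] r by auto
    have "{c..d} \<subseteq> cball x r"
      using c d by (auto simp: dist_real_def)
    then have "(c, d) \<in> I" using c d r by (auto simp: I_def)
    then show "x \<in> (\<Union>z\<in>I. {x \<in> {fst z<..<snd z}. e x \<noteq> 0})"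
      using c d x by (intro UN_I[of "(c, d)"]) auto
  qed
  ultimately show ?thesis by (rule negligible_subset)
qed

section \<open>Weak derivatives\<close>

lemma integral_lebesgue_on_cong_support:
  fixes f :: "real \<Rightarrow> real"
  assumes "S \<in> sets lebesgue" "T \<in> sets lebesgue" "\<And>x. f x \<noteq> 0 \<Longrightarrow> x \<in> S \<longleftrightarrow> x \<in> T"
  shows "(LINT x|lebesgue_on S. f x) = (LINT x|lebesgue_on T. f x)"
proof -
  have "(\<lambda>x. indicat_real S x *\<^sub>R f x) = (\<lambda>x. indicat_real T x *\<^sub>R f x)"
    using assms(3) by (auto simp: indicator_def fun_eq_iff)
  then show ?thesis
    using assms(1,2) by (simp add: integral_restrict_space)
qed

lemma compact_subset_Icc:
  fixes U :: "real set"
  assumes "is_interval U" "U \<noteq> {}" "compact K" "K \<subseteq> U"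
  obtains c d where "c \<le> d" "K \<subseteq> {c..d}" "{c..d} \<subseteq> U"
proof (cases "K = {}")
  case True
  with \<open>U \<noteq> {}\<close> obtain x where "x \<in> U" by blast
  with True show ?thesis by (intro that[of x x]) auto
next
  case False
  obtain c where c: "c \<in> K" "\<And>x. x \<in> K \<Longrightarrow> c \<le> x"
    using compact_attains_inf[OF assms(3) False] by blast
  obtain d where d: "d \<in> K" "\<And>x. x \<in> K \<Longrightarrow> x \<le> d"
    using compact_attains_sup[OF assms(3) False] by blast
  have "{c..d} \<subseteq> U"
    using assms(1,4) c(1) d(1) unfolding is_interval_1 by (meson atLeastAtMost_iff subsetD subsetI)
  with c d show ?thesis by (intro that[of c d]) auto
qed

lemma test_function_deriv:
  assumes "test_function U \<phi>"
  obtains K where "compact K" "K \<subseteq> U" "\<And>x. x \<notin> K \<Longrightarrow> \<phi> x = 0" "\<And>x. x \<notin> K \<Longrightarrow> deriv \<phi> x = 0"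
    "\<And>x. (\<phi> has_real_derivative deriv \<phi> x) (at x)" "continuous_on UNIV (deriv \<phi>)"
proof -
  obtain K where K: "compact K" "K \<subseteq> U" "\<And>x. x \<notin> K \<Longrightarrow> \<phi> x = 0" and C1: "\<phi> C1_differentiable_on UNIV"
    using assms by (auto simp: test_function_def)
  obtain D where D: "\<And>x. (\<phi> has_vector_derivative D x) (at x)" "continuous_on UNIV D"
    using C1 by (auto simp: C1_differentiable_on_def)
  have der: "deriv \<phi> x = D x" for x
    using D(1)[of x] by (intro DERIV_imp_deriv) (simp add: has_real_derivative_iff_has_vector_derivative)
  then have eq: "deriv \<phi> = D" by auto
  have "deriv \<phi> x = 0" if "x \<notin> K" for x
  proof -
    have "open (- K)" using K(1) by (simp add: compact_imp_closed open_Compl)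
    then have "((\<lambda>_. 0) has_real_derivative 0) (at x) \<longleftrightarrow> (\<phi> has_real_derivative 0) (at x)"
      using that K(3) by (intro DERIV_cong_ev) (auto simp: eventually_nhds intro!: exI[of _ "- K"])
    then show ?thesis by (simp add: DERIV_imp_deriv)
  qed
  with K D show ?thesis
    by (intro that[of K]) (auto simp: eq has_real_derivative_iff_has_vector_derivative)
qed

lemma primitive_on_continuous:
  assumes "open U" "primitive_on U Y p"
  shows "continuous_on U Y"
proof -
  have "isCont Y x" if x: "x \<in> U" for x
  proof -
    obtain e where e: "e > 0" "cball x e \<subseteq> U"
      using assms(1) x unfolding open_contains_cball by blast
    have "continuous_on {x - e..x + e} Y"
      using e(2) by (intro primitive_on_continuous_Icc[OF primitive_on_subset[OF assms(2)]])
        (simp add: cball_eq_atLeastAtMost)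
    moreover have "x \<in> interior {x - e..x + e}"
      using e(1) by simp
    ultimately show ?thesis
      by (rule continuous_on_interior)
  qed
  then show ?thesis by (intro continuous_at_imp_continuous_on ballI)
qed

lemma has_weak_deriv_subset:
  assumes "has_weak_deriv U f g" "V \<subseteq> U" "open U" "open V"
  shows "has_weak_deriv V f g"
  unfolding has_weak_deriv_def
proof (intro conjI allI impI)
  show "locally_integrable_on V f" "locally_integrable_on V g"
    using assms by (auto simp: has_weak_deriv_def locally_integrable_on_def)
  fix \<phi> assume \<phi>: "test_function V \<phi>"
  then obtain K where K: "compact K" "K \<subseteq> V" "\<And>x. x \<notin> K \<Longrightarrow> \<phi> x = 0" "\<And>x. x \<notin> K \<Longrightarrow> deriv \<phi> x = 0"
    by (rule test_function_deriv) blast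
  have "test_function U \<phi>"
    using \<phi> assms(2) unfolding test_function_def by blast
  then have "(LINT x|lebesgue_on U. f x * deriv \<phi> x) = - (LINT x|lebesgue_on U. g x * \<phi> x)"
    using assms(1) by (simp add: has_weak_deriv_def)
  moreover have "(LINT x|lebesgue_on U. f x * deriv \<phi> x) = (LINT x|lebesgue_on V. f x * deriv \<phi> x)"
    using K assms by (intro integral_lebesgue_on_cong_support) auto
  moreover have "(LINT x|lebesgue_on U. g x * \<phi> x) = (LINT x|lebesgue_on V. g x * \<phi> x)"
    using K assms by (intro integral_lebesgue_on_cong_support) auto
  ultimately show "(LINT x|lebesgue_on V. f x * deriv \<phi> x) = - (LINT x|lebesgue_on V. g x * \<phi> x)"
    by simp
qed

section \<open>From primitives to weak derivatives\<close>

lemma locally_integrable_on_Icc: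
  "locally_integrable_on U f \<Longrightarrow> {c..d} \<subseteq> U \<Longrightarrow> f absolutely_integrable_on {c..d}"
  by (simp add: locally_integrable_on_def)

text \<open>Bridge from the Lebesgue integral over \<open>U\<close> in the definition of the weak
  derivative to the gauge integral over one compact interval. \<open>\<psi>\<close> stands for a
  test function as well as for its derivative, hence the assumption of mere continuity.\<close>

lemma integral_test_function:
  assumes U: "open U" "is_interval U" and "U \<noteq> {}" and g: "locally_integrable_on U g"
    and \<psi>: "continuous_on UNIV \<psi>" "\<And>x. x \<notin> {c..d} \<Longrightarrow> \<psi> x = 0" and cd: "{c..d} \<subseteq> U"
  shows "(\<lambda>x. g x * \<psi> x) absolutely_integrable_on {c..d}"
    and "(LINT x|lebesgue_on U. g x * \<psi> x) = integral {c..d} (\<lambda>x. g x * \<psi> x)"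
proof -
  have c: "continuous_on {c..d} \<psi>"
    using \<psi>(1) continuous_on_subset by blast
  show 1: "(\<lambda>x. g x * \<psi> x) absolutely_integrable_on {c..d}"
    using locally_integrable_on_Icc[OF g cd] c by (rule absolutely_integrable_mult_continuous)
  have "(LINT x|lebesgue_on U. g x * \<psi> x) = (LINT x|lebesgue_on {c..d}. g x * \<psi> x)"
    using U(1) \<psi>(2) cd by (intro integral_lebesgue_on_cong_support) auto
  also have "\<dots> = integral {c..d} (\<lambda>x. g x * \<psi> x)"
    using 1 by (intro lebesgue_integral_eq_integral absolutely_integrable_imp_integrable) auto
  finally show "(LINT x|lebesgue_on U. g x * \<psi> x) = integral {c..d} (\<lambda>x. g x * \<psi> x)" .
qed

lemma locally_integrable_on_spike_continuous:
  assumes U: "open U" "is_interval U" and Y: "continuous_on U Y"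
    and N: "negligible N" "\<And>x. x \<in> U - N \<Longrightarrow> f x = Y x"
  shows "locally_integrable_on U f"
  unfolding locally_integrable_on_def
proof (intro allI impI)
  fix K assume K: "compact K \<and> K \<subseteq> U"
  show "f absolutely_integrable_on K"
  proof (cases "U = {}")
    case False
    obtain c d where cd: "c \<le> d" "K \<subseteq> {c..d}" "{c..d} \<subseteq> U"
      by (rule compact_subset_Icc[OF U(2) False, of K]) (use K in auto)
    have "Y absolutely_integrable_on {c..d}"
      using Y cd continuous_on_subset by (blast intro: absolutely_integrable_continuous_real)
    then have "Y absolutely_integrable_on K"
      by (rule set_integrable_subset) (use K cd in \<open>auto intro: compact_imp_closed lmeasurable_compact fmeasurableD\<close>)
    then show ?thesis
      by (rule absolutely_integrable_spike[OF _ N(1)]) (use K N(2) in auto)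
  qed (use K in auto)
qed

lemma primitive_on_imp_has_weak_deriv:
  assumes U: "open U" "is_interval U" and g: "locally_integrable_on U g"
    and Y: "primitive_on U Y g" and N: "negligible N" "\<And>x. x \<in> U - N \<Longrightarrow> f x = Y x"
  shows "has_weak_deriv U f g"
  unfolding has_weak_deriv_def
proof (intro conjI allI impI)
  have Yc: "continuous_on U Y"
    using U(1) Y by (rule primitive_on_continuous)
  show f: "locally_integrable_on U f"
    using U Yc N by (rule locally_integrable_on_spike_continuous)
  fix \<phi> assume "test_function U \<phi>"
  then obtain K where K: "compact K" "K \<subseteq> U" "\<And>x. x \<notin> K \<Longrightarrow> \<phi> x = 0" "\<And>x. x \<notin> K \<Longrightarrow> deriv \<phi> x = 0"
    "\<And>x. (\<phi> has_real_derivative deriv \<phi> x) (at x)" "continuous_on UNIV (deriv \<phi>)"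
    by (rule test_function_deriv) blast
  show "(LINT x|lebesgue_on U. f x * deriv \<phi> x) = - (LINT x|lebesgue_on U. g x * \<phi> x)"
  proof (cases "U = {}")
    case False
    obtain c d where cd: "c \<le> d" "K \<subseteq> {c..d}" "{c..d} \<subseteq> U"
      by (rule compact_subset_Icc[OF U(2) False K(1,2)])
    have \<phi>c: "continuous_on UNIV \<phi>"
      using K(5) by (meson DERIV_isCont continuous_at_imp_continuous_on)
    \<comment> \<open>The endpoints \<open>c\<close> and \<open>d\<close> may belong to
      \<open>K\<close>. By continuity the vanishing outside \<open>{c..d}\<close> extends to them,
      which removes the boundary terms of the integration by parts.\<close>
    have zero: "\<phi> x = 0" "deriv \<phi> x = 0" if "x \<notin> {c<..<d}" for x
    proof -
      have "closed {y. \<phi> y = 0}" "closed {y. deriv \<phi> y = 0}"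
        by (auto intro!: closed_Collect_eq \<phi>c K(6))
      then have "\<phi> c = 0 \<and> \<phi> d = 0 \<and> deriv \<phi> c = 0 \<and> deriv \<phi> d = 0"
      proof -
        have *: "P c \<and> P d" if "closed {y. P y}" "\<And>y. y \<notin> {c..d} \<Longrightarrow> P y" for P :: "real \<Rightarrow> bool"
        proof -
          have "closure {..<c} \<subseteq> {y. P y}" "closure {d<..} \<subseteq> {y. P y}"
            by (intro closure_minimal that(1); use that(2) in auto)+
          moreover have "c \<in> closure {..<c}" "d \<in> closure {d<..}"
            by simp_all
          ultimately show ?thesis by blast
        qed
        show ?thesis
          using *[of "\<lambda>y. \<phi> y = 0"] *[of "\<lambda>y. deriv \<phi> y = 0"] K(3,4) cd(2)
            \<open>closed {y. \<phi> y = 0}\<close> \<open>closed {y. deriv \<phi> y = 0}\<close> by (meson subsetD)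
      qed
      then show "\<phi> x = 0" "deriv \<phi> x = 0"
        using that K(3,4)[of x] cd(2) by (cases "x = c \<or> x = d"; force)+
    qed
    have z1: "\<And>x. x \<notin> {c..d} \<Longrightarrow> deriv \<phi> x = 0" and z2: "\<And>x. x \<notin> {c..d} \<Longrightarrow> \<phi> x = 0"
      using zero by auto
    note if1 = integral_test_function[OF U False f K(6) z1 cd(3)]
    note ig1 = integral_test_function[OF U False g \<phi>c z2 cd(3)]
    have parts: "((\<lambda>x. g x * \<phi> x + Y x * deriv \<phi> x) has_integral Y d * \<phi> d - Y c * \<phi> c) {c..d}"
      using K(5) cd continuous_on_subset[OF K(6)] locally_integrable_on_Icc[OF g cd(3)]
        primitive_on_subset[OF Y cd(3)]
      by (intro primitive_on_by_parts) auto
    have "((\<lambda>x. g x * \<phi> x + f x * deriv \<phi> x) has_integral 0) {c..d}"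
      using parts zero by (intro has_integral_spike[OF N(1) _ parts[THEN has_integral_eq_rhs]]) (use N(2) cd(3) in auto)
    moreover have "((\<lambda>x. g x * \<phi> x + f x * deriv \<phi> x) has_integral
        integral {c..d} (\<lambda>x. g x * \<phi> x) + integral {c..d} (\<lambda>x. f x * deriv \<phi> x)) {c..d}"
      using if1(1) ig1(1) by (intro has_integral_add integrable_integral) (auto simp: absolutely_integrable_on_def)
    ultimately have "0 = integral {c..d} (\<lambda>x. g x * \<phi> x) + integral {c..d} (\<lambda>x. f x * deriv \<phi> x)"
      by (rule has_integral_unique)
    then show ?thesis
      using if1(2) ig1(2) by simp
  qed auto
qed (use g in simp)

section \<open>Cutoff functions and the du Bois-Reymond lemma\<close>

lemma test_function_primitive:
  assumes k: "continuous_on UNIV k" "\<And>x. x \<notin> {c<..<d} \<Longrightarrow> k x = 0" "integral {c..d} k = 0"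
    and U: "{c..d} \<subseteq> U"
  obtains \<phi> where "test_function U \<phi>" "deriv \<phi> = k"
proof -
  define \<phi> where "\<phi> x = integral {c..x} k" for x
  have D: "(\<phi> has_real_derivative k x) (at x)" for x
  proof -
    \<comment> \<open>Starting the integral at a point left of both \<open>c\<close> and
      \<open>x\<close> does not change its value, and it makes \<open>x\<close> interior to
      \<open>{A..B}\<close>, so the derivative within the interval is a full derivative.\<close>
    define A where "A = min c x - 1"
    define B where "B = x + 1"
    have \<phi>A: "integral {A..y} k = \<phi> y" for y
    proof -
      have "integral {A..y} k = integral {A..y} (\<lambda>x. if x \<in> {c..} then k x else 0)"
        by (rule integral_cong) (use k(2) in auto)
      also have "\<dots> = integral ({A..y} \<inter> {c..}) k"
        by (subst Int_commute) (rule integral_restrict_Int)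
      also have "{A..y} \<inter> {c..} = {c..y}" by (auto simp: A_def)
      finally show ?thesis by (simp add: \<phi>_def)
    qed
    have "((\<lambda>y. integral {A..y} k) has_real_derivative k x) (at x within {A..B})"
      using continuous_on_subset[OF k(1) subset_UNIV]
      by (rule integral_has_real_derivative) (simp add: A_def B_def)
    then have "(\<phi> has_real_derivative k x) (at x within {A..B})"
      unfolding \<phi>A .
    moreover have "at x within {A..B} = at x"
      by (rule at_within_interior) (simp add: A_def B_def)
    ultimately show ?thesis by simp
  qed
  have zero: "\<phi> x = 0" if "x \<notin> {c..d}" for x
  proof (cases "x < c")
    case False
    have "integral {c..x} k = integral {c..x} (\<lambda>x. if x \<in> {..d} then k x else 0)"
      by (rule integral_cong) (use k(2) in auto)
    also have "\<dots> = integral ({c..x} \<inter> {..d}) k"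
      by (subst Int_commute) (rule integral_restrict_Int)
    also have "{c..x} \<inter> {..d} = {c..d}" using that False by auto
    finally show ?thesis using k(3) by (simp add: \<phi>_def)
  qed (simp add: \<phi>_def)
  have "\<phi> C1_differentiable_on UNIV"
    unfolding C1_differentiable_on_def
    using D k(1) by (intro exI[of _ k]) (auto simp: has_real_derivative_iff_has_vector_derivative)
  then have "test_function U \<phi>"
    unfolding test_function_def using U zero by (intro conjI exI[of _ "{c..d}"]) auto
  moreover have "deriv \<phi> = k" by (intro ext DERIV_imp_deriv D)
  ultimately show ?thesis by (rule that)
qed

text \<open>Piecewise linear cutoffs increasing to the indicator of \<open>{c<..<d}\<close>. They
  serve as derivatives of test functions of class C1, so continuity is all the smoothness
  required.\<close>

definition trapezoid :: "real \<Rightarrow> real \<Rightarrow> nat \<Rightarrow> real \<Rightarrow> real" where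
  "trapezoid c d n x = max 0 (min 1 (real n * min (x - c) (d - x)))"

lemma trapezoid_continuous: "continuous_on S (trapezoid c d n)"
  unfolding trapezoid_def by (intro continuous_intros)

lemma trapezoid_bounds: "0 \<le> trapezoid c d n x" "trapezoid c d n x \<le> 1"
  by (auto simp: trapezoid_def)

lemma trapezoid_outside: "x \<notin> {c<..<d} \<Longrightarrow> trapezoid c d n x = 0"
  using mult_nonneg_nonpos[of "real n" "min (x - c) (d - x)"] by (force simp: trapezoid_def)

lemma trapezoid_inside:
  assumes "x \<in> {c<..<d}"
  shows "(\<lambda>n. trapezoid c d n x) \<longlonglongrightarrow> 1"
proof (rule tendsto_eventually)
  define r where "r = min (x - c) (d - x)"
  have r: "r > 0" using assms by (simp add: r_def)
  obtain n0 where n0: "1 / r < real n0" using reals_Archimedean2 by blast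
  have "trapezoid c d n x = 1" if "n \<ge> n0" for n
  proof -
    have "1 < real n0 * r" using n0 r by (simp add: field_simps)
    also have "\<dots> \<le> real n * r" using that r by (intro mult_right_mono) auto
    finally show ?thesis by (simp add: trapezoid_def r_def)
  qed
  then show "\<forall>\<^sub>F n in sequentially. trapezoid c d n x = 1"
    using eventually_sequentially by blast
qed

lemma integral_trapezoid_tendsto:
  assumes f: "f absolutely_integrable_on {A..B}" and cd: "{c..d} \<subseteq> {A..B}"
  shows "(\<lambda>n. integral {A..B} (\<lambda>x. f x * trapezoid c d n x)) \<longlonglongrightarrow> integral {c..d} f"
proof -
  define g where "g x = (if x \<in> {c<..<d} then f x else 0)" for x
  have "(\<lambda>n. integral {A..B} (\<lambda>x. f x * trapezoid c d n x)) \<longlonglongrightarrow> integral {A..B} g"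
  proof (rule dominated_convergence(2)[where h = "\<lambda>x. \<bar>f x\<bar>"])
    fix n
    show "(\<lambda>x. f x * trapezoid c d n x) integrable_on {A..B}"
      using absolutely_integrable_mult_continuous[OF f trapezoid_continuous]
      by (simp add: absolutely_integrable_on_def)
    show "norm (f x * trapezoid c d n x) \<le> \<bar>f x\<bar>" for x
      using trapezoid_bounds[of c d n x] by (simp add: abs_mult mult_left_le)
  next
    fix x
    show "(\<lambda>n. f x * trapezoid c d n x) \<longlonglongrightarrow> g x"
    proof (cases "x \<in> {c<..<d}")
      case True
      then show ?thesis
        using tendsto_mult[OF tendsto_const[of "f x"] trapezoid_inside[OF True]] by (simp add: g_def)
    next
      case False
      then show ?thesis
        unfolding trapezoid_outside[OF False] by (simp add: g_def del: greaterThanLessThan_iff)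
    qed
  qed (use f in \<open>simp add: absolutely_integrable_on_def\<close>)
  also have "integral {A..B} g = integral ({A..B} \<inter> {c<..<d}) f"
    unfolding g_def by (subst Int_commute) (rule integral_restrict_Int)
  also have "{A..B} \<inter> {c<..<d} = {c<..<d}" using cd by force
  also have "integral {c<..<d} f = integral {c..d} f"
    by (rule integral_open_interval_real[symmetric])
  finally show ?thesis .
qed

lemma primitive_on_exists:
  assumes U: "open U" "is_interval U" and g: "\<And>c d. {c..d} \<subseteq> U \<Longrightarrow> g integrable_on {c..d}"
  obtains Y where "primitive_on U Y g"
proof (cases "U = {}")
  case True
  then have "primitive_on U (\<lambda>_. 0) g" by (auto simp: primitive_on_def)
  then show ?thesis by (rule that)
next
  case False
  then obtain x0 where x0: "x0 \<in> U" by blast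
  have I: "{u..v} \<subseteq> U" if "u \<in> U" "v \<in> U" for u v
    using U(2) that unfolding is_interval_1 by (meson atLeastAtMost_iff subsetI)
  \<comment> \<open>One of the two intervals is empty or a point and contributes \<open>0\<close>;
    the difference is the oriented integral from \<open>x0\<close> to \<open>x\<close>.\<close>
  define Y where "Y x = integral {x0..x} g - integral {x..x0} g" for x
  have "primitive_on U Y g"
    unfolding primitive_on_def
  proof (intro allI impI)
    fix s t assume st: "s \<le> t \<and> {s..t} \<subseteq> U"
    then have stU: "s \<in> U" "t \<in> U" by auto
    note comb = Henstock_Kurzweil_Integration.integral_combine[where f = g]
    have "Y t - Y s = integral {s..t} g"
    proof -
      consider "x0 \<le> s" | "s < x0" "x0 \<le> t" | "t < x0" by linarith
      then show ?thesis
      proof cases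
        case 1
        then show ?thesis
          using comb[of x0 s t] st g[OF I[OF x0 stU(2)]] by (cases "x0 = s"; cases "x0 = t") (auto simp: Y_def)
      next
        case 2
        then show ?thesis
          using comb[of s x0 t] st g[of s t] by (cases "x0 = t") (auto simp: Y_def)
      next
        case 3
        then show ?thesis
          using comb[of s t x0] st g[OF I[OF stU(1) x0]] by (auto simp: Y_def)
      qed
    qed
    then show "(g has_integral Y t - Y s) {s..t}"
      using st g[of s t] by (simp add: has_integral_iff)
  qed
  then show ?thesis by (rule that)
qed

text \<open>A continuous function of zero mean supported in \<open>{c..d}\<close> is the derivative
  of a test function, so it cannot distinguish two functions with the same weak derivative.\<close>

lemma has_weak_deriv_integral_eq:
  assumes U: "open U" "is_interval U" "U \<noteq> {}" and w: "has_weak_deriv U f g" "has_weak_deriv U F g"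
    and k: "continuous_on UNIV k" "\<And>x. x \<notin> {c<..<d} \<Longrightarrow> k x = 0" "integral {c..d} k = 0"
    and cd: "{c..d} \<subseteq> U"
  shows "integral {c..d} (\<lambda>x. (f x - F x) * k x) = 0"
proof -
  obtain \<phi> where \<phi>: "test_function U \<phi>" "deriv \<phi> = k"
    by (rule test_function_primitive[OF k cd])
  have k': "\<And>x. x \<notin> {c..d} \<Longrightarrow> k x = 0" using k(2) by auto
  have f: "locally_integrable_on U f" and F: "locally_integrable_on U F"
    using w by (auto simp: has_weak_deriv_def)
  note int_f = integral_test_function[OF U f k(1) k' cd]
  note int_F = integral_test_function[OF U F k(1) k' cd]
  have "(LINT x|lebesgue_on U. f x * k x) = (LINT x|lebesgue_on U. F x * k x)"
  proof -
    have "(LINT x|lebesgue_on U. f x * deriv \<phi> x) = (LINT x|lebesgue_on U. F x * deriv \<phi> x)"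
      using w \<phi>(1) by (simp add: has_weak_deriv_def)
    then show ?thesis by (simp add: \<phi>(2))
  qed
  then have "integral {c..d} (\<lambda>x. f x * k x) = integral {c..d} (\<lambda>x. F x * k x)"
    using int_f(2) int_F(2) by simp
  moreover have "integral {c..d} (\<lambda>x. f x * k x - F x * k x)
      = integral {c..d} (\<lambda>x. f x * k x) - integral {c..d} (\<lambda>x. F x * k x)"
    using int_f(1) int_F(1) by (intro integral_diff) (auto simp: absolutely_integrable_on_def)
  ultimately show ?thesis
    by (simp add: left_diff_distrib)
qed

text \<open>Let \<open>F\<close> be a primitive of \<open>g\<close> and \<open>h\<close> the
  difference of \<open>f\<close> and \<open>F\<close>. Subtracting from a cutoff a multiple of the
  fixed bump \<open>\<rho>\<close> with the same integral leaves a function of zero mean, so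
  \<open>h\<close> acts on every cutoff as the constant \<open>m\<close>. Sharpening the cutoffs
  gives \<open>integral {c..d} h = m * (d - c)\<close> on every interval, hence \<open>h = m\<close>
  almost everywhere.\<close>

theorem has_weak_deriv_imp_primitive_on:
  assumes w: "has_weak_deriv U f g" and U: "open U" "is_interval U"
  obtains Y N where "primitive_on U Y g" "negligible N" "\<And>x. x \<in> U - N \<Longrightarrow> f x = Y x"
proof (cases "U = {}")
  case True
  then have "primitive_on U f g" by (auto simp: primitive_on_def)
  then show ?thesis by (rule that[of f "{}"]) auto
next
  case False
  have g: "locally_integrable_on U g" and f: "locally_integrable_on U f"
    using w by (auto simp: has_weak_deriv_def)
  obtain F where F: "primitive_on U F g"
    by (rule primitive_on_exists[OF U, of g])
      (use locally_integrable_on_Icc[OF g] in \<open>auto simp: absolutely_integrable_on_def\<close>)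
  have wF: "has_weak_deriv U F g"
    by (rule primitive_on_imp_has_weak_deriv[OF U g F, of "{}"]) auto
  then have FL: "locally_integrable_on U F" by (simp add: has_weak_deriv_def)
  define h where "h x = f x - F x" for x
  have h: "h absolutely_integrable_on {c..d}" if "{c..d} \<subseteq> U" for c d
    unfolding h_def using f FL that by (intro set_integral_diff locally_integrable_on_Icc)
  obtain x0 e where x0: "x0 \<in> U" "e > 0" "cball x0 e \<subseteq> U"
    using False \<open>open U\<close> unfolding open_contains_cball by blast
  define c0 where "c0 = x0 - e"
  define d0 where "d0 = x0 + e"
  have cd0: "c0 < d0" "{c0..d0} \<subseteq> U"
    using x0 by (auto simp: c0_def d0_def cball_eq_atLeastAtMost)
  \<comment> \<open>A bump of positive integral is needed as a divisor.
    \<open>trapezoid c0 d0 0\<close> is identically zero, so a suitable index is obtained from the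
    limit.\<close>
  have "(\<lambda>n. integral {c0..d0} (\<lambda>x. 1 * trapezoid c0 d0 n x)) \<longlonglongrightarrow> integral {c0..d0} (\<lambda>_. 1)"
    by (rule integral_trapezoid_tendsto) auto
  then have "(\<lambda>n. integral {c0..d0} (trapezoid c0 d0 n)) \<longlonglongrightarrow> d0 - c0"
    using cd0 by simp
  then have "\<forall>\<^sub>F n in sequentially. integral {c0..d0} (trapezoid c0 d0 n) > 0"
    using cd0(1) by (intro order_tendstoD) auto
  then obtain n0 where n0: "integral {c0..d0} (trapezoid c0 d0 n0) > 0"
    using eventually_happens by force
  define \<rho> where "\<rho> = trapezoid c0 d0 n0"
  define m where "m = integral {c0..d0} (\<lambda>x. h x * \<rho> x) / integral {c0..d0} \<rho>"
  have inth: "integral {c..d} h = m * (d - c)" if cd: "c \<le> d" "{c..d} \<subseteq> U" for c d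
  proof -
    define A where "A = min c c0"
    define B where "B = max d d0"
    have AU: "A \<in> U" "B \<in> U" using cd cd0 by (auto simp: A_def B_def min_def max_def)
    then have AB: "{A..B} \<subseteq> U"
      using U(2) unfolding is_interval_1 by (meson atLeastAtMost_iff subsetI)
    have sub: "{c..d} \<subseteq> {A..B}" "{c0..d0} \<subseteq> {A..B}" by (auto simp: A_def B_def)
    have restr: "integral {A..B} (\<lambda>x. u x * trapezoid c' d' n x) = integral {c'..d'} (\<lambda>x. u x * trapezoid c' d' n x)"
      if "{c'..d'} \<subseteq> {A..B}" for u c' d' n
    proof -
      have "integral {A..B} (\<lambda>x. u x * trapezoid c' d' n x)
          = integral {A..B} (\<lambda>x. if x \<in> {c'..d'} then u x * trapezoid c' d' n x else 0)"
        by (rule integral_cong) (auto simp: trapezoid_outside)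
      also have "\<dots> = integral ({A..B} \<inter> {c'..d'}) (\<lambda>x. u x * trapezoid c' d' n x)"
        by (subst Int_commute) (rule integral_restrict_Int)
      also have "{A..B} \<inter> {c'..d'} = {c'..d'}" using that by auto
      finally show ?thesis .
    qed
    have trap_int: "(\<lambda>x. h x * trapezoid c' d' n x) integrable_on {A..B}" for c' d' n
      using absolutely_integrable_mult_continuous[OF h[OF AB] trapezoid_continuous]
      by (simp add: absolutely_integrable_on_def)
    have eq: "integral {A..B} (\<lambda>x. h x * trapezoid c d n x) = m * integral {A..B} (\<lambda>x. 1 * trapezoid c d n x)" for n
    proof -
      define q where "q = integral {A..B} (trapezoid c d n) / integral {c0..d0} \<rho>"
      have \<rho>AB: "integral {A..B} \<rho> = integral {c0..d0} \<rho>"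
        using restr[OF sub(2), of "\<lambda>_. 1" n0] by (simp add: \<rho>_def)
      define k where "k x = trapezoid c d n x - q * \<rho> x" for x
      have k1: "continuous_on UNIV k"
        unfolding k_def \<rho>_def by (intro continuous_intros trapezoid_continuous)
      have k2: "k x = 0" if "x \<notin> {A<..<B}" for x
      proof -
        have "x \<notin> {c<..<d}" "x \<notin> {c0<..<d0}" using that by (auto simp: A_def B_def)
        note out = this[THEN trapezoid_outside]
        show ?thesis unfolding k_def \<rho>_def out by simp
      qed
      have ti: "(trapezoid c d n has_integral integral {A..B} (trapezoid c d n)) {A..B}"
        "(\<rho> has_integral integral {A..B} \<rho>) {A..B}"
        unfolding \<rho>_def by (intro integrable_integral integrable_continuous_interval trapezoid_continuous)+
      have "(k has_integral integral {A..B} (trapezoid c d n) - q * integral {A..B} \<rho>) {A..B}"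
        unfolding k_def using ti by (intro has_integral_diff has_integral_mult_right)
      then have k3: "integral {A..B} k = 0"
        using n0 by (simp add: q_def \<rho>AB has_integral_iff) (simp add: \<rho>_def)
      have "integral {A..B} (\<lambda>x. h x * k x) = 0"
        unfolding h_def by (rule has_weak_deriv_integral_eq[OF U False w wF k1 k2 k3 AB])
      moreover have "((\<lambda>x. h x * trapezoid c d n x - q * (h x * \<rho> x)) has_integral
          integral {A..B} (\<lambda>x. h x * trapezoid c d n x) - q * integral {A..B} (\<lambda>x. h x * \<rho> x)) {A..B}"
        using trap_int unfolding \<rho>_def by (intro has_integral_diff has_integral_mult_right integrable_integral)
      moreover have "(\<lambda>x. h x * trapezoid c d n x - q * (h x * \<rho> x)) = (\<lambda>x. h x * k x)"
        by (auto simp: k_def algebra_simps)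
      ultimately have "integral {A..B} (\<lambda>x. h x * trapezoid c d n x) = q * integral {A..B} (\<lambda>x. h x * \<rho> x)"
        by (simp add: has_integral_iff)
      also have "integral {A..B} (\<lambda>x. h x * \<rho> x) = integral {c0..d0} (\<lambda>x. h x * \<rho> x)"
        unfolding \<rho>_def by (rule restr[OF sub(2)])
      finally show ?thesis by (simp add: q_def m_def mult.commute)
    qed
    have "(\<lambda>n. integral {A..B} (\<lambda>x. h x * trapezoid c d n x)) \<longlonglongrightarrow> integral {c..d} h"
      by (rule integral_trapezoid_tendsto[OF h[OF AB] sub(1)])
    moreover have "(\<lambda>n. m * integral {A..B} (\<lambda>x. 1 * trapezoid c d n x)) \<longlonglongrightarrow> m * integral {c..d} (\<lambda>_. 1)"
      by (intro tendsto_mult tendsto_const integral_trapezoid_tendsto sub(1)) auto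
    ultimately have "integral {c..d} h = m * integral {c..d} (\<lambda>_. 1)"
      unfolding eq by (rule LIMSEQ_unique)
    then show ?thesis using cd by simp
  qed
  define e where "e x = h x - m" for x
  have hi: "(e has_integral (integral {c..d} h - m * (d - c))) {c..d}" if "{c..d} \<subseteq> U" "c \<le> d" for c d
    unfolding e_def using h[OF that(1)] has_integral_const_real[of m c d] that
    by (intro has_integral_diff integrable_integral) (auto simp: absolutely_integrable_on_def mult.commute)
  have "negligible {x \<in> U. e x \<noteq> 0}"
  proof (rule integral_zero_imp_negligible[OF U(1)])
    fix c d assume cd: "{c..d} \<subseteq> U"
    show "e integrable_on {c..d}" "integral {c..d} e = 0"
      using hi[OF cd] inth[OF _ cd] by (cases "c \<le> d"; auto simp: has_integral_iff)+
  qed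
  moreover have "primitive_on U (\<lambda>x. F x + m) g"
    using F by (simp add: primitive_on_def)
  ultimately show ?thesis
    by (intro that[of "\<lambda>x. F x + m" "{x \<in> U. e x \<noteq> 0}"]) (auto simp: e_def h_def)
qed

section \<open>Uniqueness of the weak derivative and the norm built on it\<close>

lemma primitive_on_unique_deriv:
  assumes U: "open U" and Y: "primitive_on U Y p" "primitive_on U Y q"
  shows "negligible {x \<in> U. p x \<noteq> q x}"
proof -
  have "negligible {x \<in> U. p x - q x \<noteq> 0}"
  proof (rule integral_zero_imp_negligible[OF U])
    fix c d assume cd: "{c..d} \<subseteq> U"
    have "((\<lambda>x. p x - q x) has_integral 0) {c..d}" if "c \<le> d"
      using has_integral_diff[OF primitive_onD[OF Y(1) that cd] primitive_onD[OF Y(2) that cd]] by simp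
    then show "(\<lambda>x. p x - q x) integrable_on {c..d}" "integral {c..d} (\<lambda>x. p x - q x) = 0"
      by (cases "c \<le> d"; auto simp: has_integral_iff)+
  qed
  then show ?thesis by simp
qed

lemma continuous_eq_if_negligible:
  fixes f g :: "real \<Rightarrow> real"
  assumes U: "open U" and c: "continuous_on U f" "continuous_on U g"
    and N: "negligible N" "\<And>x. x \<in> U - N \<Longrightarrow> f x = g x" and x: "x \<in> U"
  shows "f x = g x"
proof (rule ccontr)
  assume "f x \<noteq> g x"
  define V where "V = U \<inter> (\<lambda>x. f x - g x) -` (- {0})"
  have "open V"
    unfolding V_def using c by (intro continuous_open_preimage[OF _ U]) (auto intro!: continuous_intros)
  moreover have "V \<subseteq> N" using N(2) by (auto simp: V_def)
  then have "negligible V" using N(1) by (rule negligible_subset[rotated])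
  ultimately have "V = {}" using open_not_negligible by blast
  with x \<open>f x \<noteq> g x\<close> show False by (auto simp: V_def)
qed

lemma has_weak_deriv_unique:
  assumes w: "has_weak_deriv U f p" "has_weak_deriv U f q" and U: "open U" "is_interval U"
  shows "negligible {x \<in> U. p x \<noteq> q x}"
proof -
  obtain Y N where Y: "primitive_on U Y p" "negligible N" "\<And>x. x \<in> U - N \<Longrightarrow> f x = Y x"
    by (rule has_weak_deriv_imp_primitive_on[OF w(1) U]) blast
  obtain Z M where Z: "primitive_on U Z q" "negligible M" "\<And>x. x \<in> U - M \<Longrightarrow> f x = Z x"
    by (rule has_weak_deriv_imp_primitive_on[OF w(2) U]) blast
  have "Y x = Z x" if "x \<in> U" for x
    using U(1) primitive_on_continuous[OF U(1) Y(1)] primitive_on_continuous[OF U(1) Z(1)]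
      negligible_Un[OF Y(2) Z(2)] _ that
    by (rule continuous_eq_if_negligible) (metis Y(3) Z(3) DiffI DiffD1 DiffD2 UnCI)
  then have "primitive_on U Y q"
    using Z(1) unfolding primitive_on_def by (metis atLeastAtMost_iff order_refl subsetD)
  with U(1) Y(1) show ?thesis by (rule primitive_on_unique_deriv)
qed

text \<open>\<open>weak_deriv\<close> is an arbitrary choice; uniqueness almost everywhere allows
  any concrete weak derivative to compute the norm.\<close>

lemma H1_norm_eq:
  assumes w: "has_weak_deriv {c<..<d} f p" and f: "square_integrable_on {c<..<d} f"
    and p: "square_integrable_on {c<..<d} p"
  shows "H1_norm {c<..<d} f = sqrt (integral {c..d} (\<lambda>x. (f x)\<^sup>2) + integral {c..d} (\<lambda>x. (p x)\<^sup>2))"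
proof -
  define q where "q = weak_deriv {c<..<d} f"
  have "has_weak_deriv {c<..<d} f q"
    unfolding q_def weak_deriv_def by (rule someI[of "has_weak_deriv {c<..<d} f", OF w])
  then have N: "negligible {x \<in> {c<..<d}. p x \<noteq> q x}"
    by (intro has_weak_deriv_unique[OF w]) (auto simp: is_interval_1)
  have q: "square_integrable_on {c<..<d} q"
    by (rule square_integrable_on_spike[OF p _ N]) auto
  have *: "(LINT x|lebesgue_on {c<..<d}. (u x)\<^sup>2) = integral {c..d} (\<lambda>x. (u x)\<^sup>2)"
    if "square_integrable_on {c<..<d} u" for u
    using that unfolding integral_open_interval_real square_integrable_on_def
    by (intro lebesgue_integral_eq_integral) auto
  have "integral {c<..<d} (\<lambda>x. (p x)\<^sup>2) = integral {c<..<d} (\<lambda>x. (q x)\<^sup>2)"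
    by (rule integral_spike[OF N]) auto
  then have "integral {c..d} (\<lambda>x. (p x)\<^sup>2) = integral {c..d} (\<lambda>x. (q x)\<^sup>2)"
    by (simp only: integral_open_interval_real)
  then show ?thesis
    unfolding H1_norm_def q_def[symmetric] *[OF f] *[OF q] by simp
qed

section \<open>Absolutely continuous representatives of solutions\<close>

lemma AE_lebesgue_on_negligible:
  assumes "AE x in lebesgue_on S. P x" "S \<in> sets lebesgue"
  obtains N where "negligible N" "\<And>x. x \<in> S \<Longrightarrow> x \<notin> N \<Longrightarrow> P x"
proof -
  have "AE x in lebesgue. x \<in> S \<longrightarrow> P x"
    using assms by (simp add: AE_restrict_space_iff)
  then obtain N where "N \<in> null_sets lebesgue" "{x \<in> space lebesgue. \<not> (x \<in> S \<longrightarrow> P x)} \<subseteq> N"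
    unfolding eventually_ae_filter by blast
  then show ?thesis
    by (intro that[of N]) (auto simp: negligible_iff_null_sets)
qed

lemma locally_integrable_on_subset:
  "locally_integrable_on U f \<Longrightarrow> V \<subseteq> U \<Longrightarrow> locally_integrable_on V f"
  unfolding locally_integrable_on_def by blast

lemma square_integrable_on_combine:
  assumes "square_integrable_on {s..u} f" "square_integrable_on {u..t} f" "s \<le> u" "u \<le> t"
  shows "square_integrable_on {s..t} f"
proof -
  have "f integrable_on {s..t}"
    using assms square_integrable_on_imp_integrable Henstock_Kurzweil_Integration.integrable_combine[of s u t f] by blast
  moreover have "(\<lambda>x. (f x)\<^sup>2) integrable_on {s..t}"
    using assms square_integrable_on_power2 Henstock_Kurzweil_Integration.integrable_combine[of s u t "\<lambda>x. (f x)\<^sup>2"] by blast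
  ultimately show ?thesis
    by (simp add: square_integrable_on_Icc_iff integrable_imp_measurable)
qed

lemma primitive_on_shift:
  assumes "primitive_on U Y p"
  shows "primitive_on {s. t + s \<in> U} (\<lambda>s. Y (t + s)) (\<lambda>s. p (t + s))"
  unfolding primitive_on_def
proof (intro allI impI)
  fix u v assume uv: "u \<le> v \<and> {u..v} \<subseteq> {s. t + s \<in> U}"
  have "{t + u..t + v} \<subseteq> U"
  proof
    fix x assume "x \<in> {t + u..t + v}"
    then have "x - t \<in> {u..v}" by auto
    then have "t + (x - t) \<in> U" using uv by blast
    then show "x \<in> U" by simp
  qed
  then have "(p has_integral Y (t + v) - Y (t + u)) {t + u..t + v}"
    using uv by (intro primitive_onD[OF assms]) auto
  from has_integral_shift_real_ivl[OF this, of t]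
  show "((\<lambda>s. p (t + s)) has_integral Y (t + v) - Y (t + u)) {u..v}"
    by (simp add: add.commute)
qed

lemma negligible_shift:
  fixes N :: "real set"
  assumes "negligible N"
  shows "negligible {s. t + s \<in> N}"
proof -
  have "{s. t + s \<in> N} = (+) (- t) ` N"
    by (auto simp: image_iff) (metis add.commute diff_add_cancel uminus_add_conv_diff)
  then show ?thesis using negligible_translation[OF assms] by metis
qed

text \<open>Solutions in the almost everywhere sense, given by their absolutely continuous
  representative and its derivative.\<close>

locale mild_solution =
  fixes a b :: real and Y p :: "real \<Rightarrow> real"
  assumes primitive: "primitive_on {-1..} Y p"
    and square_integrable: "\<And>T. square_integrable_on {-1..T} p"
    and equation: "\<exists>N. negligible N \<and> (\<forall>t>0. t \<notin> N \<longrightarrow> p t + p (t - 1) + a * Y t + b * Y (t - 1) = 0)"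

definition history_energy :: "(real \<Rightarrow> real) \<Rightarrow> (real \<Rightarrow> real) \<Rightarrow> real \<Rightarrow> real" where
  "history_energy Y p t = integral {t - 1..t} (\<lambda>x. (Y x)\<^sup>2) + integral {t - 1..t} (\<lambda>x. (p x)\<^sup>2)"

lemma H1_norm_primitive:
  assumes Y: "primitive_on {-1..} Y p" and p: "\<And>T. square_integrable_on {-1..T} p"
    and t: "0 \<le> t" and N: "negligible N" "\<And>s. s \<in> {-1<..<0} - N \<Longrightarrow> f s = Y (t + s)"
  shows "H1_norm {-1<..<0} f = sqrt (history_energy Y p t)"
proof -
  have sub: "{-1..0} \<subseteq> {s. t + s \<in> {-1..}}" using t by auto
  have prim: "primitive_on {-1..0} (\<lambda>s. Y (t + s)) (\<lambda>s. p (t + s))"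
    using primitive_on_subset[OF primitive_on_shift[OF Y] sub] .
  have "square_integrable_on {-1 + t..0 + t} p"
    by (rule square_integrable_on_subset[OF p[of t]]) (use t in auto)
  from square_integrable_on_shift[OF this]
  have p1: "square_integrable_on {-1..0} (\<lambda>s. p (t + s))"
    by (simp add: add.commute)
  have Y1: "square_integrable_on {-1..0} (\<lambda>s. Y (t + s))"
    by (intro square_integrable_on_continuous primitive_on_continuous_Icc[OF prim])
  have p2: "square_integrable_on {-1<..<0} (\<lambda>s. p (t + s))"
    using p1 square_integrable_on_Icc_iff_Ioo by blast
  have Y2: "square_integrable_on {-1<..<0} (\<lambda>s. Y (t + s))"
    using Y1 square_integrable_on_Icc_iff_Ioo by blast
  have f: "square_integrable_on {-1<..<0} f"
    by (rule square_integrable_on_spike[OF Y2 _ N]) auto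
  have "has_weak_deriv {-1<..<0} f (\<lambda>s. p (t + s))"
  proof (rule primitive_on_imp_has_weak_deriv[OF _ _ _ _ N])
    show "locally_integrable_on {-1<..<0} (\<lambda>s. p (t + s))"
      unfolding locally_integrable_on_def
    proof (intro allI impI)
      fix K :: "real set" assume K: "compact K \<and> K \<subseteq> {-1<..<0}"
      have "(\<lambda>s. p (t + s)) absolutely_integrable_on {-1..0}"
        using p1 by (rule square_integrable_on_imp_absolutely_integrable)
      then show "(\<lambda>s. p (t + s)) absolutely_integrable_on K"
        by (rule set_integrable_subset)
          (use K in \<open>auto intro: lmeasurable_compact fmeasurableD\<close>)
    qed
    show "primitive_on {-1<..<0} (\<lambda>s. Y (t + s)) (\<lambda>s. p (t + s))"
      using prim by (rule primitive_on_subset) auto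
  qed (auto simp: is_interval_1)
  from H1_norm_eq[OF this f p2]
  have "H1_norm {-1<..<0} f = sqrt (integral {-1..0} (\<lambda>s. (f s)\<^sup>2) + integral {-1..0} (\<lambda>s. (p (t + s))\<^sup>2))" .
  also have "integral {-1..0} (\<lambda>s. (f s)\<^sup>2) = integral {-1..0} (\<lambda>s. (Y (t + s))\<^sup>2)"
    by (rule integral_spike[of "insert 0 (insert (-1) N)"]) (use N in auto)
  also have "\<dots> = integral {t - 1..t} (\<lambda>x. (Y x)\<^sup>2)"
    using integral_shift_Icc[of "-1" 0 "\<lambda>x. (Y x)\<^sup>2" t] by (simp add: add.commute)
  also have "integral {-1..0} (\<lambda>s. (p (t + s))\<^sup>2) = integral {t - 1..t} (\<lambda>x. (p x)\<^sup>2)"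
    using integral_shift_Icc[of "-1" 0 "\<lambda>x. (p x)\<^sup>2" t] by (simp add: add.commute)
  finally show ?thesis by (simp add: history_energy_def)
qed

text \<open>\<open>H1_loc\<close> says nothing about the derivative near \<open>-1\<close>, but the
  datum does: \<open>y\<close> and \<open>y0\<close> agree almost everywhere on
  \<open>{-1<..<0}\<close>, so \<open>p\<close> is square integrable there together with the weak
  derivative of \<open>y0\<close>. Gluing at \<open>-1/2\<close> with the local information gives
  square integrability down to \<open>-1\<close>, and the representative extends continuously to the
  closed half-line.\<close>

lemma neutral_solution_imp_mild_solution:
  assumes "neutral_solution a b y0 y"
  obtains Y p where "mild_solution a b Y p"
    "\<forall>t\<ge>0. state_norm y t = sqrt (history_energy Y p t)"
    "H1_norm {-1<..<0} y0 = sqrt (history_energy Y p 0)"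
proof -
  obtain p where y0: "y0 \<in> H1 {-1<..<0}" and y: "y \<in> H1_loc {-1<..}"
    and ae0: "AE t in lebesgue_on {-1<..<0}. y t = y0 t"
    and wd: "has_weak_deriv {-1<..} y p"
    and ae: "AE t in lebesgue_on {0<..}. p t + p (t - 1) + a * y t + b * y (t - 1) = 0"
    using assms unfolding neutral_solution_def by blast
  obtain Z N where Z: "primitive_on {-1<..} Z p" "negligible N" "\<And>x. x \<in> {-1<..} - N \<Longrightarrow> y x = Z x"
    using has_weak_deriv_imp_primitive_on[OF wd open_greaterThan] by (auto simp: is_interval_1)
  obtain M where M: "negligible M" "\<And>x. x \<in> {-1<..<0} \<Longrightarrow> x \<notin> M \<Longrightarrow> y x = y0 x"
    using AE_lebesgue_on_negligible[OF ae0] by auto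
  obtain L where L: "negligible L" "\<And>t. t \<in> {0<..} \<Longrightarrow> t \<notin> L \<Longrightarrow> p t + p (t - 1) + a * y t + b * y (t - 1) = 0"
    using AE_lebesgue_on_negligible[OF ae] by auto
  have lp: "locally_integrable_on {-1<..} p"
    using wd by (simp add: has_weak_deriv_def)
  have p0: "square_integrable_on {-1<..<0} p"
  proof -
    obtain g where g: "has_weak_deriv {-1<..<0} y0 g" "square_integrable_on {-1<..<0} g"
      using y0 by (auto simp: H1_def)
    have "has_weak_deriv {-1<..<0} y0 p"
    proof (rule primitive_on_imp_has_weak_deriv)
      show "locally_integrable_on {-1<..<0} p"
        using lp by (rule locally_integrable_on_subset) auto
      show "primitive_on {-1<..<0} Z p"
        using Z(1) by (rule primitive_on_subset) auto
      show "negligible (N \<union> M)" using Z M by simp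
      show "y0 x = Z x" if "x \<in> {-1<..<0} - (N \<union> M)" for x
        using that Z(3)[of x] M(2)[of x] by auto
    qed (auto simp: is_interval_1)
    then have "negligible {x \<in> {-1<..<0}. g x \<noteq> p x}"
      by (intro has_weak_deriv_unique[OF g(1)]) (auto simp: is_interval_1)
    then show ?thesis
      by (rule square_integrable_on_spike[OF g(2), rotated]) auto
  qed
  have p1: "square_integrable_on {-1/2<..<T} p" for T
  proof -
    have sub: "{-1/2<..<T} \<subseteq> {-1<..}" by auto
    have "closure {-1/2<..<T} \<subseteq> {-1/2..T}" by (rule closure_minimal) auto
    then have "closure {-1/2<..<T} \<subseteq> {-1<..}" "compact (closure {-1/2<..<T})"
      by (force, simp)
    then have "y \<in> H1 {-1/2<..<T}"
      using y unfolding H1_loc_def by auto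
    then obtain g where g: "has_weak_deriv {-1/2<..<T} y g" "square_integrable_on {-1/2<..<T} g"
      by (auto simp: H1_def)
    have "has_weak_deriv {-1/2<..<T} y p"
      by (rule has_weak_deriv_subset[OF wd sub]) auto
    then have "negligible {x \<in> {-1/2<..<T}. g x \<noteq> p x}"
      by (intro has_weak_deriv_unique[OF g(1)]) (auto simp: is_interval_1)
    then show ?thesis
      by (rule square_integrable_on_spike[OF g(2), rotated]) auto
  qed
  have sq: "square_integrable_on {-1..T} p" for T
  proof -
    have "square_integrable_on {-1..-1/2} p"
      by (rule square_integrable_on_subset[of "{-1..0}"])
        (use p0 square_integrable_on_Icc_iff_Ioo[of "-1" 0 p] in auto)
    moreover have "square_integrable_on {-1/2..max T 0} p"
      using p1 square_integrable_on_Icc_iff_Ioo by blast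
    ultimately have "square_integrable_on {-1..max T 0} p"
      by (rule square_integrable_on_combine) auto
    then show ?thesis
      by (rule square_integrable_on_subset) auto
  qed
  have pint: "p integrable_on {-1..T}" for T
    using sq by (rule square_integrable_on_imp_integrable)
  \<comment> \<open>Integrating from \<open>-1\<close> includes the endpoint, where \<open>Z\<close>
    carries no information; the constant makes both representatives agree at
    \<open>0\<close>.\<close>
  define Y where "Y t = Z 0 + (integral {-1..t} p - integral {-1..0} p)" for t
  have prim: "primitive_on {-1..} Y p"
    unfolding primitive_on_def
  proof (intro allI impI)
    fix s t :: real assume st: "s \<le> t \<and> {s..t} \<subseteq> {-1..}"
    have "p integrable_on {s..t}"
      by (rule integrable_on_subinterval[OF pint[of t]]) (use st in auto)
    moreover have "Y t - Y s = integral {s..t} p"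
      using integral_initial_diff[OF pint[of t], of s t] st by (simp add: Y_def)
    ultimately show "(p has_integral Y t - Y s) {s..t}"
      by (simp add: has_integral_iff)
  qed
  have YZ: "Y t = Z t" if "t > -1" for t
  proof (cases "0 \<le> t")
    case True
    have "{0..t} \<subseteq> {-1<..}" by auto
    with True show ?thesis
      using integral_initial_diff[OF pint[of t], of 0 t] primitive_onD[OF Z(1), of 0 t]
      by (auto simp: Y_def has_integral_iff)
  next
    case False
    have "{t..0} \<subseteq> {-1<..}" using that by auto
    with False show ?thesis
      using integral_initial_diff[OF pint[of 0], of t 0] primitive_onD[OF Z(1), of t 0] that
      by (auto simp: Y_def has_integral_iff)
  qed
  have yY: "y t = Y t" if "t > -1" "t \<notin> N" for t
    using YZ Z(3)[of t] that by auto
  have "mild_solution a b Y p"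
  proof
    show "\<exists>N. negligible N \<and> (\<forall>t>0. t \<notin> N \<longrightarrow> p t + p (t - 1) + a * Y t + b * Y (t - 1) = 0)"
    proof (intro exI conjI allI impI)
      \<comment> \<open>The equation at \<open>t\<close> also involves \<open>t - 1\<close>, so the
        exceptional set of the representative is discarded together with its translate by
        one.\<close>
      show "negligible (L \<union> N \<union> {t. -1 + t \<in> N})"
        using L(1) Z(2) negligible_shift[OF Z(2), of "-1"] by simp
      show "p t + p (t - 1) + a * Y t + b * Y (t - 1) = 0"
        if "0 < t" "t \<notin> L \<union> N \<union> {t. -1 + t \<in> N}" for t
        using L(2)[of t] yY[of t] yY[of "t - 1"] that by auto
    qed
  qed (fact prim sq)+
  moreover have "\<forall>t\<ge>0. state_norm y t = sqrt (history_energy Y p t)"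
    unfolding state_norm_def
  proof (intro allI impI, rule H1_norm_primitive[OF prim sq])
    fix t :: real assume "0 \<le> t"
    then show "0 \<le> t" .
    show "negligible {s. t + s \<in> N}" using Z(2) by (rule negligible_shift)
    show "y (t + s) = Y (t + s)" if "s \<in> {-1<..<0} - {s. t + s \<in> N}" for s
      using that \<open>0 \<le> t\<close> by (intro yY) auto
  qed
  moreover have "H1_norm {-1<..<0} y0 = sqrt (history_energy Y p 0)"
  proof (rule H1_norm_primitive[OF prim sq])
    show "negligible (M \<union> N)" using Z(2) M(1) by simp
    show "y0 s = Y (0 + s)" if "s \<in> {-1<..<0} - (M \<union> N)" for s
      using that yY[of s] M(2)[of s] by auto
  qed simp
  ultimately show ?thesis by (rule that)
qed

section \<open>Energy and stability for \<open>a \<ge> \<bar>b\<bar>\<close>\<close>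

context mild_solution
begin

lemma square_integrable_p: "-1 \<le> s \<Longrightarrow> square_integrable_on {s..t} p"
  by (rule square_integrable_on_subset[OF square_integrable[of t]]) auto

lemma continuous_Y: "-1 \<le> s \<Longrightarrow> continuous_on {s..t} Y"
  by (rule primitive_on_continuous_Icc[OF primitive_on_subset[OF primitive]]) auto

lemma square_integrable_Y: "-1 \<le> s \<Longrightarrow> square_integrable_on {s..t} Y"
  by (rule square_integrable_on_continuous[OF continuous_Y])

lemma increment: "-1 \<le> s \<Longrightarrow> s \<le> t \<Longrightarrow> (p has_integral Y t - Y s) {s..t}"
  by (rule primitive_onD[OF primitive]) auto

lemma increment_power2:
  "-1 \<le> s \<Longrightarrow> s \<le> t \<Longrightarrow> ((\<lambda>x. 2 * Y x * p x) has_integral (Y t)\<^sup>2 - (Y s)\<^sup>2) {s..t}"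
  by (rule primitive_on_power2[OF primitive_on_subset[OF primitive] square_integrable_p]) auto

lemma square_integrable_pY: "-1 \<le> s \<Longrightarrow> square_integrable_on {s..t} (\<lambda>x. p x + k * Y x)"
  by (intro square_integrable_on_add square_integrable_on_cmult square_integrable_p square_integrable_Y)

lemmas p2_integrable = square_integrable_on_power2[OF square_integrable_p]
lemmas Y2_integrable = square_integrable_on_power2[OF square_integrable_Y]
lemmas pY2_integrable = square_integrable_on_power2[OF square_integrable_pY]

lemma oscillation:
  assumes "-1 \<le> s" "s \<le> u" "u \<le> v" "v \<le> t" "t \<le> s + 1"
  shows "(Y v - Y u)\<^sup>2 \<le> integral {s..t} (\<lambda>x. (p x)\<^sup>2)"
proof -
  have "(Y v - Y u)\<^sup>2 = (integral {u..v} p)\<^sup>2"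
    using increment[of u v] assms by (simp add: has_integral_iff)
  also have "\<dots> \<le> (v - u) * integral {u..v} (\<lambda>x. (p x)\<^sup>2)"
    using assms by (intro integral_power2_le square_integrable_p) auto
  also have "\<dots> \<le> 1 * integral {u..v} (\<lambda>x. (p x)\<^sup>2)"
    using assms by (intro mult_right_mono integral_nonneg p2_integrable) auto
  also have "\<dots> \<le> integral {s..t} (\<lambda>x. (p x)\<^sup>2)"
    using assms integral_nonneg_subset_le[OF p2_integrable, of s u v t] by auto
  finally show ?thesis .
qed

text \<open>The Sobolev embedding on a window of unit length: compare \<open>Y u\<close> with each
  \<open>Y x\<close> through \<open>oscillation\<close> and integrate over \<open>x\<close>.\<close>

lemma Y_power2_le_history_energy:
  assumes "0 \<le> t" "u \<in> {t - 1..t}"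
  shows "(Y u)\<^sup>2 \<le> 2 * history_energy Y p t"
proof -
  define P where "P = integral {t - 1..t} (\<lambda>x. (p x)\<^sup>2)"
  have Y2: "(\<lambda>x. (Y x)\<^sup>2) integrable_on {t - 1..t}" using assms by (intro Y2_integrable) auto
  have "integral {t - 1..t} (\<lambda>x. (Y u)\<^sup>2) \<le> integral {t - 1..t} (\<lambda>x. 2 * (Y x)\<^sup>2 + 2 * P)"
  proof (rule integral_le)
    show "(\<lambda>x. 2 * (Y x)\<^sup>2 + 2 * P) integrable_on {t - 1..t}"
      using Y2 by (intro integrable_add integrable_on_mult_right integrable_const_ivl)
    show "(Y u)\<^sup>2 \<le> 2 * (Y x)\<^sup>2 + 2 * P" if "x \<in> {t - 1..t}" for x
    proof -
      have "(Y u - Y x)\<^sup>2 \<le> P"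
        using oscillation[of "t - 1" u x t] oscillation[of "t - 1" x u t] assms that
        unfolding P_def by (cases "u \<le> x") (auto simp: power2_commute)
      moreover have "(Y u)\<^sup>2 \<le> 2 * (Y x)\<^sup>2 + 2 * (Y u - Y x)\<^sup>2"
        using zero_le_power2[of "Y u - 2 * Y x"] by (simp add: power2_eq_square algebra_simps)
      ultimately show ?thesis by linarith
    qed
  qed auto
  also have "\<dots> = 2 * integral {t - 1..t} (\<lambda>x. (Y x)\<^sup>2) + 2 * P"
    using integral_add[OF integrable_on_mult_right[OF Y2, of 2] integrable_const_ivl[of "2 * P"]] by simp
  finally show ?thesis by (simp add: history_energy_def P_def)
qed

lemma history_energy_nonneg: "0 \<le> t \<Longrightarrow> 0 \<le> history_energy Y p t"
  unfolding history_energy_def by (intro add_nonneg_nonneg integral_nonneg p2_integrable Y2_integrable) auto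

text \<open>Integrated form of the fact that a moving window integral has derivative
  \<open>f t - f (t - 1)\<close>.\<close>

lemma window_difference:
  fixes f :: "real \<Rightarrow> real"
  assumes f: "\<And>T. f integrable_on {-1..T}" and t: "0 \<le> t"
  shows "integral {t - 1..t} f - integral {-1..0} f = integral {0..t} (\<lambda>x. f x - f (x - 1))"
proof -
  have "f integrable_on {0..t}"
    by (rule integrable_on_subinterval[OF f[of t]]) auto
  moreover have "(\<lambda>x. f (x - 1)) integrable_on {0..t}"
    using integrable_shift_Icc[of f "-1" 0 t] f by simp
  ultimately have "integral {0..t} (\<lambda>x. f x - f (x - 1)) = integral {0..t} f - integral {0..t} (\<lambda>x. f (x - 1))"
    by (rule integral_diff)
  also have "integral {0..t} (\<lambda>x. f (x - 1)) = integral {-1..t - 1} f"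
    using integral_shift_Icc[of 0 t f "-1"] by simp
  also have "integral {0..t} f = integral {-1..t} f - integral {-1..0} f"
    using integral_initial_diff[OF f[of t], of 0 t] t by simp
  finally show ?thesis
    using integral_initial_diff[OF f[of t], of "t - 1" t] t by simp
qed

definition energy :: "real \<Rightarrow> real" where
  "energy t = integral {t - 1..t} (\<lambda>x. (p x + b * Y x)\<^sup>2) + (a - b) * (Y t)\<^sup>2"

text \<open>By the equation \<open>p + a Y\<close> at \<open>t\<close> equals \<open>- (p + b Y)\<close> at \<open>t - 1\<close>; squaring turns the
  change of a window integral into the exact expression \<open>(a - b) Y (2 p + (a + b) Y)\<close>.\<close>

lemma energy_identity:
  assumes t: "0 \<le> t"
  shows "energy t = energy 0 - (a\<^sup>2 - b\<^sup>2) * integral {0..t} (\<lambda>x. (Y x)\<^sup>2)"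
proof -
  define q where "q x = p x + b * Y x" for x
  obtain N where N: "negligible N" "\<And>t. t > 0 \<Longrightarrow> t \<notin> N \<Longrightarrow> p t + p (t - 1) + a * Y t + b * Y (t - 1) = 0"
    using equation by blast
  have "integral {t - 1..t} (\<lambda>x. (q x)\<^sup>2) - integral {-1..0} (\<lambda>x. (q x)\<^sup>2)
      = integral {0..t} (\<lambda>x. (q x)\<^sup>2 - (q (x - 1))\<^sup>2)"
    unfolding q_def by (intro window_difference pY2_integrable t order_refl)
  also have "\<dots> = integral {0..t} (\<lambda>x. - (a - b) * (2 * Y x * p x) - (a\<^sup>2 - b\<^sup>2) * (Y x)\<^sup>2)"
  proof (rule integral_spike)
    show "negligible (insert 0 N)" using N by simp
    fix x assume x: "x \<in> {0..t} - insert 0 N"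
    then have q1: "q (x - 1) = - (p x + a * Y x)"
      using N(2)[of x] by (simp add: q_def)
    show "- (a - b) * (2 * Y x * p x) - (a\<^sup>2 - b\<^sup>2) * (Y x)\<^sup>2 = (q x)\<^sup>2 - (q (x - 1))\<^sup>2"
      unfolding q1 by (simp add: q_def power2_eq_square algebra_simps)
  qed
  also have "\<dots> = - (a - b) * ((Y t)\<^sup>2 - (Y 0)\<^sup>2) - (a\<^sup>2 - b\<^sup>2) * integral {0..t} (\<lambda>x. (Y x)\<^sup>2)"
    using increment_power2[of 0 t] t Y2_integrable[of 0 t]
    by (intro integral_unique has_integral_diff has_integral_mult_right integrable_integral) simp_all
  finally show ?thesis
    by (simp add: energy_def q_def algebra_simps)
qed

lemma energy_0_le:
  assumes "b \<le> a"
  shows "energy 0 \<le> (2 + 2 * b\<^sup>2 + 2 * (a - b)) * history_energy Y p 0"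
proof -
  have Y2: "(\<lambda>x. (Y x)\<^sup>2) integrable_on {-1..0}" and p2: "(\<lambda>x. (p x)\<^sup>2) integrable_on {-1..0}"
    by (intro Y2_integrable p2_integrable; simp)+
  note I = integrable_on_mult_right[OF p2, of 2] integrable_on_mult_right[OF Y2, of "2 * b\<^sup>2"]
  have "integral {-1..0} (\<lambda>x. (p x + b * Y x)\<^sup>2) \<le> integral {-1..0} (\<lambda>x. 2 * (p x)\<^sup>2 + 2 * b\<^sup>2 * (Y x)\<^sup>2)"
  proof (rule integral_le)
    show "(p x + b * Y x)\<^sup>2 \<le> 2 * (p x)\<^sup>2 + 2 * b\<^sup>2 * (Y x)\<^sup>2" for x
      using zero_le_power2[of "p x - b * Y x"] by (simp add: power2_eq_square algebra_simps)
  qed (use integrable_add[OF I] pY2_integrable[where k = b] in auto)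
  also have "\<dots> = 2 * integral {-1..0} (\<lambda>x. (p x)\<^sup>2) + 2 * b\<^sup>2 * integral {-1..0} (\<lambda>x. (Y x)\<^sup>2)"
    using integral_add[OF I] by simp
  also have "\<dots> \<le> (2 + 2 * b\<^sup>2) * integral {-1..0} (\<lambda>x. (p x)\<^sup>2) + (2 + 2 * b\<^sup>2) * integral {-1..0} (\<lambda>x. (Y x)\<^sup>2)"
    using Y2 p2 by (intro add_mono mult_right_mono integral_nonneg) auto
  also have "\<dots> = (2 + 2 * b\<^sup>2) * history_energy Y p 0"
    by (simp add: history_energy_def algebra_simps)
  finally have "integral {-1..0} (\<lambda>x. (p x + b * Y x)\<^sup>2) \<le> (2 + 2 * b\<^sup>2) * history_energy Y p 0" .
  moreover have "(a - b) * (Y 0)\<^sup>2 \<le> (a - b) * (2 * history_energy Y p 0)"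
    using assms Y_power2_le_history_energy[of 0 0] by (intro mult_left_mono) auto
  ultimately show ?thesis
    by (simp add: energy_def algebra_simps)
qed

end

section \<open>Uniform bounds in the dissipative regime\<close>

locale dissipative_solution = mild_solution +
  assumes a_pos: "a > 0" and ab: "a \<ge> \<bar>b\<bar>"
begin

lemma a2b2: "0 \<le> a\<^sup>2 - b\<^sup>2"
  using ab power2_le_iff_abs_le[of a b] a_pos by (simp add: abs_le_square_iff[symmetric])

lemma energy_le: "0 \<le> t \<Longrightarrow> energy t \<le> energy 0"
  using energy_identity[of t] a2b2 integral_nonneg[OF Y2_integrable[of 0 t]] by simp

text \<open>By the equation the forcing on \<open>{s..t}\<close> is, up to sign, a translate of
  \<open>p + b Y\<close>, and \<open>t \<le> s + 1\<close> places it inside the one window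
  \<open>{s - 1..s}\<close> that \<open>energy s\<close> measures.\<close>

lemma window_le_energy:
  assumes "0 \<le> s" "s \<le> t" "t \<le> s + 1"
  shows "integral {s..t} (\<lambda>x. (p x + a * Y x)\<^sup>2) \<le> energy 0"
proof -
  obtain N where N: "negligible N" "\<And>t. t > 0 \<Longrightarrow> t \<notin> N \<Longrightarrow> p t + p (t - 1) + a * Y t + b * Y (t - 1) = 0"
    using equation by blast
  have "integral {s..t} (\<lambda>x. (p x + a * Y x)\<^sup>2) = integral {s..t} (\<lambda>x. (p (x - 1) + b * Y (x - 1))\<^sup>2)"
  proof (rule integral_spike)
    show "negligible (insert 0 N)" using N by simp
    fix x assume x: "x \<in> {s..t} - insert 0 N"
    then have "p (x - 1) + b * Y (x - 1) = - (p x + a * Y x)"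
      using N(2)[of x] assms by simp
    then show "(p (x - 1) + b * Y (x - 1))\<^sup>2 = (p x + a * Y x)\<^sup>2"
      by (simp only: power2_minus)
  qed
  also have "\<dots> = integral {s - 1..t - 1} (\<lambda>x. (p x + b * Y x)\<^sup>2)"
    using integral_shift_Icc[of s t "\<lambda>x. (p x + b * Y x)\<^sup>2" "-1"] by simp
  also have "\<dots> \<le> integral {s - 1..s} (\<lambda>x. (p x + b * Y x)\<^sup>2)"
    using assms by (intro integral_nonneg_subset_le pY2_integrable) auto
  also have "\<dots> \<le> energy s"
    using ab by (simp add: energy_def)
  also have "\<dots> \<le> energy 0"
    using assms by (intro energy_le) auto
  finally show ?thesis .
qed

lemma energy_0_nonneg: "0 \<le> energy 0"
  unfolding energy_def using ab by (intro add_nonneg_nonneg integral_nonneg pY2_integrable) auto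

text \<open>Multiply \<open>Y' + a Y = r\<close> by \<open>2 Y\<close> and spend half of the damping
  on Young's inequality \<open>2 Y r \<le> r\<^sup>2 / a + a Y\<^sup>2\<close>; the other half is
  kept as the integral on the left.\<close>

lemma Y_power2_decay:
  assumes "0 \<le> s" "s \<le> t" "t \<le> s + 1"
  shows "(Y t)\<^sup>2 + a * integral {s..t} (\<lambda>x. (Y x)\<^sup>2) \<le> (Y s)\<^sup>2 + energy 0 / a"
proof -
  have Y2: "(\<lambda>x. (Y x)\<^sup>2) integrable_on {s..t}" and r2: "(\<lambda>x. (p x + a * Y x)\<^sup>2) integrable_on {s..t}"
    using assms by (intro Y2_integrable pY2_integrable; simp)+
  note I = integrable_on_mult_right[OF r2, of "1 / a"] integrable_on_mult_right[OF Y2, of a]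
  have i: "((\<lambda>x. 2 * Y x * p x) has_integral (Y t)\<^sup>2 - (Y s)\<^sup>2) {s..t}"
    using assms by (intro increment_power2) auto
  have "integral {s..t} (\<lambda>x. 2 * Y x * p x) \<le> integral {s..t} (\<lambda>x. 1 / a * (p x + a * Y x)\<^sup>2 - a * (Y x)\<^sup>2)"
  proof (rule integral_le)
    show "2 * Y x * p x \<le> 1 / a * (p x + a * Y x)\<^sup>2 - a * (Y x)\<^sup>2" for x
      using a_pos by (simp add: field_simps power2_eq_square)
  qed (use integrable_diff[OF I] i in auto)
  also have "\<dots> = 1 / a * integral {s..t} (\<lambda>x. (p x + a * Y x)\<^sup>2) - a * integral {s..t} (\<lambda>x. (Y x)\<^sup>2)"
    using integral_diff[OF I] by simp
  also have "1 / a * integral {s..t} (\<lambda>x. (p x + a * Y x)\<^sup>2) \<le> energy 0 / a"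
    using window_le_energy[OF assms] a_pos by (simp add: divide_right_mono)
  finally show ?thesis
    using i by (simp add: has_integral_iff)
qed

text \<open>Adding up one-window estimates would grow with time, so the bound is taken at a
  maximizer \<open>u\<close> of the square. If \<open>u > 1\<close>, the value at
  \<open>u - 1\<close> is no larger and cancels, while on the whole window the square stays above
  its maximum minus \<open>R\<close>. The damping then exceeds \<open>a\<close> times that quantity,
  yet is at most \<open>R\<close>.\<close>

lemma Y_power2_le:
  assumes "0 \<le> t"
  shows "(Y t)\<^sup>2 \<le> (Y 0)\<^sup>2 + energy 0 / a + energy 0 / a\<^sup>2"
proof -
  define R where "R = energy 0 / a"
  have R: "0 \<le> R" using energy_0_nonneg a_pos by (simp add: R_def)
  have "continuous_on {0..t} (\<lambda>x. (Y x)\<^sup>2)"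
    by (intro continuous_intros continuous_Y) auto
  then obtain u where u: "u \<in> {0..t}" "\<And>x. x \<in> {0..t} \<Longrightarrow> (Y x)\<^sup>2 \<le> (Y u)\<^sup>2"
    using continuous_attains_sup[of "{0..t}" "\<lambda>x. (Y x)\<^sup>2"] assms by auto
  have "(Y u)\<^sup>2 \<le> (Y 0)\<^sup>2 + R + R / a"
  proof (cases "u \<le> 1")
    case True
    then have "(Y u)\<^sup>2 + a * integral {0..u} (\<lambda>x. (Y x)\<^sup>2) \<le> (Y 0)\<^sup>2 + R"
      using u(1) Y_power2_decay[of 0 u] by (simp add: R_def)
    moreover have "0 \<le> a * integral {0..u} (\<lambda>x. (Y x)\<^sup>2)"
      using a_pos by (intro mult_nonneg_nonneg integral_nonneg Y2_integrable) auto
    moreover have "0 \<le> R / a" using R a_pos by simp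
    ultimately show ?thesis by linarith
  next
    case False
    have Y2: "(\<lambda>x. (Y x)\<^sup>2) integrable_on {u - 1..u}"
      using False by (intro Y2_integrable) auto
    have low: "(Y u)\<^sup>2 - R \<le> (Y x)\<^sup>2" if "x \<in> {u - 1..u}" for x
    proof -
      have "(Y u)\<^sup>2 + a * integral {x..u} (\<lambda>x. (Y x)\<^sup>2) \<le> (Y x)\<^sup>2 + R"
        using that False Y_power2_decay[of x u] by (simp add: R_def)
      moreover have "0 \<le> a * integral {x..u} (\<lambda>x. (Y x)\<^sup>2)"
        using a_pos that False by (intro mult_nonneg_nonneg integral_nonneg Y2_integrable) auto
      ultimately show ?thesis by linarith
    qed
    have "integral {u - 1..u} (\<lambda>x. (Y u)\<^sup>2 - R) \<le> integral {u - 1..u} (\<lambda>x. (Y x)\<^sup>2)"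
      using Y2 low by (intro integral_le) auto
    then have "a * ((Y u)\<^sup>2 - R) \<le> a * integral {u - 1..u} (\<lambda>x. (Y x)\<^sup>2)"
      using a_pos by simp
    moreover have "(Y u)\<^sup>2 + a * integral {u - 1..u} (\<lambda>x. (Y x)\<^sup>2) \<le> (Y (u - 1))\<^sup>2 + R"
      using False Y_power2_decay[of "u - 1" u] by (simp add: R_def)
    moreover have "(Y (u - 1))\<^sup>2 \<le> (Y u)\<^sup>2"
      using False u by auto
    ultimately have "a * ((Y u)\<^sup>2 - R) \<le> R" by linarith
    then have "(Y u)\<^sup>2 - R \<le> R / a" using a_pos by (simp add: field_simps)
    then show ?thesis using zero_le_power2[of "Y 0"] by linarith
  qed
  then show ?thesis
    using u(2)[of t] assms by (simp add: R_def power2_eq_square)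
qed

text \<open>\<open>R\<close> compares \<open>energy 0\<close> with the initial history energy, and
  \<open>2 + R / a + R / a\<^sup>2\<close> is the resulting bound for the square of
  \<open>Y\<close>. Only \<open>a\<close> and \<open>b\<close> occur, which makes the estimate
  uniform over solutions.\<close>

definition stability_constant :: real where
  "stability_constant =
     (let R = 2 + 2 * b\<^sup>2 + 2 * (a - b) in 1 + 2 * R + (1 + 2 * a\<^sup>2) * (2 + R / a + R / a\<^sup>2))"

lemma history_energy_le:
  assumes t: "0 \<le> t"
  shows "history_energy Y p t \<le> stability_constant * history_energy Y p 0"
proof -
  define E where "E = energy 0"
  define K where "K = (Y 0)\<^sup>2 + E / a + E / a\<^sup>2"
  \<comment> \<open>The window may reach back before time \<open>0\<close>, where the equation does
    not hold; that part is charged to the initial datum and only \<open>{s..t}\<close> is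
    estimated.\<close>
  define s where "s = max 0 (t - 1)"
  have s: "0 \<le> s" "s \<le> t" "t \<le> s + 1" "t - 1 \<le> s" using t by (auto simp: s_def)
  have split: "integral {t - 1..t} f \<le> integral {-1..0} f + integral {s..t} f"
    if f: "f integrable_on {-1..t}" and nonneg: "\<And>x. 0 \<le> f x" for f :: "real \<Rightarrow> real"
  proof (cases "t \<le> 1")
    case True
    have i: "f integrable_on {-1..0}" by (rule integrable_on_subinterval[OF f]) (use t in auto)
    have "integral {t - 1..t} f = integral {-1..t} f - integral {-1..t - 1} f"
      using integral_initial_diff[OF f, of "t - 1" t] t by simp
    also have "\<dots> = integral {-1..0} f - integral {-1..t - 1} f + integral {s..t} f"
      using integral_initial_diff[OF f, of 0 t] t True by (simp add: s_def)
    finally have "integral {t - 1..t} f = integral {-1..0} f - integral {-1..t - 1} f + integral {s..t} f" .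
    moreover have "0 \<le> integral {-1..t - 1} f"
      using nonneg t by (intro integral_nonneg integrable_on_subinterval[OF f]) auto
    ultimately show ?thesis by linarith
  next
    case False
    have "0 \<le> integral {-1..0} f"
      using nonneg t by (intro integral_nonneg integrable_on_subinterval[OF f]) auto
    then show ?thesis using False by (simp add: s_def)
  qed
  have Yint: "integral {s..t} (\<lambda>x. (Y x)\<^sup>2) \<le> K"
  proof -
    have "integral {s..t} (\<lambda>x. (Y x)\<^sup>2) \<le> integral {s..t} (\<lambda>x. K)"
      using s Y_power2_le unfolding K_def E_def by (intro integral_le Y2_integrable) auto
    also have "\<dots> = (t - s) * K" using s by simp
    also have "\<dots> \<le> 1 * K"
      using s a_pos energy_0_nonneg by (intro mult_right_mono) (auto simp: K_def E_def)
    finally show ?thesis by simp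
  qed
  have "integral {s..t} (\<lambda>x. (p x)\<^sup>2) \<le> integral {s..t} (\<lambda>x. 2 * (p x + a * Y x)\<^sup>2 + 2 * a\<^sup>2 * (Y x)\<^sup>2)"
  proof (rule integral_le)
    show "(p x)\<^sup>2 \<le> 2 * (p x + a * Y x)\<^sup>2 + 2 * a\<^sup>2 * (Y x)\<^sup>2" for x
      using zero_le_power2[of "p x + 2 * a * Y x"] by (simp add: power2_eq_square algebra_simps)
    show "(\<lambda>x. (p x)\<^sup>2) integrable_on {s..t}" using s by (intro p2_integrable) auto
    show "(\<lambda>x. 2 * (p x + a * Y x)\<^sup>2 + 2 * a\<^sup>2 * (Y x)\<^sup>2) integrable_on {s..t}"
      using s by (intro integrable_add integrable_on_mult_right pY2_integrable Y2_integrable) auto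
  qed
  also have "\<dots> = 2 * integral {s..t} (\<lambda>x. (p x + a * Y x)\<^sup>2) + 2 * a\<^sup>2 * integral {s..t} (\<lambda>x. (Y x)\<^sup>2)"
    using s by (intro integral_unique has_integral_add has_integral_mult_right integrable_integral
        pY2_integrable Y2_integrable) auto
  also have "\<dots> \<le> 2 * E + 2 * a\<^sup>2 * K"
    unfolding E_def using window_le_energy[OF s(1,2,3)] Yint by (intro add_mono mult_left_mono) auto
  finally have pint: "integral {s..t} (\<lambda>x. (p x)\<^sup>2) \<le> 2 * E + 2 * a\<^sup>2 * K" .
  have "history_energy Y p t \<le> history_energy Y p 0 + (K + (2 * E + 2 * a\<^sup>2 * K))"
    using split[OF Y2_integrable[of "-1" t]] split[OF p2_integrable[of "-1" t]] Yint pint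
    by (simp add: history_energy_def)
  moreover define R where "R = 2 + 2 * b\<^sup>2 + 2 * (a - b)"
  have E: "E \<le> R * history_energy Y p 0"
    unfolding E_def R_def using ab by (intro energy_0_le) auto
  have "E / a \<le> R * history_energy Y p 0 / a" "E / a\<^sup>2 \<le> R * history_energy Y p 0 / a\<^sup>2"
    using E a_pos by (auto intro: divide_right_mono)
  then have K: "K \<le> (2 + R / a + R / a\<^sup>2) * history_energy Y p 0"
    using Y_power2_le_history_energy[of 0 0] by (simp add: K_def algebra_simps)
  have "(1 + 2 * a\<^sup>2) * K \<le> (1 + 2 * a\<^sup>2) * ((2 + R / a + R / a\<^sup>2) * history_energy Y p 0)"
    using K by (intro mult_left_mono) auto
  moreover have "stability_constant * history_energy Y p 0 = history_energy Y p 0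
      + 2 * (R * history_energy Y p 0) + (1 + 2 * a\<^sup>2) * ((2 + R / a + R / a\<^sup>2) * history_energy Y p 0)"
    unfolding stability_constant_def Let_def R_def[symmetric] by (simp only: distrib_right mult.assoc mult_1)
  moreover have "(1 + 2 * a\<^sup>2) * K = K + 2 * a\<^sup>2 * K" by (simp add: distrib_right)
  ultimately show ?thesis
    using E by linarith
qed

end

lemma zero_stable_if_history_energy_bounded:
  assumes "\<And>Y p t. mild_solution a b Y p \<Longrightarrow> 0 \<le> t \<Longrightarrow> history_energy Y p t \<le> C * history_energy Y p 0"
  shows "zero_stable a b"
  unfolding zero_stable_def
proof (intro allI impI)
  fix \<epsilon> :: real assume "\<epsilon> > 0"
  \<comment> \<open>\<open>C\<close> is not known to be positive, and \<open>\<delta>\<close>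
    divides by \<open>sqrt D\<close>.\<close>
  define D where "D = max C 1"
  have D: "D > 0" "C \<le> D" by (auto simp: D_def)
  define \<delta> where "\<delta> = \<epsilon> / sqrt D"
  have "\<delta> > 0" using \<open>\<epsilon> > 0\<close> D by (simp add: \<delta>_def)
  moreover have "state_norm y t < \<epsilon>"
    if sol: "neutral_solution a b y0 y \<and> H1_norm {-1<..<0} y0 < \<delta>" and t: "t \<ge> 0" for y0 y t
  proof -
    obtain Y p where Y: "mild_solution a b Y p"
      "\<forall>t\<ge>0. state_norm y t = sqrt (history_energy Y p t)"
      "H1_norm {-1<..<0} y0 = sqrt (history_energy Y p 0)"
      by (rule neutral_solution_imp_mild_solution[OF conjunct1[OF sol]])
    have "history_energy Y p t \<le> C * history_energy Y p 0"
      using assms Y(1) t by blast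
    also have "\<dots> \<le> D * history_energy Y p 0"
      using mild_solution.history_energy_nonneg[OF Y(1), of 0] D by (intro mult_right_mono) auto
    finally have "state_norm y t \<le> sqrt D * H1_norm {-1<..<0} y0"
      using Y(2) Y(3) t by (simp add: real_sqrt_mult[symmetric])
    also have "\<dots> < sqrt D * \<delta>"
      using sol D by (intro mult_strict_left_mono) auto
    also have "\<dots> = \<epsilon>" using D by (simp add: \<delta>_def)
    finally show ?thesis .
  qed
  ultimately show "\<exists>\<delta>>0. \<forall>y0 y. neutral_solution a b y0 y \<and> H1_norm {-1<..<0} y0 < \<delta> \<longrightarrow>
      (\<forall>t\<ge>0. state_norm y t < \<epsilon>)" by blast
qed

theorem zero_stable_dissipative:
  assumes "a > 0" "a \<ge> \<bar>b\<bar>"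
  shows "zero_stable a b"
proof (rule zero_stable_if_history_energy_bounded)
  fix Y p and t :: real assume "mild_solution a b Y p" "0 \<le> t"
  then show "history_energy Y p t \<le> dissipative_solution.stability_constant a b * history_energy Y p 0"
    using assms by (intro dissipative_solution.history_energy_le dissipative_solution.intro
        dissipative_solution_axioms.intro)
qed

section \<open>Stability for \<open>- a = b < 2\<close>\<close>

context mild_solution
begin

text \<open>When \<open>a + b = 0\<close> the equation is an exact derivative in \<open>t\<close>,
  its undifferentiated part being \<open>- b\<close> times the derivative of the window integral of
  \<open>Y\<close>. On a constant solution \<open>c\<close> the functional equals
  \<open>(2 - b) * c\<close>.\<close>

lemma conserved_functional:
  assumes ab: "a = - b" and t: "0 \<le> t"
  shows "Y t + Y (t - 1) - b * integral {t - 1..t} Y = Y 0 + Y (-1) - b * integral {-1..0} Y"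
proof -
  obtain N where N: "negligible N" "\<And>t. t > 0 \<Longrightarrow> t \<notin> N \<Longrightarrow> p t + p (t - 1) + a * Y t + b * Y (t - 1) = 0"
    using equation by blast
  have Yi: "Y integrable_on {-1..T}" for T
    by (rule square_integrable_on_imp_integrable[OF square_integrable_Y]) simp
  have "Y integrable_on {0..t}"
    by (rule integrable_on_subinterval[OF Yi[of t]]) auto
  moreover have "(\<lambda>x. Y (x - 1)) integrable_on {0..t}"
    using integrable_shift_Icc[of Y "-1" 0 t] Yi by simp
  ultimately have "(\<lambda>x. Y x - Y (x - 1)) integrable_on {0..t}"
    by (rule integrable_diff)
  then have 1: "((\<lambda>x. b * (Y x - Y (x - 1))) has_integral b * (integral {t - 1..t} Y - integral {-1..0} Y)) {0..t}"
    unfolding window_difference[OF Yi t] by (intro has_integral_mult_right integrable_integral)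
  have 2: "((\<lambda>x. p (x - 1)) has_integral Y (t - 1) - Y (-1)) {0..t}"
    using has_integral_shift_real_ivl[OF increment[of "-1" "t - 1"], of "-1"] t by simp
  have "((\<lambda>x. p x + p (x - 1) - b * (Y x - Y (x - 1))) has_integral
      (Y t - Y 0) + (Y (t - 1) - Y (-1)) - b * (integral {t - 1..t} Y - integral {-1..0} Y)) {0..t}"
    using t by (intro has_integral_diff has_integral_add 1 2 increment) auto
  moreover have "((\<lambda>x. p x + p (x - 1) - b * (Y x - Y (x - 1))) has_integral 0) {0..t}"
  proof (rule has_integral_spike[OF _ _ has_integral_0])
    show "negligible (insert 0 N)" using N by simp
    show "p x + p (x - 1) - b * (Y x - Y (x - 1)) = 0" if "x \<in> {0..t} - insert 0 N" for x
      using that N(2)[of x] by (simp add: ab algebra_simps)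
  qed
  ultimately have "(Y t - Y 0) + (Y (t - 1) - Y (-1)) - b * (integral {t - 1..t} Y - integral {-1..0} Y) = 0"
    by (rule has_integral_unique)
  then show ?thesis by (simp add: algebra_simps)
qed

text \<open>The cross term of \<open>(p + b Y)\<^sup>2\<close> integrates to
  \<open>b * ((Y t)\<^sup>2 - (Y (t - 1))\<^sup>2)\<close> and so spreads the boundary term
  \<open>- 2 * b * (Y t)\<^sup>2\<close> evenly over both ends of the window.\<close>

lemma energy_balanced:
  assumes ab: "a = - b" and t: "0 \<le> t"
  shows "energy t = integral {t - 1..t} (\<lambda>x. (p x)\<^sup>2) + b\<^sup>2 * integral {t - 1..t} (\<lambda>x. (Y x)\<^sup>2)
    - b * ((Y t)\<^sup>2 + (Y (t - 1))\<^sup>2)"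
proof -
  have "((\<lambda>x. (p x)\<^sup>2 + b\<^sup>2 * (Y x)\<^sup>2 + b * (2 * Y x * p x)) has_integral
      integral {t - 1..t} (\<lambda>x. (p x)\<^sup>2) + b\<^sup>2 * integral {t - 1..t} (\<lambda>x. (Y x)\<^sup>2)
      + b * ((Y t)\<^sup>2 - (Y (t - 1))\<^sup>2)) {t - 1..t}"
    using t by (intro has_integral_add has_integral_mult_right integrable_integral p2_integrable
        Y2_integrable increment_power2) auto
  moreover have "(\<lambda>x. (p x)\<^sup>2 + b\<^sup>2 * (Y x)\<^sup>2 + b * (2 * Y x * p x)) = (\<lambda>x. (p x + b * Y x)\<^sup>2)"
    by (auto simp: power2_eq_square algebra_simps)
  ultimately show ?thesis
    unfolding energy_def by (simp add: ab has_integral_iff algebra_simps)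
qed

lemma window_mean_deviation:
  assumes t: "0 \<le> t" and u: "u \<in> {t - 1..t}"
  shows "(integral {t - 1..t} Y - Y u)\<^sup>2 \<le> integral {t - 1..t} (\<lambda>x. (p x)\<^sup>2)"
proof -
  define P where "P = integral {t - 1..t} (\<lambda>x. (p x)\<^sup>2)"
  have sq: "square_integrable_on {t - 1..t} (\<lambda>x. Y x - Y u)"
    using t by (intro square_integrable_on_diff square_integrable_Y square_integrable_on_continuous) auto
  have Yi: "Y integrable_on {t - 1..t}"
    using t by (intro square_integrable_on_imp_integrable square_integrable_Y) auto
  have "integral {t - 1..t} (\<lambda>x. Y x - Y u) = integral {t - 1..t} Y - Y u"
    using integral_diff[OF Yi integrable_const_ivl[of "Y u"]] by simp
  then have "(integral {t - 1..t} Y - Y u)\<^sup>2 \<le> integral {t - 1..t} (\<lambda>x. (Y x - Y u)\<^sup>2)"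
    using integral_power2_le[OF sq] by simp
  also have "\<dots> \<le> integral {t - 1..t} (\<lambda>x. P)"
  proof (intro integral_le square_integrable_on_power2 sq integrable_const_ivl)
    fix x assume "x \<in> {t - 1..t}"
    then show "(Y x - Y u)\<^sup>2 \<le> P"
      using oscillation[of "t - 1" u x t] oscillation[of "t - 1" x u t] t u
      unfolding P_def by (cases "u \<le> x") (auto simp: power2_commute)
  qed
  finally show ?thesis by (simp add: P_def)
qed

text \<open>The energy alone is not coercive: on a constant \<open>c\<close> it is
  \<open>b * (b - 2) * c\<^sup>2\<close>. Conservation repairs this. The ends of the window enter
  through their sum, which equals \<open>b * J + C\<close>, and their difference, bounded by
  \<open>P\<close>. The remaining quadratic form in \<open>J\<close> has leading coefficient
  \<open>b\<^sup>2 * \<kappa>\<close>, and \<open>\<kappa>\<close> is positive exactly for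
  \<open>b < 2\<close>. \<open>K\<close> bounds \<open>P\<close> in terms of the initial energy; the
  other summand of the constant does the same for the square of \<open>Y\<close>.\<close>

lemma balanced_history_energy_le:
  assumes ab: "a = - b" and b: "0 \<le> b" "b < 2" and t: "0 \<le> t"
  defines "\<kappa> \<equiv> 1 - b / 2"
  defines "K \<equiv> ((1 + b\<^sup>2) + (b / 2 + b\<^sup>2 / (4 * \<kappa>)) * (12 + 3 * b\<^sup>2)) / \<kappa>"
  shows "history_energy Y p t \<le> (K + 4 * (12 + 3 * b\<^sup>2 + (2 + b\<^sup>2) * K) / (2 - b)\<^sup>2) * history_energy Y p 0"
proof -
  define H where "H = history_energy Y p 0"
  define P where "P = integral {t - 1..t} (\<lambda>x. (p x)\<^sup>2)"
  define Q where "Q = integral {t - 1..t} (\<lambda>x. (Y x)\<^sup>2)"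
  define J where "J = integral {t - 1..t} Y"
  define C where "C = Y 0 + Y (-1) - b * integral {-1..0} Y"
  have \<kappa>: "0 < \<kappa>" using b by (simp add: \<kappa>_def)
  have C: "Y t + Y (t - 1) = b * J + C"
    using conserved_functional[OF ab t] by (simp add: C_def J_def algebra_simps)
  have JQ: "J\<^sup>2 \<le> Q"
    using integral_power2_le[OF square_integrable_Y, of "t - 1" t] t by (simp add: J_def Q_def)
  have "C\<^sup>2 \<le> 3 * ((Y 0)\<^sup>2 + (Y (-1))\<^sup>2 + (b * integral {-1..0} Y)\<^sup>2)"
    using power2_sum3_le[of "Y 0" "Y (-1)" "- (b * integral {-1..0} Y)"] by (simp add: C_def)
  also have "\<dots> \<le> 3 * (2 * H + 2 * H + b\<^sup>2 * H)"
  proof -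
    have "(integral {-1..0} Y)\<^sup>2 \<le> integral {-1..0} (\<lambda>x. (Y x)\<^sup>2)"
      using integral_power2_le[OF square_integrable_Y, of "-1" 0] by simp
    also have "\<dots> \<le> H"
      unfolding H_def history_energy_def using integral_nonneg[OF p2_integrable[of "-1" 0]] by simp
    finally have "(b * integral {-1..0} Y)\<^sup>2 \<le> b\<^sup>2 * H"
      by (simp add: power_mult_distrib mult_left_mono)
    then show ?thesis
      using Y_power2_le_history_energy[of 0 0] Y_power2_le_history_energy[of 0 "-1"] by (simp add: H_def)
  qed
  finally have C2: "C\<^sup>2 \<le> (12 + 3 * b\<^sup>2) * H" by (simp add: algebra_simps)
  have "energy t = energy 0"
    using energy_identity[OF t] by (simp add: ab)
  also have "energy 0 \<le> integral {-1..0} (\<lambda>x. (p x)\<^sup>2) + b\<^sup>2 * integral {-1..0} (\<lambda>x. (Y x)\<^sup>2)"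
    using energy_balanced[OF ab, of 0] b(1) by simp
  also have "\<dots> \<le> (1 + b\<^sup>2) * integral {-1..0} (\<lambda>x. (p x)\<^sup>2) + (1 + b\<^sup>2) * integral {-1..0} (\<lambda>x. (Y x)\<^sup>2)"
    using integral_nonneg[OF p2_integrable[of "-1" 0]] integral_nonneg[OF Y2_integrable[of "-1" 0]]
    by (intro add_mono mult_right_mono mult_right_mono[of 1 "1 + b\<^sup>2", simplified]) auto
  also have "\<dots> = (1 + b\<^sup>2) * H"
    by (simp add: H_def history_energy_def algebra_simps)
  finally have E: "energy t \<le> (1 + b\<^sup>2) * H" .
  have D: "(Y t - Y (t - 1))\<^sup>2 \<le> P"
    using oscillation[of "t - 1" "t - 1" t t] t by (simp add: P_def)
  have "(Y t)\<^sup>2 + (Y (t - 1))\<^sup>2 = ((Y t + Y (t - 1))\<^sup>2 + (Y t - Y (t - 1))\<^sup>2) / 2"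
    by (simp add: power2_eq_square algebra_simps)
  also have "\<dots> \<le> ((b * J + C)\<^sup>2 + P) / 2"
    using D by (simp add: C)
  finally have "b * ((Y t)\<^sup>2 + (Y (t - 1))\<^sup>2) \<le> b * (((b * J + C)\<^sup>2 + P) / 2)"
    using b by (intro mult_left_mono)
  moreover have "b\<^sup>2 * J\<^sup>2 \<le> b\<^sup>2 * Q"
    using JQ by (intro mult_left_mono) auto
  ultimately have "P + b\<^sup>2 * J\<^sup>2 - b * (((b * J + C)\<^sup>2 + P) / 2) \<le> energy t"
    unfolding energy_balanced[OF ab t] P_def[symmetric] Q_def[symmetric] by linarith
  moreover have "\<kappa> * P - (b / 2 + b\<^sup>2 / (4 * \<kappa>)) * C\<^sup>2
      \<le> P + b\<^sup>2 * J\<^sup>2 - b * (((b * J + C)\<^sup>2 + P) / 2)"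
  proof -
    \<comment> \<open>The multiple of \<open>C\<^sup>2\<close> that completes
      \<open>b\<^sup>2 * (\<kappa> * J\<^sup>2 - J * C)\<close> to the square
      \<open>g * (2 * \<kappa> * J - C)\<^sup>2\<close>.\<close>
    define g where "g = b\<^sup>2 / (4 * \<kappa>)"
    have g: "b\<^sup>2 = 4 * \<kappa> * g" "0 \<le> g" using \<kappa> by (auto simp: g_def)
    have "P + b\<^sup>2 * J\<^sup>2 - b * (((b * J + C)\<^sup>2 + P) / 2) - (\<kappa> * P - (b / 2 + g) * C\<^sup>2)
        = b\<^sup>2 * (\<kappa> * J\<^sup>2 - J * C) + g * C\<^sup>2"
      by (simp add: \<kappa>_def power2_eq_square algebra_simps)
    also have "\<dots> = g * (2 * \<kappa> * J - C)\<^sup>2"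
      unfolding g(1) by (simp add: power2_eq_square algebra_simps)
    also have "0 \<le> \<dots>" using g(2) by simp
    finally show ?thesis by (simp add: g_def)
  qed
  moreover have "(b / 2 + b\<^sup>2 / (4 * \<kappa>)) * C\<^sup>2 \<le> (b / 2 + b\<^sup>2 / (4 * \<kappa>)) * ((12 + 3 * b\<^sup>2) * H)"
    using C2 \<kappa> b by (intro mult_left_mono) auto
  ultimately have "\<kappa> * P \<le> (1 + b\<^sup>2) * H + (b / 2 + b\<^sup>2 / (4 * \<kappa>)) * ((12 + 3 * b\<^sup>2) * H)"
    using E by linarith
  also have "\<dots> = \<kappa> * (K * H)"
  proof -
    have K: "\<kappa> * K = (1 + b\<^sup>2) + (b / 2 + b\<^sup>2 / (4 * \<kappa>)) * (12 + 3 * b\<^sup>2)"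
      using \<kappa> by (simp add: K_def)
    show ?thesis unfolding mult.assoc[symmetric] K by (simp only: distrib_right mult.assoc)
  qed
  finally have P: "P \<le> K * H" using \<kappa> by simp
  define M where "M = 4 * (12 + 3 * b\<^sup>2 + (2 + b\<^sup>2) * K) / (2 - b)\<^sup>2 * H"
  have Yu: "(Y u)\<^sup>2 \<le> M" if u: "u \<in> {t - 1..t}" for u
  proof -
    have four: "(x + y + z + w)\<^sup>2 \<le> 4 * (x\<^sup>2 + y\<^sup>2 + z\<^sup>2 + w\<^sup>2)" for x y z w :: real
      using sum_squares_ge_zero[of "x - y" "y - z"] sum_squares_ge_zero[of "x - z" "x - w"]
        sum_squares_ge_zero[of "y - w" "z - w"]
      by (simp add: power2_eq_square algebra_simps)
    \<comment> \<open>Replacing every value of \<open>Y\<close> in the conserved functional by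
      \<open>Y u\<close> turns it into \<open>(2 - b) * Y u\<close>; the errors are oscillations
      over one window, each controlled by \<open>P\<close>.\<close>
    have "(2 - b) * Y u = C + (Y u - Y t) + (Y u - Y (t - 1)) + b * (J - Y u)"
      using C by (simp add: algebra_simps)
    then have "((2 - b) * Y u)\<^sup>2 \<le> 4 * (C\<^sup>2 + (Y u - Y t)\<^sup>2 + (Y u - Y (t - 1))\<^sup>2 + (b * (J - Y u))\<^sup>2)"
      using four by metis
    also have "\<dots> \<le> 4 * ((12 + 3 * b\<^sup>2) * H + P + P + b\<^sup>2 * P)"
    proof -
      have "(Y u - Y t)\<^sup>2 \<le> P"
        using oscillation[of "t - 1" u t t] u t by (simp add: P_def power2_commute)
      moreover have "(Y u - Y (t - 1))\<^sup>2 \<le> P"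
        using oscillation[of "t - 1" "t - 1" u t] u t by (simp add: P_def)
      moreover have "(b * (J - Y u))\<^sup>2 \<le> b\<^sup>2 * P"
        using window_mean_deviation[OF t u] by (simp add: power_mult_distrib J_def P_def mult_left_mono)
      ultimately show ?thesis using C2 by (intro mult_left_mono add_mono) auto
    qed
    also have "\<dots> = 4 * ((12 + 3 * b\<^sup>2) * H + (2 + b\<^sup>2) * P)"
      by (simp add: algebra_simps)
    also have "\<dots> \<le> 4 * ((12 + 3 * b\<^sup>2) * H + (2 + b\<^sup>2) * (K * H))"
      using P by (intro mult_left_mono add_left_mono) auto
    also have "\<dots> = 4 * (12 + 3 * b\<^sup>2 + (2 + b\<^sup>2) * K) * H"
      by (simp add: algebra_simps)
    also have "\<dots> = (2 - b)\<^sup>2 * M"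
      using b by (simp add: M_def)
    finally have "(2 - b)\<^sup>2 * (Y u)\<^sup>2 \<le> (2 - b)\<^sup>2 * M" by (simp add: power_mult_distrib)
    then show ?thesis using b by simp
  qed
  have "Q \<le> integral {t - 1..t} (\<lambda>x. M)"
    unfolding Q_def using t Yu by (intro integral_le Y2_integrable) auto
  then have "Q \<le> M" by simp
  then have "history_energy Y p t \<le> K * H + M"
    using P by (simp add: history_energy_def P_def Q_def)
  then show ?thesis by (simp add: M_def H_def distrib_right)
qed

end

theorem zero_stable_balanced:
  assumes "a = - b" "0 \<le> b" "b < 2"
  shows "zero_stable a b"
  by (rule zero_stable_if_history_energy_bounded, rule mild_solution.balanced_history_energy_le) (use assms in auto)

section \<open>Steklov averages\<close>

definition average :: "real \<Rightarrow> (real \<Rightarrow> real) \<Rightarrow> real \<Rightarrow> real" where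
  "average h f s = integral {s..s + h} f / h"

lemma average_continuous:
  assumes f: "f integrable_on {c..d + h}" and h: "0 < h"
  shows "continuous_on {c..d} (average h f)"
proof -
  have G: "continuous_on {c..d + h} (\<lambda>x. integral {c..x} f)"
    by (rule indefinite_integral_continuous_1[OF f])
  have "continuous_on {c..d} (\<lambda>s. integral {c..s + h} f)"
    by (rule continuous_on_compose2[OF G]) (use h in \<open>auto intro!: continuous_intros\<close>)
  moreover have "continuous_on {c..d} (\<lambda>x. integral {c..x} f)"
    using G by (rule continuous_on_subset) (use h in auto)
  ultimately have "continuous_on {c..d} (\<lambda>s. (integral {c..s + h} f - integral {c..s} f) / h)"
    using h by (intro continuous_intros) auto
  moreover have "(integral {c..s + h} f - integral {c..s} f) / h = average h f s" if "s \<in> {c..d}" for s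
    using integral_initial_diff[OF f, of s "s + h"] that h by (simp add: average_def)
  ultimately show ?thesis by (rule continuous_on_eq)
qed

lemma square_integrable_average:
  assumes f: "square_integrable_on {c..c + 2} f" and h: "0 < h" "h \<le> 1"
  shows "square_integrable_on {c..c + 1} (average h f)"
proof (intro square_integrable_on_continuous average_continuous h(1))
  show "f integrable_on {c..c + 1 + h}"
    by (rule integrable_on_subinterval[OF square_integrable_on_imp_integrable[OF f]]) (use h in auto)
qed

text \<open>Averaging contracts the square norm once the window is enlarged. Jensen's inequality
  bounds the integrand by the difference quotient of the increasing primitive \<open>G\<close>,
  whose integral collapses to two end pieces of length \<open>h\<close>; this takes the place of an
  exchange of integrals.\<close>

lemma average_power2_integral_le:
  assumes f: "square_integrable_on {c..c + 2} f" and h: "0 < h" "h \<le> 1"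
  shows "integral {c..c + 1} (\<lambda>s. (average h f s)\<^sup>2) \<le> integral {c..c + 2} (\<lambda>s. (f s)\<^sup>2)"
proof -
  define G where "G x = integral {c..x} (\<lambda>s. (f s)\<^sup>2)" for x
  have f2: "(\<lambda>s. (f s)\<^sup>2) integrable_on {c..c + 2}"
    using f by (rule square_integrable_on_power2)
  have Gc: "continuous_on {c..c + 2} G"
    unfolding G_def by (rule indefinite_integral_continuous_1[OF f2])
  have Gi: "G integrable_on {c..c + 2}"
    using Gc by (rule integrable_continuous_interval)
  have Gi': "G integrable_on {s..t}" if "c \<le> s" "t \<le> c + 2" for s t
    by (rule integrable_on_subinterval[OF Gi]) (use that in auto)
  have G0: "0 \<le> G x" "G x \<le> G (c + 2)" if "x \<in> {c..c + 2}" for x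
    unfolding G_def using that
    by (auto intro!: integral_nonneg integrable_on_subinterval[OF f2] integral_nonneg_subset_le[OF f2])
  have shift: "integral {c..c + 1} (\<lambda>s. G (s + h)) = integral {c + h..c + 1 + h} G"
    by (rule integral_shift_Icc)
  have Gsi: "(\<lambda>s. G (s + h)) integrable_on {c..c + 1}"
    unfolding integrable_shift_Icc using h by (intro Gi') auto
  have Gsd: "(\<lambda>s. (G (s + h) - G s) / h) integrable_on {c..c + 1}"
    using h by (intro integrable_on_divide integrable_diff Gsi Gi') auto
  have "integral {c..c + 1} (\<lambda>s. (average h f s)\<^sup>2) \<le> integral {c..c + 1} (\<lambda>s. (G (s + h) - G s) / h)"
  proof (rule integral_le[OF square_integrable_on_power2[OF square_integrable_average[OF f h]] Gsd])
    fix s assume s: "s \<in> {c..c + 1}"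
    have "square_integrable_on {s..s + h} f"
      by (rule square_integrable_on_subset[OF f]) (use s h in auto)
    from integral_power2_le[OF this]
    have "(integral {s..s + h} f)\<^sup>2 \<le> h * integral {s..s + h} (\<lambda>s. (f s)\<^sup>2)"
      using h by simp
    also have "integral {s..s + h} (\<lambda>s. (f s)\<^sup>2) = G (s + h) - G s"
      unfolding G_def using integral_initial_diff[OF f2, of s "s + h"] s h by simp
    finally show "(average h f s)\<^sup>2 \<le> (G (s + h) - G s) / h"
      using h by (simp add: average_def power_divide field_simps power2_eq_square)
  qed
  also have "\<dots> = (integral {c + h..c + 1 + h} G - integral {c..c + 1} G) / h"
    using integral_diff[OF Gsi Gi'[of c "c + 1"]] by (simp add: shift)
  also have "integral {c + h..c + 1 + h} G - integral {c..c + 1} G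
      = integral {c + 1..c + 1 + h} G - integral {c..c + h} G"
  proof -
    have "integral {c..c + 1 + h} G - integral {c..c + h} G = integral {c + h..c + 1 + h} G"
      using integral_initial_diff[OF Gi, of "c + h" "c + 1 + h"] h by simp
    moreover have "integral {c..c + 1 + h} G - integral {c..c + 1} G = integral {c + 1..c + 1 + h} G"
      using integral_initial_diff[OF Gi, of "c + 1" "c + 1 + h"] h by simp
    ultimately show ?thesis by simp
  qed
  also have "\<dots> \<le> h * G (c + 2)"
  proof -
    have "integral {c + 1..c + 1 + h} G \<le> integral {c + 1..c + 1 + h} (\<lambda>x. G (c + 2))"
      using h G0(2) by (intro integral_le Gi') auto
    moreover have "0 \<le> integral {c..c + h} G"
      using h G0(1) by (intro integral_nonneg Gi') auto
    ultimately show ?thesis using h by simp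
  qed
  finally show ?thesis using h by (simp add: G_def divide_right_mono)
qed

text \<open>Pointwise convergence almost everywhere is Lebesgue differentiation, and boundedness of
  \<open>f\<close> supplies the constant dominating function.\<close>

lemma average_tendsto_bounded:
  assumes f: "square_integrable_on {c..c + 2} f" and M: "\<And>x. \<bar>f x\<bar> \<le> M"
  shows "(\<lambda>n. integral {c..c + 1} (\<lambda>s. (f s - average (1 / real (Suc n)) f s)\<^sup>2)) \<longlonglongrightarrow> 0"
proof -
  define f' where "f' x = (if x \<in> {c..c + 2} then f x else 0)" for x
  have fi: "f integrable_on {c..c + 2}"
    using f by (rule square_integrable_on_imp_integrable)
  have "f' integrable_on UNIV"
    unfolding f'_def integrable_restrict_UNIV by (rule fi)
  then have "f' integrable_on cbox u v" for u v
    by (rule integrable_on_subcbox) auto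
  then obtain N where N: "negligible N"
    "\<And>x \<epsilon>. x \<notin> N \<Longrightarrow> 0 < \<epsilon> \<Longrightarrow> \<exists>r>0. \<forall>h. 0 < h \<and> h < r \<longrightarrow>
       norm (integral (cbox x (x + h *\<^sub>R One)) f' /\<^sub>R h ^ DIM(real) - f' x) < \<epsilon>"
    by (rule integrable_ccontinuous_explicit[of f']) blast
  \<comment> \<open>The value \<open>0\<close> on the negligible set yields convergence at every
    point, as dominated convergence requires, without changing the integrals.\<close>
  define A where "A n s = (if s \<in> N then 0 else (f s - average (1 / real (Suc n)) f s)\<^sup>2)" for n s
  have sq: "square_integrable_on {c..c + 1} (\<lambda>s. f s - average (1 / real (Suc n)) f s)" for n
    by (intro square_integrable_on_diff square_integrable_average f square_integrable_on_subset[OF f]) auto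
  have Ai: "A n integrable_on {c..c + 1}" for n
    by (rule integrable_spike[OF square_integrable_on_power2[OF sq[of n]] N(1)]) (simp add: A_def)
  have lim: "(\<lambda>n. A n s) \<longlonglongrightarrow> 0" if s: "s \<in> {c..c + 1}" for s
  proof (cases "s \<in> N")
    case False
    have "(\<lambda>n. average (1 / real (Suc n)) f s) \<longlonglongrightarrow> f s"
    proof (rule LIMSEQ_I)
      fix \<epsilon> :: real assume \<epsilon>: "0 < \<epsilon>"
      then obtain r where r: "r > 0" and
        rh: "\<And>h. 0 < h \<Longrightarrow> h < r \<Longrightarrow> \<bar>integral {s..s + h} f' / h - f' s\<bar> < \<epsilon>"
        using N(2)[OF False \<epsilon>] by (auto simp: divide_inverse mult.commute)
      obtain n0 where n0: "1 / r < real n0" using reals_Archimedean2 by blast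
      have "norm (average (1 / real (Suc n)) f s - f s) < \<epsilon>" if "n \<ge> n0" for n
      proof -
        define h where "h = 1 / real (Suc n)"
        have "1 / r < real (Suc n)" using n0 that by linarith
        then have h: "0 < h" "h < r" "h \<le> 1" using r by (auto simp: h_def field_simps)
        have "integral {s..s + h} f' = integral {s..s + h} f"
          using s h by (intro integral_cong) (auto simp: f'_def)
        then show ?thesis
          unfolding h_def[symmetric] using rh[OF h(1,2)] s by (simp add: average_def f'_def)
      qed
      then show "\<exists>no. \<forall>n\<ge>no. norm (average (1 / real (Suc n)) f s - f s) < \<epsilon>" by blast
    qed
    from tendsto_power[OF tendsto_diff[OF tendsto_const[of "f s"] this], of 2]
    show ?thesis using False by (simp add: A_def)
  qed (simp add: A_def)
  have bound: "norm (A n s) \<le> (2 * M)\<^sup>2" if s: "s \<in> {c..c + 1}" for n s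
  proof -
    define h where "h = 1 / real (Suc n)"
    have h: "0 < h" "h \<le> 1" by (auto simp: h_def)
    have "\<bar>integral {s..s + h} f\<bar> \<le> integral {s..s + h} (\<lambda>_. M)"
      by (rule abs_integral_bound[OF integrable_on_subinterval[OF fi] integrable_const_ivl]) (use s h M in auto)
    then have "\<bar>average h f s\<bar> \<le> M"
      using h by (simp add: average_def field_simps)
    then have "\<bar>f s - average h f s\<bar> \<le> 2 * M" using M[of s] by linarith
    then have "(f s - average h f s)\<^sup>2 \<le> (2 * M)\<^sup>2"
      by (metis abs_ge_zero power2_abs power_mono)
    then show ?thesis by (simp add: A_def h_def)
  qed
  have "(\<lambda>n. integral {c..c + 1} (A n)) \<longlonglongrightarrow> integral {c..c + 1} (\<lambda>_. 0)"
    by (rule dominated_convergence(2)[OF Ai integrable_const_ivl bound lim])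
  moreover have "integral {c..c + 1} (A n) = integral {c..c + 1} (\<lambda>s. (f s - average (1 / real (Suc n)) f s)\<^sup>2)" for n
    by (rule integral_spike[OF N(1)]) (simp add: A_def)
  ultimately show ?thesis by simp
qed

lemma average_diff:
  assumes "f integrable_on {s..s + h}" "g integrable_on {s..s + h}"
  shows "average h (\<lambda>x. f x - g x) s = average h f s - average h g s"
  using integral_diff[OF assms] by (simp add: average_def diff_divide_distrib)

text \<open>Truncation reduces to the bounded case: the remainder \<open>v\<close> is small in
  square norm, and so are its averages by contraction. The bound \<open>\<epsilon> / 9\<close>
  accounts for three terms and the factor three of \<open>power2_sum3_le\<close>.\<close>

lemma average_tendsto:
  assumes f: "square_integrable_on {c..c + 2} f"
  shows "(\<lambda>n. integral {c..c + 1} (\<lambda>s. (f s - average (1 / real (Suc n)) f s)\<^sup>2)) \<longlonglongrightarrow> 0"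
proof (rule LIMSEQ_I)
  fix \<epsilon> :: real assume \<epsilon>: "0 < \<epsilon>"
  define trunc where "trunc k x = max (- real k) (min (real k) (f x))" for k x
  have tsq: "square_integrable_on {c..c + 2} (trunc k)" for k
  proof -
    have m: "trunc k \<in> borel_measurable (lebesgue_on {c..c + 2})"
      using f unfolding trunc_def square_integrable_on_def by (intro borel_measurable_max borel_measurable_min) auto
    moreover have "(\<lambda>x. (trunc k x)\<^sup>2) integrable_on {c..c + 2}"
    proof (rule measurable_bounded_by_integrable_imp_integrable_real)
      show "(\<lambda>x. (trunc k x)\<^sup>2) \<in> borel_measurable (lebesgue_on {c..c + 2})"
        using m by (rule borel_measurable_power)
      show "\<bar>(trunc k x)\<^sup>2\<bar> \<le> (real k)\<^sup>2" for x
        by (simp add: trunc_def abs_le_square_iff[symmetric])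
    qed (rule integrable_const_ivl, simp)
    ultimately show ?thesis by (simp add: square_integrable_on_Icc_iff)
  qed
  have "(\<lambda>k. integral {c..c + 2} (\<lambda>x. (f x - trunc k x)\<^sup>2)) \<longlonglongrightarrow> integral {c..c + 2} (\<lambda>_. 0)"
  proof (rule dominated_convergence(2)[where h = "\<lambda>x. (f x)\<^sup>2"])
    show "(\<lambda>x. (f x - trunc k x)\<^sup>2) integrable_on {c..c + 2}" for k
      by (intro square_integrable_on_power2 square_integrable_on_diff f tsq)
    show "(\<lambda>x. (f x)\<^sup>2) integrable_on {c..c + 2}"
      using f by (rule square_integrable_on_power2)
    show "norm ((f x - trunc k x)\<^sup>2) \<le> (f x)\<^sup>2" for k x
      by (simp add: trunc_def abs_le_square_iff[symmetric])
    show "(\<lambda>k. (f x - trunc k x)\<^sup>2) \<longlonglongrightarrow> 0" for x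
    proof (rule tendsto_eventually)
      obtain k0 where "\<bar>f x\<bar> < real k0" using reals_Archimedean2 by blast
      then have "(f x - trunc k x)\<^sup>2 = 0" if "k \<ge> k0" for k
        using that by (auto simp: trunc_def)
      then show "\<forall>\<^sub>F k in sequentially. (f x - trunc k x)\<^sup>2 = 0"
        using eventually_sequentially by blast
    qed
  qed
  then have "\<forall>\<^sub>F k in sequentially. integral {c..c + 2} (\<lambda>x. (f x - trunc k x)\<^sup>2) < \<epsilon> / 9"
    using \<epsilon> by (intro order_tendstoD) auto
  then obtain k where k: "integral {c..c + 2} (\<lambda>x. (f x - trunc k x)\<^sup>2) < \<epsilon> / 9"
    using eventually_happens by force
  define u where "u = trunc k"
  define v where "v x = f x - u x" for x
  have u: "square_integrable_on {c..c + 2} u" unfolding u_def by (rule tsq)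
  have v: "square_integrable_on {c..c + 2} v" unfolding v_def by (intro square_integrable_on_diff f u)
  have v\<epsilon>: "integral {c..c + 2} (\<lambda>x. (v x)\<^sup>2) < \<epsilon> / 9" using k by (simp add: v_def u_def)
  have "(\<lambda>n. integral {c..c + 1} (\<lambda>s. (u s - average (1 / real (Suc n)) u s)\<^sup>2)) \<longlonglongrightarrow> 0"
    by (rule average_tendsto_bounded[OF u, of "real k"]) (auto simp: u_def trunc_def)
  then have "\<forall>\<^sub>F n in sequentially. integral {c..c + 1} (\<lambda>s. (u s - average (1 / real (Suc n)) u s)\<^sup>2) < \<epsilon> / 9"
    using \<epsilon> by (intro order_tendstoD) auto
  then obtain n0 where n0: "\<And>n. n \<ge> n0 \<Longrightarrow> integral {c..c + 1} (\<lambda>s. (u s - average (1 / real (Suc n)) u s)\<^sup>2) < \<epsilon> / 9"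
    unfolding eventually_sequentially by blast
  have "norm (integral {c..c + 1} (\<lambda>s. (f s - average (1 / real (Suc n)) f s)\<^sup>2) - 0) < \<epsilon>" if "n \<ge> n0" for n
  proof -
    define h where "h = 1 / real (Suc n)"
    have h: "0 < h" "h \<le> 1" by (auto simp: h_def)
    have v1: "square_integrable_on {c..c + 1} v"
      by (rule square_integrable_on_subset[OF v]) auto
    have f1: "square_integrable_on {c..c + 1} f"
      by (rule square_integrable_on_subset[OF f]) auto
    have u1: "square_integrable_on {c..c + 1} u"
      by (rule square_integrable_on_subset[OF u]) auto
    have i1: "(\<lambda>s. (f s - average h f s)\<^sup>2) integrable_on {c..c + 1}"
      by (intro square_integrable_on_power2 square_integrable_on_diff f1 square_integrable_average[OF f h])
    have i2: "(\<lambda>s. (u s - average h u s)\<^sup>2) integrable_on {c..c + 1}"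
      by (intro square_integrable_on_power2 square_integrable_on_diff u1 square_integrable_average[OF u h])
    have i3: "(\<lambda>s. (v s)\<^sup>2) integrable_on {c..c + 1}"
      by (intro square_integrable_on_power2 v1)
    have i4: "(\<lambda>s. (average h v s)\<^sup>2) integrable_on {c..c + 1}"
      by (intro square_integrable_on_power2 square_integrable_average[OF v h])
    have "integral {c..c + 1} (\<lambda>s. (f s - average h f s)\<^sup>2)
        \<le> integral {c..c + 1} (\<lambda>s. 3 * ((u s - average h u s)\<^sup>2 + (v s)\<^sup>2 + (average h v s)\<^sup>2))"
    proof (rule integral_le[OF i1])
      show "(\<lambda>s. 3 * ((u s - average h u s)\<^sup>2 + (v s)\<^sup>2 + (average h v s)\<^sup>2)) integrable_on {c..c + 1}"
        by (intro integrable_on_mult_right integrable_add i2 i3 i4)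
      fix s assume s: "s \<in> {c..c + 1}"
      have "average h v s = average h f s - average h u s"
        unfolding v_def using s h
        by (intro average_diff integrable_on_subinterval[OF square_integrable_on_imp_integrable[OF f]]
            integrable_on_subinterval[OF square_integrable_on_imp_integrable[OF u]]) auto
      then have "f s - average h f s = (u s - average h u s) + v s + (- average h v s)"
        by (simp add: v_def)
      then show "(f s - average h f s)\<^sup>2 \<le> 3 * ((u s - average h u s)\<^sup>2 + (v s)\<^sup>2 + (average h v s)\<^sup>2)"
        using power2_sum3_le[of "u s - average h u s" "v s" "- average h v s"] by simp
    qed
    also have "\<dots> = 3 * (integral {c..c + 1} (\<lambda>s. (u s - average h u s)\<^sup>2)
        + integral {c..c + 1} (\<lambda>s. (v s)\<^sup>2) + integral {c..c + 1} (\<lambda>s. (average h v s)\<^sup>2))"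
      by (intro integral_unique has_integral_mult_right has_integral_add integrable_integral i2 i3 i4)
    also have "\<dots> < 3 * (\<epsilon> / 9 + \<epsilon> / 9 + \<epsilon> / 9)"
    proof -
      have "integral {c..c + 1} (\<lambda>s. (v s)\<^sup>2) \<le> integral {c..c + 2} (\<lambda>s. (v s)\<^sup>2)"
        by (rule integral_nonneg_subset_le[OF square_integrable_on_power2[OF v]]) auto
      then show ?thesis
        using n0[OF that] average_power2_integral_le[OF v h] v\<epsilon> unfolding h_def[symmetric] by simp
    qed
    finally have "integral {c..c + 1} (\<lambda>s. (f s - average h f s)\<^sup>2) < \<epsilon>" by simp
    moreover have "0 \<le> integral {c..c + 1} (\<lambda>s. (f s - average h f s)\<^sup>2)"
      by (intro integral_nonneg i1) auto
    ultimately show ?thesis by (simp add: h_def)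
  qed
  then show "\<exists>no. \<forall>n\<ge>no. norm (integral {c..c + 1} (\<lambda>s. (f s - average (1 / real (Suc n)) f s)\<^sup>2) - 0) < \<epsilon>"
    by blast
qed

section \<open>Asymptotic stability\<close>

lemma mild_solution_diff:
  assumes "mild_solution a b Y p" "mild_solution a b Z q"
  shows "mild_solution a b (\<lambda>x. Y x - Z x) (\<lambda>x. p x - q x)"
proof -
  interpret Y: mild_solution a b Y p by fact
  interpret Z: mild_solution a b Z q by fact
  show ?thesis
  proof
    show "primitive_on {-1..} (\<lambda>x. Y x - Z x) (\<lambda>x. p x - q x)"
      unfolding primitive_on_def
    proof (intro allI impI)
      fix s t :: real assume "s \<le> t \<and> {s..t} \<subseteq> {-1..}"
      then have "((\<lambda>x. p x - q x) has_integral (Y t - Y s) - (Z t - Z s)) {s..t}"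
        by (intro has_integral_diff Y.increment Z.increment) auto
      then show "((\<lambda>x. p x - q x) has_integral Y t - Z t - (Y s - Z s)) {s..t}"
        by (rule has_integral_eq_rhs) simp
    qed
    show "square_integrable_on {-1..T} (\<lambda>x. p x - q x)" for T
      by (intro square_integrable_on_diff Y.square_integrable Z.square_integrable)
    obtain N where N: "negligible N" "\<And>t. t > 0 \<Longrightarrow> t \<notin> N \<Longrightarrow> p t + p (t - 1) + a * Y t + b * Y (t - 1) = 0"
      using Y.equation by blast
    obtain M where M: "negligible M" "\<And>t. t > 0 \<Longrightarrow> t \<notin> M \<Longrightarrow> q t + q (t - 1) + a * Z t + b * Z (t - 1) = 0"
      using Z.equation by blast
    show "\<exists>N. negligible N \<and> (\<forall>t>0. t \<notin> N \<longrightarrow>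
        p t - q t + (p (t - 1) - q (t - 1)) + a * (Y t - Z t) + b * (Y (t - 1) - Z (t - 1)) = 0)"
    proof (intro exI conjI allI impI)
      show "negligible (N \<union> M)" using N M by simp
      fix t :: real assume "0 < t" "t \<notin> N \<union> M"
      then show "p t - q t + (p (t - 1) - q (t - 1)) + a * (Y t - Z t) + b * (Y (t - 1) - Z (t - 1)) = 0"
        using N(2)[of t] M(2)[of t] by (simp add: algebra_simps)
    qed
  qed
qed

section \<open>Averages of solutions\<close>

context mild_solution
begin

lemma Y_integrable: "-1 \<le> s \<Longrightarrow> Y integrable_on {s..t}"
  by (rule square_integrable_on_imp_integrable[OF square_integrable_Y])

lemma average_p:
  assumes "-1 \<le> s" "0 < h"
  shows "average h p s = (Y (s + h) - Y s) / h"
  using increment[of s "s + h"] assms by (simp add: average_def has_integral_iff)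

lemma average_Y_increment:
  assumes s: "-1 \<le> s" "s \<le> t" and h: "0 < h"
  shows "((\<lambda>x. (Y (x + h) - Y x) / h) has_integral average h Y t - average h Y s) {s..t}"
proof -
  have shifted: "(\<lambda>x. Y (x + h)) integrable_on {s..t}"
    unfolding integrable_shift_Icc using assms by (intro Y_integrable) auto
  have "((\<lambda>x. (Y (x + h) - Y x) / h) has_integral
      (integral {s..t} (\<lambda>x. Y (x + h)) - integral {s..t} Y) / h) {s..t}"
    using assms by (intro has_integral_divide has_integral_diff integrable_integral shifted Y_integrable)
  also have "integral {s..t} (\<lambda>x. Y (x + h)) = integral {s + h..t + h} Y"
    by (rule integral_shift_Icc)
  also have "integral {s + h..t + h} Y - integral {s..t} Y = integral {t..t + h} Y - integral {s..s + h} Y"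
  proof -
    have "Y integrable_on {s..t + h}" using s by (intro Y_integrable)
    note diff = integral_initial_diff[OF this]
    show ?thesis using diff[of "s + h" "t + h"] diff[of t "t + h"] s h by simp
  qed
  finally show ?thesis by (simp add: average_def diff_divide_distrib)
qed

text \<open>The equation integrated over \<open>{t..t + h}\<close> and divided by \<open>h\<close>.
  Integration absorbs the exceptional set, so the averaged equation holds at every
  \<open>t > 0\<close>.\<close>

lemma mild_solution_average:
  assumes h: "0 < h"
  shows "mild_solution a b (average h Y) (\<lambda>x. (Y (x + h) - Y x) / h)"
proof
  show "primitive_on {-1..} (average h Y) (\<lambda>x. (Y (x + h) - Y x) / h)"
    unfolding primitive_on_def using h by (auto intro!: average_Y_increment)
  show "square_integrable_on {-1..T} (\<lambda>x. (Y (x + h) - Y x) / h)" for T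
  proof -
    have "continuous_on {-1..T} (\<lambda>x. Y (x + h))"
      by (rule continuous_on_compose2[OF continuous_Y[of "-1" "T + h"]])
        (use h in \<open>auto intro!: continuous_intros\<close>)
    then show ?thesis
      using h continuous_Y[of "-1" T] by (intro square_integrable_on_continuous continuous_intros) auto
  qed
  obtain N where N: "negligible N" "\<And>t. t > 0 \<Longrightarrow> t \<notin> N \<Longrightarrow> p t + p (t - 1) + a * Y t + b * Y (t - 1) = 0"
    using equation by blast
  have "(Y (t + h) - Y t) / h + (Y (t - 1 + h) - Y (t - 1)) / h + a * average h Y t + b * average h Y (t - 1) = 0"
    if t: "0 < t" for t
  proof -
    have p1: "((\<lambda>x. p (x - 1)) has_integral Y (t - 1 + h) - Y (t - 1)) {t..t + h}"
      using has_integral_shift_real_ivl[OF increment[of "t - 1" "t - 1 + h"], of "-1"] t h by simp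
    have Y1: "((\<lambda>x. Y (x - 1)) has_integral integral {t - 1..t - 1 + h} Y) {t..t + h}"
      using has_integral_shift_real_ivl[OF integrable_integral[OF Y_integrable[of "t - 1" "t - 1 + h"]], of "-1"] t by simp
    have "((\<lambda>x. p x + p (x - 1) + a * Y x + b * Y (x - 1)) has_integral
        (Y (t + h) - Y t) + (Y (t - 1 + h) - Y (t - 1)) + a * integral {t..t + h} Y
        + b * integral {t - 1..t - 1 + h} Y) {t..t + h}"
      using t h by (intro has_integral_add has_integral_mult_right p1 Y1 increment integrable_integral Y_integrable) auto
    moreover have "((\<lambda>x. p x + p (x - 1) + a * Y x + b * Y (x - 1)) has_integral 0) {t..t + h}"
      by (rule has_integral_spike[OF N(1) _ has_integral_0]) (use N(2) t in auto)
    ultimately have "(Y (t + h) - Y t) + (Y (t - 1 + h) - Y (t - 1)) + a * integral {t..t + h} Y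
        + b * integral {t - 1..t - 1 + h} Y = 0"
      by (rule has_integral_unique)
    then have "((Y (t + h) - Y t) + (Y (t - 1 + h) - Y (t - 1)) + a * integral {t..t + h} Y
        + b * integral {t - 1..t - 1 + h} Y) / h = 0"
      by simp
    then show ?thesis
      unfolding average_def by (simp add: add_divide_distrib)
  qed
  then show "\<exists>N. negligible N \<and> (\<forall>t>0. t \<notin> N \<longrightarrow>
      (Y (t + h) - Y t) / h + (Y (t - 1 + h) - Y (t - 1)) / h + a * average h Y t + b * average h Y (t - 1) = 0)"
    by (intro exI[of _ "{}"]) auto
qed

text \<open>The derivative of the average is the average of \<open>p\<close>, so the same
  convergence result serves both halves of the energy.\<close>

lemma history_energy_average_tendsto:
  "(\<lambda>n. history_energy (\<lambda>x. Y x - average (1 / real (Suc n)) Y x)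
      (\<lambda>x. p x - (Y (x + 1 / real (Suc n)) - Y x) / (1 / real (Suc n))) 0) \<longlonglongrightarrow> 0"
proof -
  have "(\<lambda>n. integral {-1..0} (\<lambda>s. (Y s - average (1 / real (Suc n)) Y s)\<^sup>2)
      + integral {-1..0} (\<lambda>s. (p s - average (1 / real (Suc n)) p s)\<^sup>2)) \<longlonglongrightarrow> 0 + 0"
    using average_tendsto[of "-1" Y] average_tendsto[of "-1" p]
      square_integrable_Y[of "-1" 1] square_integrable_p[of "-1" 1]
    by (intro tendsto_add) auto
  moreover have "integral {-1..0} (\<lambda>s. (p s - average h p s)\<^sup>2)
      = integral {-1..0} (\<lambda>s. (p s - (Y (s + h) - Y s) / h)\<^sup>2)" if "0 < h" for h
    by (rule integral_cong) (use average_p that in auto)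
  ultimately show ?thesis
    by (simp add: history_energy_def)
qed

text \<open>Here a derivative is traded for values: a difference quotient needs no information about
  \<open>p\<close>. The price \<open>4 / h\<^sup>2\<close> is harmless because \<open>h\<close> is
  fixed before \<open>t\<close> tends to infinity.\<close>

lemma history_energy_average_le:
  assumes h: "0 < h" "h \<le> 1" and t: "0 \<le> t"
  shows "history_energy (average h Y) (\<lambda>x. (Y (x + h) - Y x) / h) t
    \<le> (1 + 4 / h\<^sup>2) * integral {t - 1..t + 1} (\<lambda>x. (Y x)\<^sup>2)"
proof -
  define I where "I = integral {t - 1..t + 1} (\<lambda>x. (Y x)\<^sup>2)"
  have Y2: "(\<lambda>x. (Y x)\<^sup>2) integrable_on {t - 1..t + 1}" using t by (intro Y2_integrable) auto
  have Y2': "(\<lambda>x. (Y x)\<^sup>2) integrable_on {t - 1..t}" using t by (intro Y2_integrable) auto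
  have Y2h: "(\<lambda>x. (Y (x + h))\<^sup>2) integrable_on {t - 1..t}"
    using integrable_shift_Icc[of "\<lambda>x. (Y x)\<^sup>2" h "t - 1" t] t h Y2_integrable[of "t - 1 + h"] by auto
  have "integral {t - 1..t} (\<lambda>x. (average h Y x)\<^sup>2) \<le> I"
  proof -
    have "square_integrable_on {t - 1..t - 1 + 2} Y" using t by (intro square_integrable_Y) simp
    from average_power2_integral_le[OF this h] show ?thesis
      unfolding I_def by (simp add: algebra_simps)
  qed
  moreover have "integral {t - 1..t} (\<lambda>x. ((Y (x + h) - Y x) / h)\<^sup>2) \<le> 4 / h\<^sup>2 * I"
  proof -
    interpret avg: mild_solution a b "average h Y" "\<lambda>x. (Y (x + h) - Y x) / h"
      using h(1) by (rule mild_solution_average)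
    have "integral {t - 1..t} (\<lambda>x. ((Y (x + h) - Y x) / h)\<^sup>2)
        \<le> integral {t - 1..t} (\<lambda>x. 2 / h\<^sup>2 * ((Y (x + h))\<^sup>2 + (Y x)\<^sup>2))"
    proof (rule integral_le)
      show "(\<lambda>x. ((Y (x + h) - Y x) / h)\<^sup>2) integrable_on {t - 1..t}"
        using t by (intro avg.p2_integrable) auto
      show "(\<lambda>x. 2 / h\<^sup>2 * ((Y (x + h))\<^sup>2 + (Y x)\<^sup>2)) integrable_on {t - 1..t}"
        by (intro integrable_on_mult_right integrable_add Y2h Y2')
      fix x
      have "(Y (x + h) - Y x)\<^sup>2 \<le> 2 * ((Y (x + h))\<^sup>2 + (Y x)\<^sup>2)"
        using zero_le_power2[of "Y (x + h) + Y x"] by (simp add: power2_eq_square algebra_simps)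
      then show "((Y (x + h) - Y x) / h)\<^sup>2 \<le> 2 / h\<^sup>2 * ((Y (x + h))\<^sup>2 + (Y x)\<^sup>2)"
        by (simp add: power_divide divide_right_mono)
    qed
    also have "\<dots> = 2 / h\<^sup>2 * (integral {t - 1..t} (\<lambda>x. (Y (x + h))\<^sup>2) + integral {t - 1..t} (\<lambda>x. (Y x)\<^sup>2))"
      by (intro integral_unique has_integral_mult_right has_integral_add integrable_integral Y2h Y2')
    also have "\<dots> \<le> 2 / h\<^sup>2 * (I + I)"
    proof -
      have "integral {t - 1..t} (\<lambda>x. (Y (x + h))\<^sup>2) = integral {t - 1 + h..t + h} (\<lambda>x. (Y x)\<^sup>2)"
        by (rule integral_shift_Icc)
      also have "\<dots> \<le> I"
        unfolding I_def using h by (intro integral_nonneg_subset_le[OF Y2]) auto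
      finally have "integral {t - 1..t} (\<lambda>x. (Y (x + h))\<^sup>2) \<le> I" .
      moreover have "integral {t - 1..t} (\<lambda>x. (Y x)\<^sup>2) \<le> I"
        unfolding I_def by (intro integral_nonneg_subset_le[OF Y2]) auto
      ultimately show ?thesis by (intro mult_left_mono add_mono) auto
    qed
    finally show ?thesis by simp
  qed
  ultimately show ?thesis
    by (simp add: history_energy_def I_def distrib_right)
qed

end

lemma history_energy_triangle:
  assumes "mild_solution a b Y p" "mild_solution a b Z q" "0 \<le> t"
  shows "history_energy Y p t \<le> 2 * history_energy (\<lambda>x. Y x - Z x) (\<lambda>x. p x - q x) t + 2 * history_energy Z q t"
proof -
  interpret Y: mild_solution a b Y p by fact
  interpret Z: mild_solution a b Z q by fact
  interpret D: mild_solution a b "\<lambda>x. Y x - Z x" "\<lambda>x. p x - q x"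
    using assms by (intro mild_solution_diff)
  have *: "integral {t - 1..t} (\<lambda>x. (f x)\<^sup>2)
      \<le> 2 * integral {t - 1..t} (\<lambda>x. (f x - g x)\<^sup>2) + 2 * integral {t - 1..t} (\<lambda>x. (g x)\<^sup>2)"
    if i: "(\<lambda>x. (f x)\<^sup>2) integrable_on {t - 1..t}" "(\<lambda>x. (f x - g x)\<^sup>2) integrable_on {t - 1..t}"
      "(\<lambda>x. (g x)\<^sup>2) integrable_on {t - 1..t}" for f g :: "real \<Rightarrow> real"
  proof -
    have "integral {t - 1..t} (\<lambda>x. (f x)\<^sup>2) \<le> integral {t - 1..t} (\<lambda>x. 2 * (f x - g x)\<^sup>2 + 2 * (g x)\<^sup>2)"
    proof (rule integral_le)
      show "(f x)\<^sup>2 \<le> 2 * (f x - g x)\<^sup>2 + 2 * (g x)\<^sup>2" for x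
        using zero_le_power2[of "f x - 2 * g x"] by (simp add: power2_eq_square algebra_simps)
    qed (use i in \<open>auto intro!: integrable_add integrable_on_mult_right\<close>)
    also have "\<dots> = 2 * integral {t - 1..t} (\<lambda>x. (f x - g x)\<^sup>2) + 2 * integral {t - 1..t} (\<lambda>x. (g x)\<^sup>2)"
      by (intro integral_unique has_integral_mult_right has_integral_add integrable_integral i)
    finally show ?thesis .
  qed
  have "-1 \<le> t - 1" using \<open>0 \<le> t\<close> by simp
  then show ?thesis
    using *[OF Y.Y2_integrable D.Y2_integrable Z.Y2_integrable] *[OF Y.p2_integrable D.p2_integrable Z.p2_integrable]
    by (simp add: history_energy_def)
qed

text \<open>With \<open>a\<^sup>2 - b\<^sup>2 > 0\<close> the energy identity bounds the increasing
  function \<open>I\<close>; its increments over intervals of length two must therefore die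
  out.\<close>

lemma (in dissipative_solution) window_Y2_tendsto:
  assumes strict: "a > \<bar>b\<bar>"
  shows "((\<lambda>t. integral {t - 1..t + 1} (\<lambda>x. (Y x)\<^sup>2)) \<longlongrightarrow> 0) at_top"
proof -
  define I where "I t = integral {0..t} (\<lambda>x. (Y x)\<^sup>2)" for t
  have pos: "0 < a\<^sup>2 - b\<^sup>2"
    using strict by (metis abs_ge_zero diff_gt_0_iff_gt power2_abs power_strict_mono zero_less_numeral)
  have Y2: "(\<lambda>x. (Y x)\<^sup>2) integrable_on {0..t}" for t by (rule Y2_integrable) simp
  have bound: "I t \<le> energy 0 / (a\<^sup>2 - b\<^sup>2)" if "0 \<le> t" for t
  proof -
    have "0 \<le> energy t"
      unfolding energy_def using ab that by (intro add_nonneg_nonneg integral_nonneg pY2_integrable) auto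
    then have "(a\<^sup>2 - b\<^sup>2) * I t \<le> energy 0"
      using energy_identity[OF that] by (simp add: I_def)
    then show ?thesis using pos by (simp add: field_simps)
  qed
  have mono: "I s \<le> I t" if "s \<le> t" for s t
    unfolding I_def using that by (intro integral_nonneg_subset_le[OF Y2]) auto
  have bdd: "bdd_above (I ` {0..})"
    using bound by (intro bdd_aboveI2) auto
  define L where "L = (SUP t\<in>{0..}. I t)"
  show ?thesis
  proof (rule tendstoI)
    fix \<epsilon> :: real assume \<epsilon>: "\<epsilon> > 0"
    then have "L - \<epsilon> < (SUP t\<in>{0..}. I t)" by (simp add: L_def)
    then obtain T where T: "T \<ge> 0" "L - \<epsilon> < I T"
      using less_cSUP_iff[OF _ bdd] by auto
    have "dist (integral {t - 1..t + 1} (\<lambda>x. (Y x)\<^sup>2)) 0 < \<epsilon>" if "t \<ge> T + 1" for t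
    proof -
      have "integral {t - 1..t + 1} (\<lambda>x. (Y x)\<^sup>2) = I (t + 1) - I (t - 1)"
        unfolding I_def using integral_initial_diff[OF Y2[of "t + 1"], of "t - 1" "t + 1"] that T by simp
      moreover have "I (t + 1) \<le> L"
        unfolding L_def using that T by (intro cSUP_upper bdd) auto
      moreover have "I T \<le> I (t - 1)" using that by (intro mono) auto
      moreover have "I (t - 1) \<le> I (t + 1)" by (intro mono) auto
      ultimately show ?thesis using T by (simp add: dist_real_def)
    qed
    then show "\<forall>\<^sub>F t in at_top. dist (integral {t - 1..t + 1} (\<lambda>x. (Y x)\<^sup>2)) 0 < \<epsilon>"
      using eventually_at_top_linorder by blast
  qed
qed

text \<open>The spectrum approaches the imaginary axis, so there is no decay rate. The averages over
  \<open>[t, t + h]\<close> solve the equation too and their energy vanishes, because both they and their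
  derivatives are controlled by the square integrable \<open>Y\<close>; they approximate \<open>Y\<close> at time
  \<open>0\<close>, hence uniformly in time by stability.\<close>

lemma (in dissipative_solution) history_energy_tendsto:
  assumes strict: "a > \<bar>b\<bar>"
  shows "(history_energy Y p \<longlongrightarrow> 0) at_top"
proof (rule tendstoI)
  fix \<epsilon> :: real assume \<epsilon>: "\<epsilon> > 0"
  \<comment> \<open>Origin of the tolerance \<open>\<epsilon> / (4 * C)\<close> below: stability
    multiplies the initial error by at most \<open>C\<close>, and
    \<open>history_energy_triangle\<close> doubles two terms that are each below
    \<open>\<epsilon> / 4\<close>. The maximum keeps \<open>C\<close> positive.\<close>
  define C where "C = max 1 (dissipative_solution.stability_constant a b)"
  have C: "C > 0" "dissipative_solution.stability_constant a b \<le> C" by (auto simp: C_def)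
  have "\<forall>\<^sub>F n in sequentially. history_energy (\<lambda>x. Y x - average (1 / real (Suc n)) Y x)
      (\<lambda>x. p x - (Y (x + 1 / real (Suc n)) - Y x) / (1 / real (Suc n))) 0 < \<epsilon> / (4 * C)"
    using history_energy_average_tendsto by (rule order_tendstoD) (use \<epsilon> C in simp)
  then obtain n where n: "history_energy (\<lambda>x. Y x - average (1 / real (Suc n)) Y x)
      (\<lambda>x. p x - (Y (x + 1 / real (Suc n)) - Y x) / (1 / real (Suc n))) 0 < \<epsilon> / (4 * C)"
    using eventually_happens by force
  define h where "h = 1 / real (Suc n)"
  have h: "0 < h" "h \<le> 1" by (auto simp: h_def)
  define Z where "Z = average h Y"
  define q where "q x = (Y (x + h) - Y x) / h" for x
  have Zq: "mild_solution a b Z q"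
    unfolding Z_def q_def using h(1) by (rule mild_solution_average)
  interpret D: dissipative_solution a b "\<lambda>x. Y x - Z x" "\<lambda>x. p x - q x"
    using mild_solution_diff[OF mild_solution_axioms Zq] a_pos ab
    by (intro dissipative_solution.intro dissipative_solution_axioms.intro)
  have D0: "history_energy (\<lambda>x. Y x - Z x) (\<lambda>x. p x - q x) 0 < \<epsilon> / (4 * C)"
    using n unfolding Z_def q_def h_def .
  have "((\<lambda>t. (1 + 4 / h\<^sup>2) * integral {t - 1..t + 1} (\<lambda>x. (Y x)\<^sup>2)) \<longlongrightarrow> (1 + 4 / h\<^sup>2) * 0) at_top"
    by (intro tendsto_mult tendsto_const window_Y2_tendsto strict)
  then have "\<forall>\<^sub>F t in at_top. (1 + 4 / h\<^sup>2) * integral {t - 1..t + 1} (\<lambda>x. (Y x)\<^sup>2) < \<epsilon> / 4"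
    using \<epsilon> by (intro order_tendstoD) auto
  then show "\<forall>\<^sub>F t in at_top. dist (history_energy Y p t) 0 < \<epsilon>"
    using eventually_ge_at_top[of 0]
  proof eventually_elim
    case (elim t)
    have "history_energy (\<lambda>x. Y x - Z x) (\<lambda>x. p x - q x) t
        \<le> dissipative_solution.stability_constant a b * history_energy (\<lambda>x. Y x - Z x) (\<lambda>x. p x - q x) 0"
      using elim by (intro D.history_energy_le)
    also have "\<dots> \<le> C * history_energy (\<lambda>x. Y x - Z x) (\<lambda>x. p x - q x) 0"
      using C D.history_energy_nonneg[of 0] by (intro mult_right_mono) auto
    also have "\<dots> < C * (\<epsilon> / (4 * C))"
      using C D0 by (intro mult_strict_left_mono)
    also have "\<dots> = \<epsilon> / 4" using C by simp
    finally have "history_energy (\<lambda>x. Y x - Z x) (\<lambda>x. p x - q x) t < \<epsilon> / 4" .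
    moreover have "history_energy Z q t < \<epsilon> / 4"
      using history_energy_average_le[OF h elim(2)] elim(1) unfolding Z_def q_def by linarith
    moreover have "history_energy Y p t
        \<le> 2 * history_energy (\<lambda>x. Y x - Z x) (\<lambda>x. p x - q x) t + 2 * history_energy Z q t"
      using mild_solution_axioms Zq elim(2) by (rule history_energy_triangle)
    ultimately show ?case
      using history_energy_nonneg[OF elim(2)] by (simp add: dist_real_def)
  qed
qed

theorem zero_asymptotically_stable_dissipative:
  assumes "a > \<bar>b\<bar>"
  shows "zero_asymptotically_stable a b"
  unfolding zero_asymptotically_stable_def
proof
  show "zero_stable a b" using assms by (intro zero_stable_dissipative) auto
  show "\<exists>\<eta>>0. \<forall>y0 y. neutral_solution a b y0 y \<and> H1_norm {-1<..<0} y0 < \<eta> \<longrightarrow> (state_norm y \<longlongrightarrow> 0) at_top"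
  proof (intro exI[of _ 1] conjI allI impI)
    fix y0 y assume "neutral_solution a b y0 y \<and> H1_norm {-1<..<0} y0 < 1"
    then have sol: "neutral_solution a b y0 y" by simp
    obtain Y p where Y: "mild_solution a b Y p"
      "\<forall>t\<ge>0. state_norm y t = sqrt (history_energy Y p t)"
      "H1_norm {-1<..<0} y0 = sqrt (history_energy Y p 0)"
      by (rule neutral_solution_imp_mild_solution[OF sol])
    interpret dissipative_solution a b Y p
      using Y(1) assms by (intro dissipative_solution.intro dissipative_solution_axioms.intro) auto
    have "((\<lambda>t. sqrt (history_energy Y p t)) \<longlongrightarrow> sqrt 0) at_top"
      by (intro tendsto_real_sqrt history_energy_tendsto assms)
    moreover have "\<forall>\<^sub>F t in at_top. sqrt (history_energy Y p t) = state_norm y t"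
      using eventually_ge_at_top[of 0] by eventually_elim (use Y(2) in auto)
    ultimately show "(state_norm y \<longlongrightarrow> 0) at_top"
      by (simp add: tendsto_cong)
  qed auto
qed

section \<open>Characteristic roots\<close>

lemma char_roots_iff: "z \<in> char_roots a b \<longleftrightarrow> (z + of_real a) * exp z = - (z + of_real b)"
  by (auto simp: char_roots_def algebra_simps add_eq_0_iff)

text \<open>Time reversal: if \<open>y\<close> solves the equation for \<open>(a, b)\<close>, then
  the function with value \<open>y (- t)\<close> at \<open>t\<close> solves it for
  \<open>(- b, - a)\<close>. It carries results about one half-plane to the other.\<close>

lemma char_roots_uminus: "- z \<in> char_roots (- b) (- a) \<longleftrightarrow> z \<in> char_roots a b"
proof -
  have "- z \<in> char_roots (- b) (- a) \<longleftrightarrow> exp z * ((- z - of_real b) * exp (- z)) = exp z * (z + of_real a)"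
    by (simp add: char_roots_iff add.commute)
  also have "exp z * ((- z - of_real b) * exp (- z)) = - (z + of_real b)"
    by (simp add: exp_minus field_simps)
  finally show ?thesis by (auto simp: char_roots_iff mult.commute)
qed

section \<open>Roots located by comparing moduli\<close>

lemma char_roots_modulus:
  assumes "z \<in> char_roots a b"
  shows "((Re z + a)\<^sup>2 + (Im z)\<^sup>2) * exp (2 * Re z) = (Re z + b)\<^sup>2 + (Im z)\<^sup>2"
proof -
  have "cmod (z + of_real a) * exp (Re z) = cmod (z + of_real b)"
    using assms unfolding char_roots_iff by (metis norm_exp_eq_Re norm_minus_cancel norm_mult)
  then have "(cmod (z + of_real a))\<^sup>2 * (exp (Re z))\<^sup>2 = (cmod (z + of_real b))\<^sup>2"
    by (metis power_mult_distrib)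
  moreover have "(exp (Re z))\<^sup>2 = exp (2 * Re z)"
    by (simp add: power2_eq_square flip: exp_add)
  ultimately show ?thesis by (simp add: cmod_power2)
qed

text \<open>In the closed right half-plane the exponential has modulus at least one, so
  \<open>z\<close> is no farther from \<open>- a\<close> than from \<open>- b\<close>. The imaginary
  parts cancel and a linear condition on \<open>Re z\<close> remains.\<close>

lemma char_roots_not_right:
  assumes z: "z \<in> char_roots a b" and "0 \<le> Re z"
  shows "2 * (a - b) * Re z + (a\<^sup>2 - b\<^sup>2) \<le> 0"
proof -
  have "((Re z + a)\<^sup>2 + (Im z)\<^sup>2) * 1 \<le> ((Re z + a)\<^sup>2 + (Im z)\<^sup>2) * exp (2 * Re z)"
    using assms(2) by (intro mult_left_mono) auto
  then show ?thesis
    unfolding char_roots_modulus[OF z] by (simp add: power2_eq_square algebra_simps)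
qed

lemma char_roots_not_left:
  assumes z: "z \<in> char_roots a b" and "Re z \<le> 0"
  shows "0 \<le> 2 * (a - b) * Re z + (a\<^sup>2 - b\<^sup>2)"
proof -
  have "((Re z + a)\<^sup>2 + (Im z)\<^sup>2) * exp (2 * Re z) \<le> ((Re z + a)\<^sup>2 + (Im z)\<^sup>2) * 1"
    using assms(2) by (intro mult_left_mono) auto
  then show ?thesis
    unfolding char_roots_modulus[OF z] by (simp add: power2_eq_square algebra_simps)
qed

lemma power2_less_iff_abs_less:
  fixes x y :: real
  shows "x\<^sup>2 < y\<^sup>2 \<longleftrightarrow> \<bar>x\<bar> < \<bar>y\<bar>"
  by (metis abs_le_square_iff linorder_not_le)

lemma char_roots_Re_neg:
  assumes "a > \<bar>b\<bar>" "z \<in> char_roots a b"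
  shows "Re z < 0"
proof (rule ccontr)
  assume "\<not> Re z < 0"
  moreover have "0 \<le> 2 * (a - b) * Re z" if "0 \<le> Re z"
    using assms(1) that by (intro mult_nonneg_nonneg) auto
  moreover have "b\<^sup>2 < a\<^sup>2" using assms(1) by (simp add: power2_less_iff_abs_less)
  ultimately show False using char_roots_not_right[OF assms(2)] by linarith
qed

lemma char_roots_Re_pos:
  assumes "b < - \<bar>a\<bar>" "z \<in> char_roots a b"
  shows "Re z > 0"
proof (rule ccontr)
  assume "\<not> Re z > 0"
  moreover have "2 * (a - b) * Re z \<le> 0" if "Re z \<le> 0"
    using assms(1) that by (intro mult_nonneg_nonpos) auto
  moreover have "a\<^sup>2 < b\<^sup>2" using assms(1) by (simp add: power2_less_iff_abs_less)
  ultimately show False using char_roots_not_left[OF assms(2)] by linarith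
qed

lemma char_roots_Re_nonzero:
  assumes "\<bar>a\<bar> \<noteq> \<bar>b\<bar>" "z \<in> char_roots a b"
  shows "Re z \<noteq> 0"
proof
  assume "Re z = 0"
  then have "a\<^sup>2 = b\<^sup>2"
    using char_roots_not_left[OF assms(2)] char_roots_not_right[OF assms(2)] by simp
  then show False using assms(1) by (metis real_sqrt_abs)
qed

lemma char_roots_antisymmetric_pos:
  assumes "a > 0" "z \<in> char_roots a (- a)"
  shows "Re z = 0"
proof (rule ccontr)
  assume "Re z \<noteq> 0"
  then consider "0 < Re z" | "Re z < 0" by linarith
  then show False
  proof cases
    case 1
    then have "0 < a * Re z" using assms(1) by simp
    then show False using char_roots_not_right[OF assms(2)] 1 by simp
  next
    case 2
    then have "a * Re z < 0" using assms(1) by (simp add: mult_pos_neg)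
    then show False using char_roots_not_left[OF assms(2)] 2 by simp
  qed
qed

lemma char_roots_diagonal:
  "z \<in> char_roots a a \<longleftrightarrow> z = of_real (- a) \<or> exp z = -1"
proof -
  have "z \<in> char_roots a a \<longleftrightarrow> (z + of_real a) * (exp z + 1) = 0"
    by (simp add: char_roots_def algebra_simps)
  then show ?thesis by (auto simp: add_eq_0_iff2)
qed

lemma exp_eq_minus_one_imp_Re:
  assumes "exp z = (-1 :: complex)"
  shows "Re z = 0"
proof -
  have "exp (Re z) = cmod (exp z)" by simp
  then show ?thesis by (simp add: assms)
qed

text \<open>With \<open>s = (a + b) / 2\<close> and \<open>d = (b - a) / 2\<close> the characteristic equation reads
  \<open>z + s = d tanh (z / 2)\<close>; these are its real and imaginary parts, free of denominators.\<close>

lemma char_roots_Re_Im: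
  assumes z: "z \<in> char_roots a b"
  defines "s \<equiv> (a + b) / 2" and "d \<equiv> (b - a) / 2"
  defines "B \<equiv> (exp (Re z) * cos (Im z) + 1)\<^sup>2 + (exp (Re z) * sin (Im z))\<^sup>2"
  shows "(Re z + s) * B = d * ((exp (Re z))\<^sup>2 - 1)"
    and "Im z * B = 2 * d * exp (Re z) * sin (Im z)"
proof -
  define E where "E = exp (Re z)"
  define x where "x = Re z"
  define y where "y = Im z"
  define C where "C = E * cos y"
  define S where "S = E * sin y"
  have CS: "C\<^sup>2 + S\<^sup>2 = E\<^sup>2"
    by (simp add: C_def S_def power_mult_distrib flip: distrib_left)
  have eq: "z * (exp z + 1) + of_real a * exp z + of_real b = 0"
    using z by (simp add: char_roots_def)
  have ez: "Re (exp z) = C" "Im (exp z) = S"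
    by (simp_all add: Re_exp Im_exp C_def S_def E_def y_def)
  have R: "x * (C + 1) - y * S + a * C + b = 0"
    using arg_cong[OF eq, of Re] by (simp add: ez x_def y_def)
  have I: "x * S + y * (C + 1) + a * S = 0"
    using arg_cong[OF eq, of Im] by (simp add: ez x_def y_def)
  have ab: "a = s - d" "b = s + d" by (simp_all add: s_def d_def field_simps)
  have B: "B = (C + 1)\<^sup>2 + S\<^sup>2" by (simp add: B_def C_def S_def E_def y_def)
  \<comment> \<open>Both identities come from multiplying the equation by the conjugate of
    \<open>exp z + 1\<close>; \<open>B\<close> is the squared modulus of that number.\<close>
  have "(x + s) * B - d * (E\<^sup>2 - 1) = (C + 1) * (x * (C + 1) - y * S + a * C + b) + S * (x * S + y * (C + 1) + a * S)"
    unfolding B CS[symmetric] ab by (simp add: power2_eq_square algebra_simps)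
  then show "(Re z + s) * B = d * ((exp (Re z))\<^sup>2 - 1)"
    unfolding R I by (simp add: x_def E_def)
  have "y * B - 2 * d * S = (C + 1) * (x * S + y * (C + 1) + a * S) - S * (x * (C + 1) - y * S + a * C + b)"
    unfolding B ab by (simp add: power2_eq_square algebra_simps)
  then show "Im z * B = 2 * d * exp (Re z) * sin (Im z)"
    unfolding R I by (simp add: y_def S_def E_def)
qed

lemma exp_power2_minus_one_ge:
  fixes x :: real
  assumes "0 \<le> x"
  shows "2 * exp x * x \<le> (exp x)\<^sup>2 - 1"
proof -
  have "x \<le> (exp x - inverse (exp x)) / 2" using real_le_x_sinh[OF assms] .
  then have "2 * exp x * x \<le> 2 * exp x * ((exp x - inverse (exp x)) / 2)"
    by (intro mult_left_mono) auto
  also have "\<dots> = (exp x)\<^sup>2 - 1"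
    by (simp add: field_simps power2_eq_square)
  finally show ?thesis .
qed

text \<open>This is \<open>x < sinh x\<close>; the derivative of \<open>sinh u - u\<close> is
  \<open>(exp u - 1)\<^sup>2 * exp (- u) / 2\<close>. Strictness is what decides in the case
  \<open>a = - b\<close>, where the shift \<open>(a + b) / 2\<close> is zero.\<close>

lemma exp_power2_minus_one_gt:
  fixes x :: real
  assumes "0 < x"
  shows "2 * exp x * x < (exp x)\<^sup>2 - 1"
proof -
  have "\<exists>u>0. u < x \<and> ((exp x - exp (- x)) / 2 - x) - ((exp 0 - exp (- 0)) / 2 - 0)
      = (x - 0) * ((exp u + exp (- u)) / 2 - 1)"
    by (rule MVT2[OF assms]) (auto intro!: derivative_eq_intros simp: field_simps)
  then obtain u where u: "u > 0" "(exp x - exp (- x)) / 2 - x = x * ((exp u + exp (- u)) / 2 - 1)"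
    by auto
  have "0 < (exp u - 1)\<^sup>2 * exp (- u)" using u(1) by simp
  also have "(exp u - 1)\<^sup>2 * exp (- u) = exp u + exp (- u) - 2"
    by (simp add: power2_eq_square algebra_simps flip: exp_add)
  finally have "0 < x * ((exp u + exp (- u)) / 2 - 1)" using assms by (intro mult_pos_pos) auto
  then have "x < (exp x - exp (- x)) / 2" using u(2) by linarith
  then have "2 * exp x * x < 2 * exp x * ((exp x - exp (- x)) / 2)"
    by (intro mult_strict_left_mono) auto
  also have "\<dots> = exp x * (exp x - exp (- x))" by simp
  also have "\<dots> = (exp x)\<^sup>2 - exp x * exp (- x)"
    by (simp only: power2_eq_square right_diff_distrib)
  also have "exp x * exp (- x) = 1" by (simp flip: exp_add)
  finally show ?thesis .
qed

lemma exp_power2_minus_one_le: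
  fixes x :: real
  assumes "x \<le> 0"
  shows "(exp x)\<^sup>2 - 1 \<le> 2 * exp x * x"
proof -
  have "2 * exp (- x) * (- x) \<le> (exp (- x))\<^sup>2 - 1"
    using exp_power2_minus_one_ge[of "- x"] assms by simp
  then have le: "(exp x)\<^sup>2 * (2 * exp (- x) * (- x)) \<le> (exp x)\<^sup>2 * ((exp (- x))\<^sup>2 - 1)"
    by (rule mult_left_mono) simp
  have EF: "exp x * exp (- x) = 1" by (simp flip: exp_add)
  have "(exp x)\<^sup>2 * (2 * exp (- x) * (- x)) = (exp x * exp (- x)) * (2 * exp x * (- x))"
    by (simp add: power2_eq_square)
  also have "\<dots> = - (2 * exp x * x)" unfolding EF by simp
  finally have 1: "(exp x)\<^sup>2 * (2 * exp (- x) * (- x)) = - (2 * exp x * x)" .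
  have 2: "(exp x)\<^sup>2 * ((exp (- x))\<^sup>2 - 1) = (exp x * exp (- x))\<^sup>2 - (exp x)\<^sup>2"
    by (simp add: power2_eq_square algebra_simps)
  show ?thesis using le unfolding 1 2 EF by simp
qed

section \<open>Real roots and the left half-plane\<close>

lemma tanh_half_eq: "tanh (x / 2 :: real) = (exp x - 1) / (exp x + 1)"
proof -
  have "exp x * exp (- x) = 1" by (simp flip: exp_add)
  then have "(exp x - 1) / (exp x + 1) = (exp x * (1 - exp (- x))) / (exp x * (1 + exp (- x)))"
    by (simp add: algebra_simps)
  also have "\<dots> = tanh (x / 2)"
    by (simp add: tanh_real_altdef)
  finally show ?thesis by simp
qed

lemma real_char_root_iff:
  "complex_of_real x \<in> char_roots a b \<longleftrightarrow> x + (a + b) / 2 = (b - a) / 2 * tanh (x / 2)"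
proof -
  have "complex_of_real x \<in> char_roots a b \<longleftrightarrow> complex_of_real (x * (exp x + 1) + a * exp x + b) = 0"
    unfolding char_roots_def by (simp add: exp_of_real)
  also have "\<dots> \<longleftrightarrow> x * (exp x + 1) + a * exp x + b = 0"
    by (simp only: of_real_eq_0_iff)
  also have "\<dots> \<longleftrightarrow> (x + (a + b) / 2) * (exp x + 1) = (b - a) / 2 * (exp x - 1)"
    by (auto simp: field_simps)
  also have "\<dots> \<longleftrightarrow> x + (a + b) / 2 = (b - a) / 2 * tanh (x / 2)"
  proof -
    have "exp x + 1 \<noteq> 0" using exp_gt_zero[of x] by linarith
    then show ?thesis unfolding tanh_half_eq times_divide_eq_right by (rule nonzero_eq_divide_eq[symmetric])
  qed
  finally show ?thesis .
qed

lemma tanh_half_deriv: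
  "((\<lambda>x. d * tanh (x / 2) - s - x) has_real_derivative d / 2 * (1 - (tanh (x / 2))\<^sup>2) - 1) (at x)"
proof -
  have "cosh (x / 2) \<noteq> 0" using cosh_real_pos[of "x / 2"] by linarith
  then show ?thesis
    by (auto intro!: derivative_eq_intros)
qed

text \<open>On the negative axis \<open>k\<close> is convex, since the square of \<open>tanh\<close>
  decreases there, and \<open>k 0 < 0\<close>. Two zeros \<open>u < v\<close> would give a critical
  point \<open>\<xi>\<close> between them and a point \<open>\<eta>\<close> beyond \<open>v\<close>
  with negative slope, against the monotone derivative.\<close>

lemma negative_real_char_root_unique:
  assumes s: "0 < a + b" and d: "a < b" and x: "x < 0" "y < 0"
    and roots: "complex_of_real x \<in> char_roots a b" "complex_of_real y \<in> char_roots a b"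
  shows "x = y"
proof -
  define k where "k x = (b - a) / 2 * tanh (x / 2) - (a + b) / 2 - x" for x
  have False if uv: "u < v" "v < 0" "k u = 0" "k v = 0" for u v
  proof -
    note deriv = tanh_half_deriv[of "(b - a) / 2" "(a + b) / 2", folded k_def]
    have "\<exists>\<xi>>u. \<xi> < v \<and> k v - k u = (v - u) * ((b - a) / 2 / 2 * (1 - (tanh (\<xi> / 2))\<^sup>2) - 1)"
      by (rule MVT2[OF uv(1)]) (rule deriv)
    then obtain \<xi> where \<xi>: "\<xi> < v" "(b - a) / 2 / 2 * (1 - (tanh (\<xi> / 2))\<^sup>2) = 1"
      using uv by auto
    have "\<exists>\<eta>>v. \<eta> < 0 \<and> k 0 - k v = (0 - v) * ((b - a) / 2 / 2 * (1 - (tanh (\<eta> / 2))\<^sup>2) - 1)"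
      by (rule MVT2[OF uv(2)]) (rule deriv)
    then obtain \<eta> where \<eta>: "v < \<eta>" "\<eta> < 0"
      "k 0 - k v = (0 - v) * ((b - a) / 2 / 2 * (1 - (tanh (\<eta> / 2))\<^sup>2) - 1)" by blast
    have "k 0 - k v < 0" using s uv by (simp add: k_def)
    then have "(b - a) / 2 / 2 * (1 - (tanh (\<eta> / 2))\<^sup>2) - 1 < 0"
      unfolding \<eta>(3) using uv(2) mult_nonneg_nonneg[of "0 - v"] by (meson diff_ge_0_iff_ge less_imp_le not_le)
    moreover have "\<bar>tanh (\<eta> / 2)\<bar> \<le> \<bar>tanh (\<xi> / 2)\<bar>"
    proof -
      have "tanh (\<xi> / 2) \<le> tanh (\<eta> / 2)" "tanh (\<eta> / 2) < 0" using \<xi> \<eta> by auto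
      then show ?thesis by simp
    qed
    then have "(tanh (\<eta> / 2))\<^sup>2 \<le> (tanh (\<xi> / 2))\<^sup>2" by (simp add: abs_le_square_iff)
    then have "(b - a) / 2 / 2 * (1 - (tanh (\<xi> / 2))\<^sup>2) \<le> (b - a) / 2 / 2 * (1 - (tanh (\<eta> / 2))\<^sup>2)"
      using d by (intro mult_left_mono) auto
    ultimately show False using \<xi>(2) by linarith
  qed
  moreover have "k x = 0" "k y = 0"
    using roots unfolding real_char_root_iff k_def by linarith+
  ultimately show ?thesis using x by (metis linorder_neqE_linordered_idom)
qed

lemma negative_real_char_root_exists:
  assumes s: "0 < a + b" and d: "a < b"
  obtains x where "x < 0" "complex_of_real x \<in> char_roots a b"
proof -
  define k where "k x = (b - a) / 2 * tanh (x / 2) - (a + b) / 2 - x" for x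
  have cont: "continuous_on {- b..0} k"
    using tanh_half_deriv[of "(b - a) / 2" "(a + b) / 2", folded k_def] DERIV_isCont
    by (intro continuous_at_imp_continuous_on) blast
  have "0 < b" using s d by simp
  \<comment> \<open>The point \<open>- b\<close> is chosen because
    \<open>b - (a + b) / 2 = (b - a) / 2\<close>: there \<open>k\<close> equals
    \<open>(b - a) / 2\<close> times \<open>1 + tanh (- b / 2)\<close>, which is positive.\<close>
  have "(b - a) / 2 * (- 1) \<le> (b - a) / 2 * tanh (- b / 2)"
    using d tanh_real_gt_neg1[of "- b / 2"] by (intro mult_left_mono) auto
  then have "0 \<le> k (- b)" by (simp add: k_def field_simps)
  moreover have "k 0 \<le> 0" using s by (simp add: k_def)
  ultimately obtain x where x: "- b \<le> x" "x \<le> 0" "k x = 0"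
    using IVT2'[of k 0 0 "- b"] cont \<open>0 < b\<close> by auto
  moreover have "k 0 \<noteq> 0" using s by (simp add: k_def)
  ultimately have "x < 0" by (cases "x = 0") auto
  moreover have "complex_of_real x \<in> char_roots a b"
    using x(3) unfolding real_char_root_iff k_def by linarith
  ultimately show ?thesis by (rule that)
qed

text \<open>For a nonreal root the imaginary part and
  \<open>\<bar>sin y\<bar> \<le> \<bar>y\<bar>\<close> give \<open>B \<le> (b - a) * E\<close>.
  Feeding this into the real part, with \<open>x \<le> 0\<close> and the bound for
  \<open>sinh\<close>, leaves \<open>(a + b) / 2 * B \<le> 0\<close>, impossible for positive
  \<open>B\<close>.\<close>

lemma char_roots_left_real:
  assumes s: "0 < a + b" and d: "a < b" and z: "z \<in> char_roots a b" and neg: "Re z < 0"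
  shows "Im z = 0"
proof (rule ccontr)
  assume y: "Im z \<noteq> 0"
  define E where "E = exp (Re z)"
  define B where "B = (E * cos (Im z) + 1)\<^sup>2 + (E * sin (Im z))\<^sup>2"
  have E: "0 < E" "E < 1" using neg by (simp_all add: E_def)
  have h1: "(Re z + (a + b) / 2) * B = (b - a) / 2 * (E\<^sup>2 - 1)"
    and h2: "Im z * B = 2 * ((b - a) / 2) * E * sin (Im z)"
    using char_roots_Re_Im[OF z] by (simp_all add: B_def E_def)
  have "E\<^sup>2 < 1" using E by (simp add: power_less_one_iff)
  then have "(b - a) / 2 * (E\<^sup>2 - 1) < 0" using d by (intro mult_pos_neg) auto
  then have "B \<noteq> 0" using h1 by auto
  moreover have "0 \<le> B" by (simp add: B_def)
  ultimately have B: "0 < B" by simp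
  have "\<bar>Im z\<bar> * B = 2 * ((b - a) / 2) * E * \<bar>sin (Im z)\<bar>"
    using arg_cong[OF h2, of abs] d E B by (simp add: abs_mult)
  also have "\<dots> \<le> 2 * ((b - a) / 2) * E * \<bar>Im z\<bar>"
    using d E by (intro mult_left_mono abs_sin_x_le_abs_x) auto
  finally have "B * \<bar>Im z\<bar> \<le> (2 * ((b - a) / 2) * E) * \<bar>Im z\<bar>" by (simp add: mult.commute)
  then have BE: "B \<le> 2 * ((b - a) / 2) * E"
    using y by (simp add: mult_le_cancel_right)
  have "(Re z + (a + b) / 2) * B \<le> (b - a) / 2 * (2 * E * Re z)"
    unfolding h1 using d neg exp_power2_minus_one_le[of "Re z"] by (intro mult_left_mono) (auto simp: E_def)
  also have "\<dots> = 2 * ((b - a) / 2) * E * Re z" by simp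
  also have "\<dots> \<le> B * Re z"
    using BE neg by (intro mult_right_mono_neg) auto
  finally have "(a + b) / 2 * B \<le> 0" by (simp add: algebra_simps)
  then show False using s B by (simp add: mult_le_0_iff)
qed

lemma unique_left_char_root:
  assumes s: "0 < a + b" and d: "a < b"
  obtains x where "x < 0" "complex_of_real x \<in> char_roots a b"
    "\<forall>z\<in>char_roots a b. Re z < 0 \<longrightarrow> z = of_real x"
proof -
  obtain x where x: "x < 0" "complex_of_real x \<in> char_roots a b"
    by (rule negative_real_char_root_exists[OF s d])
  have "z = of_real x" if z: "z \<in> char_roots a b" "Re z < 0" for z
  proof -
    have "z = of_real (Re z)"
      using char_roots_left_real[OF s d z] by (simp add: complex_eq_iff)
    then show ?thesis
      using negative_real_char_root_unique[OF s d z(2) x(1)] z(1) x(2) by metis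
  qed
  then show ?thesis using x that by blast
qed

text \<open>Time reversal preserves the coefficients, so excluding the right half-plane is enough. A
  real root \<open>x > 0\<close> would satisfy \<open>x = b * tanh (x / 2)\<close>, at most
  \<open>2 * tanh (x / 2) < x\<close>; this is where \<open>b \<le> 2\<close> enters. A nonreal root
  fails by the estimate of the imaginary part together with the strict bound for
  \<open>sinh\<close>.\<close>

lemma char_roots_antisymmetric_neg:
  assumes b: "0 < b" "b \<le> 2" and z: "z \<in> char_roots (- b) b"
  shows "Re z = 0"
proof -
  have pos: "Re z \<le> 0" if z: "z \<in> char_roots (- b) b" for z
  proof (rule ccontr)
    assume "\<not> Re z \<le> 0"
    then have x: "0 < Re z" by simp
    define E where "E = exp (Re z)"
    define B where "B = (E * cos (Im z) + 1)\<^sup>2 + (E * sin (Im z))\<^sup>2"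
    have E: "1 < E" using x by (simp add: E_def)
    have h1: "Re z * B = b * (E\<^sup>2 - 1)" and h2: "Im z * B = 2 * b * E * sin (Im z)"
      using char_roots_Re_Im[OF z] by (simp_all add: B_def E_def)
    have gt: "2 * E * Re z < E\<^sup>2 - 1"
      using exp_power2_minus_one_gt[OF x] by (simp add: E_def)
    show False
    proof (cases "Im z = 0")
      case True
      have "\<exists>u>0. u < Re z \<and> (2 * tanh (Re z / 2) - 0 - Re z) - (2 * tanh (0 / 2) - 0 - 0)
          = (Re z - 0) * (2 / 2 * (1 - (tanh (u / 2))\<^sup>2) - 1)"
        by (rule MVT2[OF x]) (rule tanh_half_deriv)
      then obtain u where u: "u > 0" "2 * tanh (Re z / 2) - Re z = - (Re z * (tanh (u / 2))\<^sup>2)"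
        by auto
      have "0 < Re z * (tanh (u / 2))\<^sup>2" using x u(1) by (intro mult_pos_pos) auto
      then have lt: "2 * tanh (Re z / 2) < Re z" using u(2) by linarith
      have "z = of_real (Re z)" using True by (simp add: complex_eq_iff)
      then have "of_real (Re z) \<in> char_roots (- b) b" using z by metis
      then have "Re z = b * tanh (Re z / 2)" by (simp add: real_char_root_iff)
      also have "\<dots> \<le> 2 * tanh (Re z / 2)" using b x by (intro mult_right_mono) auto
      finally show False using lt by simp
    next
      case False
      have "0 \<le> B" by (simp add: B_def)
      then have "\<bar>Im z\<bar> * B = 2 * b * E * \<bar>sin (Im z)\<bar>"
        using arg_cong[OF h2, of abs] b E by (simp add: abs_mult)
      also have "\<dots> \<le> 2 * b * E * \<bar>Im z\<bar>"
        using b E by (intro mult_left_mono abs_sin_x_le_abs_x) auto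
      finally have "B * \<bar>Im z\<bar> \<le> (2 * b * E) * \<bar>Im z\<bar>" by (simp add: mult.commute)
      then have "B \<le> 2 * b * E" using False by (simp add: mult_le_cancel_right)
      then have "Re z * B \<le> Re z * (2 * b * E)" using x by (intro mult_left_mono) auto
      also have "\<dots> = b * (2 * E * Re z)" by simp
      also have "\<dots> < b * (E\<^sup>2 - 1)" using gt b by (intro mult_strict_left_mono) auto
      finally show False using h1 by simp
    qed
  qed
  have "- z \<in> char_roots (- b) b" using z char_roots_uminus[of z b "- b"] by simp
  with pos[OF z] pos[of "- z"] show ?thesis by simp
qed

text \<open>For large imaginary parts the equation is the fixed point problem
  \<open>z = \<i> \<omega> + Ln ((z + b) / (z + a))\<close> with \<open>\<omega>\<close> an odd multiple of \<open>\<pi>\<close>.\<close>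

lemma nonreal_char_root_exists:
  obtains z where "z \<in> char_roots a b" "Im z \<noteq> 0"
proof -
  \<comment> \<open>The size of \<open>k\<close> forces \<open>cmod (w z) < 1 / 2\<close> on the
    unit disc around \<open>\<i> * of_real \<omega>\<close>. Then \<open>1 + w z\<close> stays off
    the branch cut of the logarithm, and \<open>norm_Ln_le\<close> bounds the logarithm by
    \<open>1\<close>, so \<open>G\<close> maps the disc into itself.\<close>
  obtain k :: nat where k: "2 + 2 * \<bar>b - a\<bar> < real k" using reals_Archimedean2 by blast
  define \<omega> where "\<omega> = (2 * real k + 1) * pi"
  have "real k * 1 \<le> (2 * real k + 1) * pi"
    using pi_gt3 by (intro mult_mono) auto
  then have \<omega>: "2 + 2 * \<bar>b - a\<bar> < \<omega>" using k by (simp add: \<omega>_def)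
  have \<omega>2: "2 < \<omega>" by (rule order_le_less_trans[OF _ \<omega>]) simp
  define w where "w z = of_real (b - a) / (z + of_real a)" for z :: complex
  define G where "G z = \<i> * of_real \<omega> + Ln (1 + w z)" for z
  let ?S = "cball (\<i> * of_real \<omega>) 1"
  have Imz: "\<omega> - 1 \<le> Im z" if "z \<in> ?S" for z
  proof -
    have "\<bar>Im (\<i> * of_real \<omega> - z)\<bar> \<le> cmod (\<i> * of_real \<omega> - z)" by (rule abs_Im_le_cmod)
    then show ?thesis using that by (simp add: dist_norm)
  qed
  have nz: "z + of_real a \<noteq> 0" if "z \<in> ?S" for z
  proof -
    have "0 < Im z" using Imz[OF that] \<omega>2 by linarith
    then have "0 < Im (z + of_real a)" by simp
    then show ?thesis by (metis less_irrefl zero_complex.sel(2))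
  qed
  have small: "cmod (w z) < 1 / 2" if "z \<in> ?S" for z
  proof -
    have "\<omega> - 1 \<le> cmod (z + of_real a)"
      using Imz[OF that] abs_Im_le_cmod[of "z + of_real a"] by simp
    then have "2 * \<bar>b - a\<bar> < cmod (z + of_real a)" "0 < cmod (z + of_real a)"
      using \<omega> \<omega>2 by linarith+
    then have "\<bar>b - a\<bar> / cmod (z + of_real a) < 1 / 2"
      by (simp add: pos_divide_less_eq)
    moreover have "cmod (w z) = \<bar>b - a\<bar> / cmod (z + of_real a)"
      unfolding w_def norm_divide by (simp only: norm_of_real)
    ultimately show ?thesis by simp
  qed
  have pos: "1 + w z \<notin> \<real>\<^sub>\<le>\<^sub>0" if "z \<in> ?S" for z
  proof -
    have "0 < Re (1 + w z)" using abs_Re_le_cmod[of "w z"] small[OF that] by simp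
    then show ?thesis by (auto simp: complex_nonpos_Reals_iff)
  qed
  have "continuous_on ?S G"
    unfolding G_def w_def using nz pos unfolding w_def by (intro continuous_intros) auto
  moreover have "G \<in> ?S \<rightarrow> ?S"
  proof
    fix z assume z: "z \<in> ?S"
    have "cmod (Ln (1 + w z)) \<le> 2 * cmod (w z)" using small[OF z] by (rule norm_Ln_le)
    then show "G z \<in> ?S" using small[OF z] by (simp add: G_def dist_norm)
  qed
  ultimately obtain z where z: "z \<in> ?S" "G z = z"
    using brouwer[of ?S G] by auto
  have "1 + w z \<noteq> 0" using pos[OF z(1)] by auto
  then have "exp z = exp (\<i> * of_real \<omega>) * (1 + w z)"
    using arg_cong[OF z(2), of exp] by (simp add: G_def exp_add exp_Ln)
  moreover have "exp (\<i> * of_real \<omega>) = -1"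
  proof -
    have "\<i> * of_real \<omega> = \<i> * of_real pi + of_nat k * (2 * of_real pi * \<i>)"
      by (simp add: \<omega>_def algebra_simps)
    then show ?thesis
      using exp_plus_2pin[of "\<i> * of_real pi" "int k"] by (simp add: mult.commute mult.left_commute)
  qed
  ultimately have "exp z = - (1 + w z)" by simp
  then have "(z + of_real a) * exp z = - (z + of_real b)"
    using nz[OF z(1)] by (simp add: w_def field_simps)
  then have "z \<in> char_roots a b" by (simp add: char_roots_iff)
  moreover have "Im z \<noteq> 0" using Imz[OF z(1)] \<omega>2 by linarith
  ultimately show ?thesis by (rule that)
qed

section \<open>Instability\<close>

lemma primitive_on_C1:
  assumes "\<And>t. (Y has_real_derivative p t) (at t)"
  shows "primitive_on U Y p"
  unfolding primitive_on_def
proof (intro allI impI)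
  fix s t :: real assume "s \<le> t \<and> {s..t} \<subseteq> U"
  then show "(p has_integral Y t - Y s) {s..t}"
    by (intro fundamental_theorem_of_calculus
        has_field_derivative_at_within[OF assms, unfolded has_real_derivative_iff_has_vector_derivative]) simp
qed

lemma has_weak_deriv_C1:
  assumes Y: "\<And>t. (Y has_real_derivative p t) (at t)" and p: "continuous_on UNIV p" and V: "open V"
  shows "has_weak_deriv V Y p"
proof (rule has_weak_deriv_subset[OF _ subset_UNIV open_UNIV V])
  have lp: "locally_integrable_on UNIV p"
    by (rule locally_integrable_on_spike_continuous[of _ p "{}"]) (use p in auto)
  show "has_weak_deriv UNIV Y p"
    by (rule primitive_on_imp_has_weak_deriv[OF open_UNIV _ lp primitive_on_C1[OF Y] negligible_empty]) auto
qed

lemma H1_C1: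
  assumes Y: "\<And>t. (Y has_real_derivative p t) (at t)" and p: "continuous_on UNIV p"
    and V: "open V" "bounded V"
  shows "Y \<in> H1 V"
proof -
  obtain r where r: "V \<subseteq> {- r..r}"
    using V(2) unfolding bounded_iff by (auto simp: abs_le_iff) (metis atLeastAtMost_iff minus_le_iff subsetI)
  have sq: "square_integrable_on V f" if "continuous_on UNIV f" for f
  proof (rule square_integrable_on_subset[OF _ r])
    show "square_integrable_on {- r..r} f"
      using that by (intro square_integrable_on_continuous) (rule continuous_on_subset, auto)
  qed (use V in auto)
  have "continuous_on UNIV Y"
    using Y DERIV_isCont by (intro continuous_at_imp_continuous_on) blast
  then show ?thesis
    using sq[of Y] sq[OF p] has_weak_deriv_C1[OF Y p V(1)] by (auto simp: H1_def)
qed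

lemma classical_solution:
  assumes Y: "\<And>t. (Y has_real_derivative p t) (at t)" and p: "continuous_on UNIV p"
    and eq: "\<And>t. p t + p (t - 1) + a * Y t + b * Y (t - 1) = 0"
  shows "neutral_solution a b Y Y" "mild_solution a b Y p"
proof -
  show "neutral_solution a b Y Y"
    unfolding neutral_solution_def
  proof (intro conjI exI[of _ p])
    show "Y \<in> H1 {-1<..<0}" by (rule H1_C1[OF Y p]) auto
    show "Y \<in> H1_loc {-1<..}"
      unfolding H1_loc_def using H1_C1[OF Y p] bounded_subset[OF compact_imp_bounded closure_subset] by blast
    show "has_weak_deriv {-1<..} Y p" by (rule has_weak_deriv_C1[OF Y p]) simp
  qed (use eq in auto)
  show "mild_solution a b Y p"
  proof
    show "primitive_on {-1..} Y p" using Y by (rule primitive_on_C1)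
    show "square_integrable_on {-1..T} p" for T
      by (intro square_integrable_on_continuous continuous_on_subset[OF p]) auto
  qed (use eq in \<open>auto intro!: exI[of _ "{}"]\<close>)
qed

text \<open>After a full period of the oscillation the mode is multiplied by a positive real number,
  so growth can be read off at multiples of \<open>T\<close> without estimating the oscillating
  factor.\<close>

lemma exp_char_root_period:
  obtains T where "T > 0" "exp (z * of_real T) = of_real (exp (Re z * T))"
proof -
  define T where "T = (if Im z = 0 then 1 else 2 * pi / \<bar>Im z\<bar>)"
  have T: "T > 0" by (simp add: T_def)
  have "cis (Im z * T) = 1"
    by (auto simp: T_def complex_eq_iff abs_if)
  then have "exp (z * of_real T) = of_real (exp (Re z * T))"
    by (subst exp_eq_polar) simp
  with T show ?thesis by (rule that)
qed

lemma history_energy_scale: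
  "history_energy (\<lambda>x. k * Y x) (\<lambda>x. k * p x) t = k\<^sup>2 * history_energy Y p t"
  by (simp add: history_energy_def power_mult_distrib algebra_simps)

lemma history_energy_shift:
  "history_energy Y p (t + h) = history_energy (\<lambda>x. Y (x + h)) (\<lambda>x. p (x + h)) t"
  unfolding history_energy_def
  using integral_shift_Icc[of "t - 1" t "\<lambda>x. (Y x)\<^sup>2" h] integral_shift_Icc[of "t - 1" t "\<lambda>x. (p x)\<^sup>2" h]
  by (simp add: algebra_simps)

theorem zero_unstable_char_root:
  assumes z: "z \<in> char_roots a b" and pos: "Re z > 0"
  shows "zero_unstable a b"
proof
  assume stable: "zero_stable a b"
  define Y where "Y t = Re (exp (z * of_real t))" for t
  define p where "p t = Re (z * exp (z * of_real t))" for t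
  have deriv: "(Y has_real_derivative p t) (at t)" for t
  proof -
    have "((\<lambda>w. exp (z * w)) has_field_derivative z * exp (z * of_real t)) (at (of_real t))"
      by (auto intro!: derivative_eq_intros)
    then have "((\<lambda>t. exp (z * of_real t)) has_vector_derivative z * exp (z * of_real t)) (at t)"
      by (rule has_vector_derivative_real_field)
    from bounded_linear.has_vector_derivative[OF bounded_linear_Re this]
    show ?thesis
      unfolding Y_def[abs_def] p_def has_real_derivative_iff_has_vector_derivative .
  qed
  have cont: "continuous_on UNIV p"
    unfolding p_def by (intro continuous_intros)
  have eq: "p t + p (t - 1) + a * Y t + b * Y (t - 1) = 0" for t
  proof -
    have e: "exp (z * of_real t) = exp z * exp (z * of_real (t - 1))"
      by (simp add: algebra_simps flip: exp_add)
    have "p t + p (t - 1) + a * Y t + b * Y (t - 1)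
        = Re (z * exp (z * of_real t) + z * exp (z * of_real (t - 1))
          + of_real a * exp (z * of_real t) + of_real b * exp (z * of_real (t - 1)))"
      by (simp add: p_def Y_def)
    also have "z * exp (z * of_real t) + z * exp (z * of_real (t - 1))
          + of_real a * exp (z * of_real t) + of_real b * exp (z * of_real (t - 1))
        = exp (z * of_real (t - 1)) * (z * (exp z + 1) + of_real a * exp z + of_real b)"
      unfolding e by (simp add: algebra_simps)
    also have "\<dots> = 0" using z by (simp add: char_roots_def)
    finally show ?thesis by simp
  qed
  obtain T where T: "T > 0" "exp (z * of_real T) = of_real (exp (Re z * T))"
    by (rule exp_char_root_period)
  define r where "r = exp (Re z * T)"
  have r: "r > 1" using T pos by (simp add: r_def)
  have shift: "exp (z * of_real (t + real n * T)) = of_real (r ^ n) * exp (z * of_real t)" for t n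
  proof -
    have "z * of_real (t + real n * T) = of_nat n * (z * of_real T) + z * of_real t"
      by (simp add: algebra_simps)
    then show ?thesis
      by (simp add: exp_add exp_of_nat_mult T(2) r_def)
  qed
  have Ysh: "Y (t + real n * T) = r ^ n * Y t" and psh: "p (t + real n * T) = r ^ n * p t" for t n
    unfolding Y_def p_def shift by (simp_all add: algebra_simps)
  have H: "history_energy Y p (real n * T) = (r ^ n)\<^sup>2 * history_energy Y p 0" for n
    using history_energy_shift[of Y p 0 "real n * T"] by (simp add: Ysh psh history_energy_scale)
  \<comment> \<open>\<open>Y 0 = 1\<close>, so the Sobolev embedding rules out a vanishing initial
    norm.\<close>
  have "(Y 0)\<^sup>2 \<le> 2 * history_energy Y p 0"
    by (rule mild_solution.Y_power2_le_history_energy[OF classical_solution(2)[OF deriv cont eq]]) auto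
  then have H0: "0 < history_energy Y p 0" by (simp add: Y_def)
  obtain \<delta> where \<delta>: "\<delta> > 0" and bound: "\<And>y0 y t. neutral_solution a b y0 y \<Longrightarrow> H1_norm {-1<..<0} y0 < \<delta> \<Longrightarrow>
      0 \<le> t \<Longrightarrow> state_norm y t < 1"
    using stable[unfolded zero_stable_def, rule_format, of 1] by auto
  \<comment> \<open>Normalizes the initial norm to \<open>\<delta> / 2\<close>; each period
    \<open>T\<close> then multiplies the norm by \<open>r > 1\<close>.\<close>
  define k where "k = \<delta> / (2 * sqrt (history_energy Y p 0))"
  have k: "k > 0" using \<delta> H0 by (simp add: k_def)
  define Z where "Z t = k * Y t" for t
  define q where "q t = k * p t" for t
  have Zd: "(Z has_real_derivative q t) (at t)" for t
    unfolding Z_def q_def by (intro DERIV_cmult deriv)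
  have qc: "continuous_on UNIV q"
    unfolding q_def using cont by (intro continuous_intros)
  have Zeq: "q t + q (t - 1) + a * Z t + b * Z (t - 1) = 0" for t
  proof -
    have "q t + q (t - 1) + a * Z t + b * Z (t - 1) = k * (p t + p (t - 1) + a * Y t + b * Y (t - 1))"
      by (simp add: q_def Z_def algebra_simps)
    then show ?thesis by (simp add: eq)
  qed
  note Zsol = classical_solution[OF Zd qc Zeq]
  have ZH: "history_energy Z q t = k\<^sup>2 * history_energy Y p t" for t
    using history_energy_scale[of k Y p t] by (simp add: Z_def[abs_def] q_def[abs_def])
  have norm: "H1_norm {-1<..<0} (\<lambda>s. Z (t + s)) = k * sqrt (history_energy Y p t)" if "0 \<le> t" for t
    using H1_norm_primitive[OF mild_solution.primitive[OF Zsol(2)] mild_solution.square_integrable[OF Zsol(2)] that,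
        of "{}" "\<lambda>s. Z (t + s)"] k
    by (simp add: ZH real_sqrt_mult)
  have "H1_norm {-1<..<0} Z = \<delta> / 2"
    using norm[of 0] H0 by (simp add: k_def)
  then have small: "H1_norm {-1<..<0} Z < \<delta>" using \<delta> by simp
  obtain n where n: "2 / \<delta> < r ^ n" using real_arch_pow[OF r] by blast
  have "state_norm Z (real n * T) = k * sqrt (history_energy Y p (real n * T))"
    unfolding state_norm_def using T by (intro norm) auto
  also have "\<dots> = r ^ n * (\<delta> / 2)"
    using H0 r by (simp add: H real_sqrt_mult k_def)
  also have "\<dots> > 1" using n \<delta> by (simp add: field_simps)
  finally show False
    using bound[OF Zsol(1) small, of "real n * T"] T by simp
qed

section \<open>The unstable regions of the parameter plane\<close>

lemma unstable_all_right:
  assumes ab: "b < - \<bar>a\<bar>"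
  shows "zero_unstable a b \<and> (\<forall>z\<in>char_roots a b. Re z > 0)"
proof -
  \<comment> \<open>The bound on real parts would hold vacuously for an empty spectrum; instability
    requires an actual root.\<close>
  obtain z where z: "z \<in> char_roots a b" "Im z \<noteq> 0" by (rule nonreal_char_root_exists)
  show ?thesis
    using zero_unstable_char_root[OF z(1) char_roots_Re_pos[OF ab z(1)]] char_roots_Re_pos[OF ab] by simp
qed

lemma unstable_one_left:
  assumes ab: "b > \<bar>a\<bar>"
  shows "zero_unstable a b \<and>
      (\<exists>z0\<in>char_roots a b. Re z0 < 0 \<and> (\<forall>z\<in>char_roots a b - {z0}. Re z > 0))"
proof -
  have s: "0 < a + b" and d: "a < b" using ab by auto
  obtain x where x: "x < 0" "complex_of_real x \<in> char_roots a b"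
    "\<forall>z\<in>char_roots a b. Re z < 0 \<longrightarrow> z = of_real x"
    by (rule unique_left_char_root[OF s d])
  have pos: "Re z > 0" if "z \<in> char_roots a b" "z \<noteq> of_real x" for z
  proof -
    have "Re z \<noteq> 0" by (rule char_roots_Re_nonzero[OF _ that(1)]) (use ab in auto)
    moreover have "\<not> Re z < 0" using x(3) that by blast
    ultimately show ?thesis by linarith
  qed
  \<comment> \<open>A nonreal root differs from the exceptional real root \<open>x\<close> and
    therefore lies in the right half-plane.\<close>
  obtain z where z: "z \<in> char_roots a b" "Im z \<noteq> 0" by (rule nonreal_char_root_exists)
  then have "Re z > 0" by (intro pos) auto
  with z(1) have "zero_unstable a b" by (rule zero_unstable_char_root)
  with x(1,2) pos show ?thesis
    by (intro conjI bexI[of _ "complex_of_real x"]) auto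
qed

text \<open>The region \<open>b > \<bar>a\<bar>\<close> under time reversal. Here the exceptional
  root itself causes the instability.\<close>

lemma unstable_one_right:
  assumes ab: "a < - \<bar>b\<bar>"
  shows "zero_unstable a b \<and>
      (\<exists>z0\<in>char_roots a b. Re z0 > 0 \<and> (\<forall>z\<in>char_roots a b - {z0}. Re z < 0))"
proof -
  have s: "0 < - b + - a" and d: "- b < - a" using ab by auto
  obtain x where x: "x < 0" "complex_of_real x \<in> char_roots (- b) (- a)"
    "\<forall>z\<in>char_roots (- b) (- a). Re z < 0 \<longrightarrow> z = of_real x"
    by (rule unique_left_char_root[OF s d])
  have root: "complex_of_real (- x) \<in> char_roots a b"
    using x(2) char_roots_uminus[of "complex_of_real (- x)" b a] by simp
  have neg: "Re z < 0" if z: "z \<in> char_roots a b" "z \<noteq> of_real (- x)" for z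
  proof -
    have "Re z \<noteq> 0" by (rule char_roots_Re_nonzero[OF _ z(1)]) (use ab in auto)
    moreover have "\<not> Re z > 0"
    proof
      assume "Re z > 0"
      then have "- z = of_real x" using x(3) z(1) char_roots_uminus[of z b a] by simp
      then show False using z(2) by (metis minus_minus of_real_minus)
    qed
    ultimately show ?thesis by linarith
  qed
  have "zero_unstable a b"
    by (rule zero_unstable_char_root[OF root]) (use x(1) in simp)
  with root x(1) neg show ?thesis
    by (intro conjI bexI[of _ "complex_of_real (- x)"]) auto
qed

lemma unstable_negative_diagonal:
  assumes ab: "a = b \<and> b < 0"
  shows "zero_unstable a b \<and> of_real (- a) \<in> char_roots a b \<and> - a > 0 \<and>
      (\<forall>z\<in>char_roots a b - {of_real (- a)}. Re z = 0)"
proof -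
  have root: "of_real (- a) \<in> char_roots a b"
    using ab char_roots_diagonal[of _ a] by blast
  have "zero_unstable a b"
    by (rule zero_unstable_char_root[OF root]) (use ab in simp)
  then show ?thesis
    using root ab char_roots_diagonal[of _ a] exp_eq_minus_one_imp_Re by auto
qed

theorem theorem2:
  fixes a b :: real
  shows
    "(a > \<bar>b\<bar> \<longrightarrow>
        zero_asymptotically_stable a b \<and> (\<forall>z\<in>char_roots a b. Re z < 0)) \<and>
     (b < - \<bar>a\<bar> \<longrightarrow>
        zero_unstable a b \<and> (\<forall>z\<in>char_roots a b. Re z > 0)) \<and>
     (b > \<bar>a\<bar> \<longrightarrow>
        zero_unstable a b \<and>
        (\<exists>z0\<in>char_roots a b. Re z0 < 0 \<and> (\<forall>z\<in>char_roots a b - {z0}. Re z > 0))) \<and>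
     (a < - \<bar>b\<bar> \<longrightarrow>
        zero_unstable a b \<and>
        (\<exists>z0\<in>char_roots a b. Re z0 > 0 \<and> (\<forall>z\<in>char_roots a b - {z0}. Re z < 0))) \<and>
     (a = \<bar>b\<bar> \<and> a \<noteq> 0 \<longrightarrow>
        zero_stable a b \<and>
        (b > 0 \<longrightarrow> of_real (- a) \<in> char_roots a b \<and> - a < 0 \<and>
                  (\<forall>z\<in>char_roots a b - {of_real (- a)}. Re z = 0)) \<and>
        (\<not> b > 0 \<longrightarrow> (\<forall>z\<in>char_roots a b. Re z = 0))) \<and>
     (- a = b \<and> b > 0 \<longrightarrow>
        (b < 2 \<longrightarrow> zero_stable a b) \<and>
        (b \<le> 2 \<longrightarrow> (\<forall>z\<in>char_roots a b. Re z = 0))) \<and>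
     (a = b \<and> b < 0 \<longrightarrow>
        zero_unstable a b \<and>
        of_real (- a) \<in> char_roots a b \<and> - a > 0 \<and>
        (\<forall>z\<in>char_roots a b - {of_real (- a)}. Re z = 0)) \<and>
     (a = 0 \<and> b = 0 \<longrightarrow> zero_stable a b)"
proof (intro conjI)
  show "a > \<bar>b\<bar> \<longrightarrow> zero_asymptotically_stable a b \<and> (\<forall>z\<in>char_roots a b. Re z < 0)"
    using zero_asymptotically_stable_dissipative char_roots_Re_neg by blast
next
  show "b < - \<bar>a\<bar> \<longrightarrow> zero_unstable a b \<and> (\<forall>z\<in>char_roots a b. Re z > 0)"
    using unstable_all_right by blast
next
  show "b > \<bar>a\<bar> \<longrightarrow> zero_unstable a b \<and>
      (\<exists>z0\<in>char_roots a b. Re z0 < 0 \<and> (\<forall>z\<in>char_roots a b - {z0}. Re z > 0))"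
    using unstable_one_left by blast
next
  show "a < - \<bar>b\<bar> \<longrightarrow> zero_unstable a b \<and>
      (\<exists>z0\<in>char_roots a b. Re z0 > 0 \<and> (\<forall>z\<in>char_roots a b - {z0}. Re z < 0))"
    using unstable_one_right by blast
next
  show "a = \<bar>b\<bar> \<and> a \<noteq> 0 \<longrightarrow> zero_stable a b \<and>
      (b > 0 \<longrightarrow> of_real (- a) \<in> char_roots a b \<and> - a < 0 \<and>
        (\<forall>z\<in>char_roots a b - {of_real (- a)}. Re z = 0)) \<and>
      (\<not> b > 0 \<longrightarrow> (\<forall>z\<in>char_roots a b. Re z = 0))"
  proof (intro impI conjI)
    assume ab: "a = \<bar>b\<bar> \<and> a \<noteq> 0"
    show "zero_stable a b" using ab by (intro zero_stable_dissipative) auto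
    show "of_real (- a) \<in> char_roots a b" "- a < 0" "\<forall>z\<in>char_roots a b - {of_real (- a)}. Re z = 0"
      if "b > 0"
    proof -
      have "b = a" using ab that by simp
      then show "of_real (- a) \<in> char_roots a b" "- a < 0" "\<forall>z\<in>char_roots a b - {of_real (- a)}. Re z = 0"
        using that char_roots_diagonal[of _ a] exp_eq_minus_one_imp_Re by auto
    qed
    show "\<forall>z\<in>char_roots a b. Re z = 0" if "\<not> b > 0"
    proof -
      have "b = - a" "a > 0" using ab that by auto
      then show ?thesis using char_roots_antisymmetric_pos by blast
    qed
  qed
next
  show "- a = b \<and> b > 0 \<longrightarrow> (b < 2 \<longrightarrow> zero_stable a b) \<and> (b \<le> 2 \<longrightarrow> (\<forall>z\<in>char_roots a b. Re z = 0))"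
  proof (intro impI conjI)
    assume ab: "- a = b \<and> b > 0"
    show "zero_stable a b" if "b < 2" using ab that by (intro zero_stable_balanced) auto
    show "\<forall>z\<in>char_roots a b. Re z = 0" if "b \<le> 2"
    proof -
      have "a = - b" using ab by simp
      then show ?thesis using char_roots_antisymmetric_neg[of b] ab that by blast
    qed
  qed
next
  show "a = b \<and> b < 0 \<longrightarrow> zero_unstable a b \<and> of_real (- a) \<in> char_roots a b \<and> - a > 0 \<and>
      (\<forall>z\<in>char_roots a b - {of_real (- a)}. Re z = 0)"
    using unstable_negative_diagonal by blast
next
  show "a = 0 \<and> b = 0 \<longrightarrow> zero_stable a b"
    by (intro impI zero_stable_balanced) auto
qed

end
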